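(* (Mean value theorem) Let $\Omega\subset\mathbb R^n$ be open, let $x,y\in\Omega$ with $x\ne y$ and $[x,y]\subset\Omega$, and let $f\in W^{1,p}_{\rm loc}(\Omega,\mathbb R^m)$ for $n<p\le\infty$. If there is some $\tilde\delta>0$ with $$Df\,(y-x)\in L^\infty([x,y]_{\tilde\delta},\mathbb R^m),$$ then for all $\mathcal L^n$-densities $\mathrm{dens}_{[x,y]}^\Omega\in\mathcal L^n\text{-}\mathrm{Dens}_{[x,y]}^\Omega$ we have $$f(y)-f(x)=\Big(\int_\Omega Df\,d\,\mathrm{dens}_{[x,y]}^\Omega\Big)\,(y-x) .$$
   Context: $[x,y]$ is the closed segment joining $x$ and $y$, and $C_\delta$ is the open $\delta$-neighborhood of a set $C\subset\mathbb R^n$ (in the hypothesis, $[x,y]_{\tilde\delta}$ is understood to lie in $\Omega$, where $Df$ is defined). $W^{1,p}_{\rm loc}(\Omega,\mathbb R^m)$ is the usual local Sobolev space (of equivalence classes); since $p>n$, $f$ is identified with its continuous representative, which is differentiable $\mathcal L^n$-a.e., and $Df$ is the derivative ($m\times n$-matrix valued), which agrees $\mathcal L^n$-a.e. with the weak derivative. $\mathcal L^n$ is Lebesgue measure, $\mathcal B(\Omega)$ the Borel subsets of $\Omega$, $\overline\Omega$ the closure of $\Omega$ in $\mathbb R^n$. $\mathrm{ba}(\Omega,\mathcal B(\Omega),\mathcal L^n)$ is the space of bounded finitely additive set functions $\mu:\mathcal B(\Omega)\to\mathbb R$ with $\mu(A)=0$ whenever $\mathcal L^n(A)=0$. For a nonempty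 closed $C\subset\overline\Omega$ with $\mathcal L^n(C\cap\Omega)=0$ (a standing assumption, which for $C=[x,y]\subset\Omega$ means $n\ge2$) and $\mathcal L^n(C_\delta\cap\Omega)>0$ for all $\delta>0$, $\mathcal L^n\text{-}\mathrm{Dens}_C^\Omega$ is the set of all $\mu\in\mathrm{ba}(\Omega,\mathcal B(\Omega),\mathcal L^n)$ with $$\liminf_{\delta\downarrow0}\frac{\mathcal L^n(A\cap\Omega\cap C_\delta)}{\mathcal L^n(\Omega\cap C_\delta)}\le\mu(A)\le\limsup_{\delta\downarrow0}\frac{\mathcal L^n(A\cap\Omega\cap C_\delta)}{\mathcal L^n(\Omega\cap C_\delta)}\quad\forall A\in\mathcal B(\Omega).$$ Such $\mu$ are positive with $\mu(C_\delta\cap\Omega)=\mu(\Omega)=1$ for all $\delta>0$. Integral: for $\mu\ge0$ in this space put $\mu^*(A)=\inf\{\mu(B):A\subset B\in\mathcal B(\Omega)\}$. A function $g:\Omega\to\mathbb R$ is $\mu$-integrable if there are Borel step functions (finitely many values) $h_k$ with $\mu^*(\{|h_k-g|>\varepsilon\})\to0$ for all $\varepsilon>0$ and $\int_\Omega|h_k-h_l|\,d\mu\to0$ as $k,l\to\infty$; then $\int_\Omega g\,d\mu=\lim_k\int_\Omega h_k\,d\mu$. It depends only on the $\mathcal L^n$-a.e. class of $g$, and here only on the values of $g$ on $[x,y]_\delta$ for arbitrarily small $\delta>0$. Vector and matrix functions are treated componentwise.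
   Formalization: Since Df itself need not be integrable (e.g. f = |z_2|^a near a segment on the first axis), the formula is proved as f(y)-f(x) = ∫ Df (y-x) d dens, including integrability, and in the stated form with ∫ Df applied to y-x whenever the entries of Df are integrable. *)

theory Defs
  imports "HOL-Analysis.Analysis"
begin

section \<open>Sobolev functions\<close>

definition Lp_on :: "ennreal \<Rightarrow> (real^'n::finite) set \<Rightarrow> (real^'n \<Rightarrow> 'b::real_normed_vector) \<Rightarrow> bool" where
  "Lp_on p S g \<longleftrightarrow> g \<in> borel_measurable (lebesgue_on S) \<and>
     (if p = top then \<exists>M. AE z in lebesgue_on S. norm (g z) \<le> M
      else integrable (lebesgue_on S) (\<lambda>z. norm (g z) powr enn2real p))"

definition Lp_loc :: "ennreal \<Rightarrow> (real^'n::finite) set \<Rightarrow> (real^'n \<Rightarrow> 'b::real_normed_vector) \<Rightarrow> bool" where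
  "Lp_loc p \<Omega> g \<longleftrightarrow> (\<forall>K. compact K \<and> K \<subseteq> \<Omega> \<longrightarrow> Lp_on p K g)"

definition pdiff :: "'n::finite \<Rightarrow> (real^'n \<Rightarrow> real) \<Rightarrow> real^'n \<Rightarrow> real" where
  "pdiff j \<phi> z = frechet_derivative \<phi> (at z) (axis j 1)"

primrec Ck :: "nat \<Rightarrow> (real^'n::finite \<Rightarrow> real) \<Rightarrow> bool" where
  "Ck 0 \<phi> \<longleftrightarrow> continuous_on UNIV \<phi>"
| "Ck (Suc k) \<phi> \<longleftrightarrow> (\<forall>z. \<phi> differentiable (at z)) \<and> (\<forall>j. Ck k (pdiff j \<phi>))"

text \<open>Test functions are taken on the whole space; those in \<open>C\<^sub>c\<^sup>\<infinity>(\<Omega>)\<close> are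
  exactly the restrictions, extended by zero.\<close>

definition test_functions :: "(real^'n::finite) set \<Rightarrow> (real^'n \<Rightarrow> real) set" where
  "test_functions \<Omega> = {\<phi>. (\<forall>k. Ck k \<phi>) \<and>
     compact (closure {z. \<phi> z \<noteq> 0}) \<and> closure {z. \<phi> z \<noteq> 0} \<subseteq> \<Omega>}"

definition weak_jacobian ::
  "(real^'n::finite) set \<Rightarrow> (real^'n \<Rightarrow> real^'m::finite) \<Rightarrow> (real^'n \<Rightarrow> real^'n^'m) \<Rightarrow> bool" where
  "weak_jacobian \<Omega> f G \<longleftrightarrow> Lp_loc 1 \<Omega> f \<and> Lp_loc 1 \<Omega> G \<and>
     (\<forall>\<phi>\<in>test_functions \<Omega>. \<forall>i j.
        (LINT z:\<Omega>|lebesgue. f z $ i * pdiff j \<phi> z) = - (LINT z:\<Omega>|lebesgue. G z $ i $ j * \<phi> z))"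

definition sobolev_loc :: "ennreal \<Rightarrow> (real^'n::finite) set \<Rightarrow> (real^'n \<Rightarrow> real^'m::finite) \<Rightarrow> bool" where
  "sobolev_loc p \<Omega> f \<longleftrightarrow> Lp_loc p \<Omega> f \<and> (\<exists>G. weak_jacobian \<Omega> f G \<and> Lp_loc p \<Omega> G)"

section \<open>Finitely additive measures and densities\<close>

definition borel_subsets :: "'a::topological_space set \<Rightarrow> 'a set set" where
  "borel_subsets \<Omega> = {A \<in> sets borel. A \<subseteq> \<Omega>}"

text \<open>Set functions are total; only their values on \<open>borel_subsets \<Omega>\<close> matter.\<close>

definition ba :: "(real^'n::finite) set \<Rightarrow> ((real^'n) set \<Rightarrow> real) set" where
  "ba \<Omega> = {\<mu>.
     (\<forall>A\<in>borel_subsets \<Omega>. \<forall>B\<in>borel_subsets \<Omega>. A \<inter> B = {} \<longrightarrow> \<mu> (A \<union> B) = \<mu> A + \<mu> B) \<and>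
     (\<exists>M. \<forall>A\<in>borel_subsets \<Omega>. \<bar>\<mu> A\<bar> \<le> M) \<and>
     (\<forall>A\<in>borel_subsets \<Omega>. emeasure lborel A = 0 \<longrightarrow> \<mu> A = 0)}"

definition nbhd :: "'a::metric_space set \<Rightarrow> real \<Rightarrow> 'a set" where
  "nbhd C \<delta> = (\<Union>c\<in>C. ball c \<delta>)"

definition density_ratio :: "(real^'n::finite) set \<Rightarrow> (real^'n) set \<Rightarrow> (real^'n) set \<Rightarrow> real \<Rightarrow> ereal" where
  "density_ratio \<Omega> C A \<delta> =
     ereal (measure lborel (A \<inter> \<Omega> \<inter> nbhd C \<delta>) / measure lborel (\<Omega> \<inter> nbhd C \<delta>))"

text \<open>Intended for nonempty closed \<open>C \<subseteq> closure \<Omega>\<close> such that \<open>C \<inter> \<Omega>\<close> is Lebesgue null and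
  \<open>\<Omega> \<inter> nbhd C \<delta>\<close> has positive and (for small \<open>\<delta>\<close>) finite measure.\<close>

definition Dens :: "(real^'n::finite) set \<Rightarrow> (real^'n) set \<Rightarrow> ((real^'n) set \<Rightarrow> real) set" where
  "Dens \<Omega> C = {\<mu> \<in> ba \<Omega>. \<forall>A\<in>borel_subsets \<Omega>.
     Liminf (at_right 0) (density_ratio \<Omega> C A) \<le> ereal (\<mu> A) \<and>
     ereal (\<mu> A) \<le> Limsup (at_right 0) (density_ratio \<Omega> C A)}"

section \<open>The integral for positive finitely additive measures\<close>

definition outer :: "'a::topological_space set \<Rightarrow> ('a set \<Rightarrow> real) \<Rightarrow> 'a set \<Rightarrow> real" where
  "outer \<Omega> \<mu> A = Inf {\<mu> B | B. B \<in> borel_subsets \<Omega> \<and> A \<subseteq> B}"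

definition step_function :: "'a::topological_space set \<Rightarrow> ('a \<Rightarrow> real) \<Rightarrow> bool" where
  "step_function \<Omega> h \<longleftrightarrow> simple_function (restrict_space borel \<Omega>) h"

definition step_integral :: "'a set \<Rightarrow> ('a set \<Rightarrow> real) \<Rightarrow> ('a \<Rightarrow> real) \<Rightarrow> real" where
  "step_integral \<Omega> \<mu> h = (\<Sum>v\<in>h ` \<Omega>. v * \<mu> (h -` {v} \<inter> \<Omega>))"

definition approximates ::
  "'a::topological_space set \<Rightarrow> ('a set \<Rightarrow> real) \<Rightarrow> (nat \<Rightarrow> 'a \<Rightarrow> real) \<Rightarrow> ('a \<Rightarrow> real) \<Rightarrow> bool" where
  "approximates \<Omega> \<mu> h g \<longleftrightarrow>
     (\<forall>k. step_function \<Omega> (h k)) \<and>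
     (\<forall>\<epsilon>>0. (\<lambda>k. outer \<Omega> \<mu> {z \<in> \<Omega>. \<bar>h k z - g z\<bar> > \<epsilon>}) \<longlonglongrightarrow> 0) \<and>
     (\<forall>\<epsilon>>0. \<exists>N. \<forall>k\<ge>N. \<forall>l\<ge>N. step_integral \<Omega> \<mu> (\<lambda>z. \<bar>h k z - h l z\<bar>) < \<epsilon>)"

definition fa_integrable :: "'a::topological_space set \<Rightarrow> ('a set \<Rightarrow> real) \<Rightarrow> ('a \<Rightarrow> real) \<Rightarrow> bool" where
  "fa_integrable \<Omega> \<mu> g \<longleftrightarrow> (\<exists>h. approximates \<Omega> \<mu> h g)"

text \<open>The limit does not depend on the approximating sequence.\<close>

definition fa_integral :: "'a::topological_space set \<Rightarrow> ('a set \<Rightarrow> real) \<Rightarrow> ('a \<Rightarrow> real) \<Rightarrow> real" where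
  "fa_integral \<Omega> \<mu> g =
     (THE I. \<exists>h. approximates \<Omega> \<mu> h g \<and> (\<lambda>k. step_integral \<Omega> \<mu> (h k)) \<longlonglongrightarrow> I)"

definition fa_integrable_vec ::
  "'a::topological_space set \<Rightarrow> ('a set \<Rightarrow> real) \<Rightarrow> ('a \<Rightarrow> real^'m::finite) \<Rightarrow> bool" where
  "fa_integrable_vec \<Omega> \<mu> g \<longleftrightarrow> (\<forall>i. fa_integrable \<Omega> \<mu> (\<lambda>z. g z $ i))"

definition fa_integral_vec ::
  "'a::topological_space set \<Rightarrow> ('a set \<Rightarrow> real) \<Rightarrow> ('a \<Rightarrow> real^'m::finite) \<Rightarrow> real^'m" where
  "fa_integral_vec \<Omega> \<mu> g = (\<chi> i. fa_integral \<Omega> \<mu> (\<lambda>z. g z $ i))"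

definition fa_integrable_mat ::
  "'a::topological_space set \<Rightarrow> ('a set \<Rightarrow> real) \<Rightarrow> ('a \<Rightarrow> real^'n::finite^'m::finite) \<Rightarrow> bool" where
  "fa_integrable_mat \<Omega> \<mu> G \<longleftrightarrow> (\<forall>i j. fa_integrable \<Omega> \<mu> (\<lambda>z. G z $ i $ j))"

definition fa_integral_mat ::
  "'a::topological_space set \<Rightarrow> ('a set \<Rightarrow> real) \<Rightarrow> ('a \<Rightarrow> real^'n::finite^'m::finite) \<Rightarrow> real^'n^'m" where
  "fa_integral_mat \<Omega> \<mu> G = (\<chi> i j. fa_integral \<Omega> \<mu> (\<lambda>z. G z $ i $ j))"

text \<open>At points where \<open>f\<close> is not differentiable the value is unspecified; for continuous
  functions in \<open>sobolev_loc p \<Omega>\<close> with \<open>p > n\<close> these points form a null set, which affects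
  neither membership in \<open>L\<^sup>\<infinity>\<close> nor the integral above.\<close>

definition Df :: "(real^'n::finite \<Rightarrow> real^'m::finite) \<Rightarrow> real^'n \<Rightarrow> real^'n^'m" where
  "Df f z = jacobian f (at z)"

text \<open>Boundedness of \<open>Df f z *v v\<close> for one direction \<open>v\<close> does not make \<open>Df f\<close> integrable:
  for \<open>f z = \<bar>z\<^sub>2\<bar> powr a\<close> with \<open>1 - 1/p < a < 1\<close> on the plane and a segment on the first axis,
  the second partial derivative blows up along the segment. An expression such as
  "(integral of \<open>Df f\<close>) applied to \<open>v\<close>" is then to be read as the integral of
  \<open>\<lambda>z. Df f z *v v\<close>; the two agree if \<open>Df f\<close> is integrable.\<close>

end

theory Submission
  imports Defs
begin

text \<open>Write \<open>v = y - x\<close> and let \<open>C\<^sub>\<delta>\<close> be the tube around the segment.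

  The averages of \<open>Df v\<close> over \<open>C\<^sub>\<delta>\<close> tend to \<open>f y - f x\<close>. Morrey's estimate at Lebesgue points shows that
  \<open>f\<close> is differentiable almost everywhere and that \<open>Df\<close> is the weak derivative, so the bound on \<open>Df v\<close>
  makes \<open>f\<close> Lipschitz in the direction \<open>v\<close>. Hence the integral of \<open>Df v\<close> over \<open>C\<^sub>\<delta>\<close> is the limit of the
  integrals of \<open>(f (z + s v) - f z) / s\<close>. These only see the two ends of the tube, where \<open>f\<close> is close
  to \<open>f x\<close> and \<open>f y\<close>.

  A density is only controlled on sets, by the limits inferior and superior of the relative volume in
  \<open>C\<^sub>\<delta>\<close>, and these bounds are not additive. It nevertheless integrates a bounded \<open>g\<close> to the limit of
  the averages of \<open>g\<close> over \<open>C\<^sub>\<delta>\<close>, if this limit exists. Indeed, halving sets in every shell between two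
  tubes writes a step function with dyadic values in \<open>[0,1]\<close> as a mean of indicator functions whose
  averages are all asymptotic to those of the step function.\<close>

section \<open>Smooth bump functions\<close>

text \<open>One identity serves both analytic steps. The average of \<open>u\<close> against a bump
  that moves and widens at constant rates is differentiable in time, with the weak gradient paired
  with the velocity field. Translating a bump of fixed radius gives the directional Lipschitz bound.
  A bump that grows out of a point gives Morrey's estimate: at radius t the derivative is of order
  t^(-n/q), which is integrable at 0 because q > n.

  On the side of the charge, a set with asymptotically half the volume of another is not known
  beforehand to have half its charge; only the sum over both halves is known. So the last digit of a
  step function is removed in two opposite ways and the two bounds are averaged. Upper bounds
  suffice, since 1 - h yields the lower ones. The shells have radii proportional to 1/k: ratios of
  consecutive radii tend to 1, so cutting through one shell is a negligible error, whereas geometric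
  radii would only bound it by a fixed proportion. Dimension at least two makes the segment null, so
  the shells exhaust the volume of the tube.\<close>

primrec nsmooth :: "nat \<Rightarrow> (real \<Rightarrow> real) \<Rightarrow> bool" where
  "nsmooth 0 g \<longleftrightarrow> continuous_on UNIV g"
| "nsmooth (Suc k) g \<longleftrightarrow> (\<exists>g'. (\<forall>t. (g has_real_derivative g' t) (at t)) \<and> nsmooth k g')"

lemma nsmooth_continuous: "nsmooth k g \<Longrightarrow> continuous_on UNIV g"
  by (cases k) (auto simp: continuous_on_eq_continuous_at intro: DERIV_isCont)

lemma nsmooth_Suc_imp: "nsmooth (Suc k) g \<Longrightarrow> nsmooth k g"
proof (induction k arbitrary: g)
  case 0
  then show ?case using nsmooth_continuous[of "Suc 0" g] by simp
next
  case (Suc k)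
  then show ?case by (metis nsmooth.simps(2))
qed

lemma nsmooth_const: "nsmooth k (\<lambda>_. c)"
proof (induction k arbitrary: c)
  case (Suc k)
  then show ?case by (auto intro!: exI[of _ "\<lambda>_. 0"])
qed simp

lemma nsmooth_affine: "nsmooth k (\<lambda>t. a + b * t)"
proof (cases k)
  case (Suc m)
  then show ?thesis
    by (auto intro!: exI[of _ "\<lambda>_. b"] nsmooth_const derivative_eq_intros)
qed (auto intro!: continuous_intros)

lemma nsmooth_add: "nsmooth k g \<Longrightarrow> nsmooth k h \<Longrightarrow> nsmooth k (\<lambda>t. g t + h t)"
proof (induction k arbitrary: g h)
  case 0
  then show ?case by (auto intro: continuous_intros)
next
  case (Suc k)
  then obtain g' h' where "\<forall>t. (g has_real_derivative g' t) (at t)" "nsmooth k g'"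
    "\<forall>t. (h has_real_derivative h' t) (at t)" "nsmooth k h'" by auto
  with Suc.IH show ?case
    by (auto intro!: exI[of _ "\<lambda>t. g' t + h' t"] derivative_eq_intros)
qed

lemma nsmooth_mult: "nsmooth k g \<Longrightarrow> nsmooth k h \<Longrightarrow> nsmooth k (\<lambda>t. g t * h t)"
proof (induction k arbitrary: g h)
  case 0
  then show ?case by (auto intro: continuous_intros)
next
  case (Suc k)
  then obtain g' h' where *: "\<forall>t. (g has_real_derivative g' t) (at t)" "nsmooth k g'"
    "\<forall>t. (h has_real_derivative h' t) (at t)" "nsmooth k h'" by auto
  have "nsmooth k (\<lambda>t. g' t * h t + h' t * g t)"
    using * Suc.prems nsmooth_Suc_imp by (intro nsmooth_add Suc.IH) auto
  moreover have "((\<lambda>t. g t * h t) has_real_derivative (g' t * h t + h' t * g t)) (at t)" for t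
    using * by (auto intro!: derivative_eq_intros)
  ultimately show ?case by (auto intro!: exI[of _ "\<lambda>t. g' t * h t + h' t * g t"])
qed

lemma nsmooth_compose_affine: "nsmooth k g \<Longrightarrow> nsmooth k (\<lambda>t. g (a + b * t))"
proof (induction k arbitrary: g)
  case 0
  then show ?case
    by (auto intro!: continuous_intros continuous_on_compose2[of UNIV g])
next
  case (Suc k)
  then obtain g' where *: "\<forall>t. (g has_real_derivative g' t) (at t)" "nsmooth k g'" by auto
  have "((\<lambda>t. g (a + b * t)) has_real_derivative g' (a + b * t) * b) (at t)" for t
    using *(1) by (intro DERIV_chain2[where f=g]) (auto intro!: derivative_eq_intros)
  moreover have "nsmooth k (\<lambda>t. g' (a + b * t) * b)"
    by (intro nsmooth_mult nsmooth_const Suc.IH *)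
  ultimately show ?case by (auto intro!: exI[of _ "\<lambda>t. g' (a + b * t) * b"])
qed

text \<open>Every derivative of \<open>exp (-1/t)\<close>, extended by \<open>0\<close> to \<open>t \<le> 0\<close>, has this form.\<close>

definition flat :: "real poly \<Rightarrow> real \<Rightarrow> real" where
  "flat q t = (if t > 0 then poly q (1 / t) * exp (- (1 / t)) else 0)"

lemma poly_exp_neg_tendsto_0: "((\<lambda>x::real. poly q x * exp (- x)) \<longlongrightarrow> 0) at_top"
proof (induction q)
  case (pCons a q)
  have "((\<lambda>x::real. x ^ k / exp x) \<longlongrightarrow> 0) at_top" for k
    by (rule tendsto_power_div_exp_0)
  then have *: "((\<lambda>x::real. x ^ k * exp (- x)) \<longlongrightarrow> 0) at_top" for k
    by (simp add: exp_minus field_simps)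
  have "poly (pCons a q) x * exp (-x) = (\<Sum>i\<le>degree (pCons a q). coeff (pCons a q) i * (x ^ i * exp (-x)))" for x
    unfolding poly_altdef sum_distrib_right by (simp add: mult.assoc)
  moreover have "((\<lambda>x. \<Sum>i\<le>degree (pCons a q). coeff (pCons a q) i * (x ^ i * exp (-x))) \<longlongrightarrow> (\<Sum>i\<le>degree (pCons a q). coeff (pCons a q) i * 0)) at_top"
    by (intro tendsto_sum tendsto_mult tendsto_const *)
  ultimately show ?case by simp
qed simp

text \<open>In the variable s = 1/t one has d/dt = -s^2 d/ds, so q(s) exp(-s) becomes s^2 (q(s) -
  q'(s)) exp(-s), which has the same form again. At 0 the difference quotient is s q(s) exp(-s) for
  t > 0 and vanishes for t < 0.\<close>

lemma flat_has_derivative: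
  "(flat q has_real_derivative flat ([:0,0,1:] * (q - pderiv q)) t) (at t)"
proof -
  consider "t > 0" | "t < 0" | "t = 0" by linarith
  then show ?thesis
  proof cases
    case 1
    have "((\<lambda>t. poly q (1/t) * exp (- (1/t))) has_real_derivative
        (poly (pderiv q) (1/t) * (- 1 / t\<^sup>2)) * exp (- (1/t)) + poly q (1/t) * (exp (- (1/t)) * (1/t\<^sup>2))) (at t)"
      using 1 by (auto intro!: derivative_eq_intros DERIV_chain2[OF poly_DERIV] simp: power2_eq_square)
    moreover have "flat ([:0,0,1:] * (q - pderiv q)) t = (poly (pderiv q) (1/t) * (- 1 / t\<^sup>2)) * exp (- (1/t)) + poly q (1/t) * (exp (- (1/t)) * (1/t\<^sup>2))"
      using 1 by (simp add: flat_def power2_eq_square algebra_simps)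
    ultimately have "((\<lambda>t. poly q (1/t) * exp (- (1/t))) has_real_derivative flat ([:0,0,1:] * (q - pderiv q)) t) (at t)"
      by simp
    then show ?thesis
      by (rule has_field_derivative_transform_within_open[where S="{0<..}"]) (use 1 in \<open>auto simp: flat_def\<close>)
  next
    case 2
    have "((\<lambda>t. 0) has_real_derivative flat ([:0,0,1:] * (q - pderiv q)) t) (at t)"
      using 2 by (simp add: flat_def)
    then show ?thesis
      by (rule has_field_derivative_transform_within_open[where S="{..<0}"]) (use 2 in \<open>auto simp: flat_def\<close>)
  next
    case 3
    \<comment> \<open>\<open>pCons 0 q\<close> supplies the extra factor 1/h of the difference
      quotient.\<close>
    have "((\<lambda>h. poly (pCons 0 q) (1/h) * exp (- (1/h))) \<longlongrightarrow> 0) (at_right 0)"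
      using filterlim_compose[OF poly_exp_neg_tendsto_0[of "pCons 0 q"] filterlim_inverse_at_top_right]
      by (simp add: inverse_eq_divide)
    then have r: "((\<lambda>h. flat q h / h) \<longlongrightarrow> 0) (at_right 0)"
      by (rule Lim_transform_eventually)
        (auto simp: flat_def eventually_at_filter)
    have l: "((\<lambda>h. flat q h / h) \<longlongrightarrow> 0) (at_left 0)"
      by (rule tendsto_eventually) (auto simp: flat_def eventually_at_filter)
    from l r have "((\<lambda>h. flat q h / h) \<longlongrightarrow> 0) (at 0)"
      by (simp add: filterlim_split_at)
    then show ?thesis
      using 3 by (simp add: DERIV_def flat_def)
  qed
qed

lemma nsmooth_flat: "nsmooth k (flat q)"
proof (induction k arbitrary: q)
  case 0
  show ?case
    by (auto intro!: DERIV_continuous_on intro: has_field_derivative_at_within[OF flat_has_derivative])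
next
  case (Suc k)
  then show ?case using flat_has_derivative by auto
qed

text \<open>On (-1,1) this is exp(-2/(1 - t^2)). The factorisation reduces smoothness to that of
  \<open>flat\<close>.\<close>

definition bump :: "real \<Rightarrow> real" where
  "bump t = flat 1 (1 + t) * flat 1 (1 - t)"

lemma nsmooth_bump: "nsmooth k bump"
  unfolding bump_def
  using nsmooth_mult[OF nsmooth_compose_affine[OF nsmooth_flat[of k 1], of 1 1]
      nsmooth_compose_affine[OF nsmooth_flat[of k 1], of 1 "-1"]] by (simp add: bump_def[abs_def])

lemma bump_nonneg: "bump t \<ge> 0"
  by (simp add: bump_def flat_def)

lemma bump_le_1: "bump t \<le> 1"
  by (auto simp: bump_def flat_def intro!: mult_le_one)

lemma bump_pos: "\<bar>t\<bar> < 1 \<Longrightarrow> bump t > 0"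
  by (auto simp: bump_def flat_def)

lemma bump_eq_0: "\<bar>t\<bar> \<ge> 1 \<Longrightarrow> bump t = 0"
  by (auto simp: bump_def flat_def)

definition bump' :: "real \<Rightarrow> real" where "bump' = deriv bump"

lemma bump_has_derivative: "(bump has_real_derivative bump' t) (at t)"
proof -
  obtain g' where "\<And>t. (bump has_real_derivative g' t) (at t)"
    using nsmooth_bump[of "Suc 0"] by auto
  from this[of t] show ?thesis
    by (simp add: bump'_def DERIV_imp_deriv)
qed

lemma continuous_bump: "continuous_on UNIV bump"
  using nsmooth_bump[of 0] by simp

lemma continuous_bump': "continuous_on UNIV bump'"
proof -
  obtain g' where g': "\<And>t. (bump has_real_derivative g' t) (at t)" "nsmooth 0 g'"
    using nsmooth_bump[of "Suc 0"] by auto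
  then have "bump' = g'" by (auto simp: bump'_def fun_eq_iff DERIV_imp_deriv)
  with g' show ?thesis by simp
qed

section \<open>Test functions as products over the coordinates\<close>

lemma has_derivative_coord_prod:
  fixes z :: "real^'n"
  assumes "\<And>j. (g j has_real_derivative g' j (z$j)) (at (z$j))"
  shows "((\<lambda>z. \<Prod>j\<in>UNIV. g j (z$j)) has_derivative
     (\<lambda>h. \<Sum>i\<in>UNIV. g' i (z$i) * h$i * (\<Prod>j\<in>UNIV-{i}. g j (z$j)))) (at z)"
proof -
  have "((\<lambda>z. g j (z$j)) has_derivative (\<lambda>h. g' j (z$j) * h$j)) (at z)" for j
    using DERIV_compose_FDERIV[where f="g j" and g="\<lambda>z. z$j" and g'="\<lambda>h. h$j", OF assms[of j]]
    by (simp add: mult.commute bounded_linear_imp_has_derivative bounded_linear_vec_nth)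
  then show ?thesis by (intro has_derivative_prod) auto
qed

lemma pdiff_coord_prod:
  fixes z :: "real^'n"
  assumes "\<And>j t. (g j has_real_derivative g' j t) (at t)"
  shows "pdiff i (\<lambda>z. \<Prod>j\<in>UNIV. g j (z$j)) z = g' i (z$i) * (\<Prod>j\<in>UNIV-{i}. g j (z$j))"
proof -
  have "frechet_derivative (\<lambda>z. \<Prod>j\<in>UNIV. g j (z$j)) (at z) =
     (\<lambda>h. \<Sum>i\<in>UNIV. g' i (z$i) * h$i * (\<Prod>j\<in>UNIV-{i}. g j (z$j)))"
    by (rule frechet_derivative_at[symmetric], rule has_derivative_coord_prod) (rule assms)
  then show ?thesis
    unfolding pdiff_def
    by (simp add: axis_def if_distrib[of "\<lambda>x. _ * (x * _)"] mult.assoc if_distribR cong: if_cong)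
qed

text \<open>The i-th partial derivative replaces the i-th factor by its derivative and leaves a
  product of the same kind, so the induction runs over all families of factors at once.\<close>

lemma Ck_coord_prod: "(\<And>j. nsmooth k (g j)) \<Longrightarrow> Ck k (\<lambda>z::real^'n. \<Prod>j\<in>UNIV. g j (z$j))"
proof (induction k arbitrary: g)
  case 0
  have "continuous_on UNIV (\<lambda>z::real^'n. g j (z$j))" for j
    using 0[of j] by (auto intro!: continuous_on_compose2[of UNIV "g j"] continuous_intros)
  then show ?case by (auto intro!: continuous_intros)
next
  case (Suc k)
  then obtain g' where g': "\<And>j t. (g j has_real_derivative g' j t) (at t)" "\<And>j. nsmooth k (g' j)"
    by (simp) metis
  have "pdiff i (\<lambda>z::real^'n. \<Prod>j\<in>UNIV. g j (z$j)) = (\<lambda>z. \<Prod>j\<in>UNIV. (if j = i then g' j else g j) (z$j))" for i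
  proof
    fix z :: "real^'n"
    show "pdiff i (\<lambda>z::real^'n. \<Prod>j\<in>UNIV. g j (z$j)) z = (\<Prod>j\<in>UNIV. (if j = i then g' j else g j) (z$j))"
      unfolding pdiff_coord_prod[of g g', OF g'(1)] by (simp add: prod.remove[of UNIV i])
  qed
  moreover have "Ck k (\<lambda>z::real^'n. \<Prod>j\<in>UNIV. (if j = i then g' j else g j) (z$j))" for i
    using g'(2) Suc.prems nsmooth_Suc_imp by (intro Suc.IH) auto
  moreover have "(\<lambda>z::real^'n. \<Prod>j\<in>UNIV. g j (z$j)) differentiable (at z)" for z
    using has_derivative_coord_prod[of g g' z] g'(1) by (auto simp: differentiable_def)
  ultimately show ?case by simp
qed

lemma test_functions_coord_prod:
  fixes l r :: "real^'n"
  assumes "\<And>j k. nsmooth k (g j)" and "\<And>j t. t \<notin> {l$j..r$j} \<Longrightarrow> g j t = 0"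
    and "cbox l r \<subseteq> \<Omega>"
  shows "(\<lambda>z::real^'n. \<Prod>j\<in>UNIV. g j (z$j)) \<in> test_functions \<Omega>"
proof -
  have "{z. (\<Prod>j\<in>UNIV. g j (z$j)) \<noteq> 0} \<subseteq> cbox l r"
    using assms(2) by (force simp: mem_box_cart)
  then have "closure {z. (\<Prod>j\<in>UNIV. g j (z$j)) \<noteq> 0} \<subseteq> cbox l r"
    by (rule closure_minimal) (rule closed_cbox)
  moreover from this have "compact (closure {z. (\<Prod>j\<in>UNIV. g j (z$j)) \<noteq> 0})"
    by (meson bounded_cbox bounded_subset closed_closure compact_eq_bounded_closed)
  ultimately show ?thesis
    using assms Ck_coord_prod[of _ g] by (auto simp: test_functions_def)
qed

text \<open>A product instead of a radial bump: its partial derivatives are one-variable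
  computations, and its support, the cube from -1 to 1, fits the boxes over which the integrals
  run.\<close>

definition cube_bump :: "real^'n::finite \<Rightarrow> real" where
  "cube_bump \<zeta> = (\<Prod>j\<in>UNIV. bump (\<zeta> $ j))"

lemma cube_bump_nonneg: "cube_bump \<zeta> \<ge> 0"
  unfolding cube_bump_def by (intro prod_nonneg bump_nonneg)

lemma cube_bump_le_1: "cube_bump \<zeta> \<le> 1"
  unfolding cube_bump_def by (intro prod_le_1) (auto simp: bump_nonneg bump_le_1)

lemma cube_bump_nonzero: "cube_bump \<zeta> \<noteq> 0 \<Longrightarrow> \<bar>\<zeta> $ j\<bar> < 1"
  using bump_eq_0[of "\<zeta> $ j"] by (force simp: cube_bump_def)

lemma cube_bump_eq_0: "\<zeta> \<notin> cbox (-1) 1 \<Longrightarrow> cube_bump \<zeta> = 0"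
proof (rule ccontr)
  assume "cube_bump \<zeta> \<noteq> 0"
  from cube_bump_nonzero[OF this] have "- 1 \<le> \<zeta> $ j \<and> \<zeta> $ j \<le> 1" for j
    by (simp add: abs_less_iff less_imp_le minus_le_iff)
  then have "\<zeta> \<in> cbox (-1) 1" by (simp add: mem_box_cart)
  moreover assume "\<zeta> \<notin> cbox (-1) 1"
  ultimately show False by simp
qed

lemma continuous_cube_bump: "continuous_on UNIV (cube_bump :: real^'n::finite \<Rightarrow> real)"
  unfolding cube_bump_def
  by (intro continuous_intros continuous_on_compose2[OF continuous_bump]) auto

lemma borel_measurable_cube_bump [measurable]: "(cube_bump :: real^'n::finite \<Rightarrow> real) \<in> borel_measurable borel"
  using continuous_cube_bump by (rule borel_measurable_continuous_onI)

lemma integrable_cube_bump: "integrable lebesgue (cube_bump :: real^'n::finite \<Rightarrow> real)"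
proof -
  have "cube_bump absolutely_integrable_on cbox (-1::real^'n) 1"
    by (intro absolutely_integrable_continuous continuous_on_subset[OF continuous_cube_bump]) auto
  then show ?thesis
    unfolding set_integrable_def
    by (rule Bochner_Integration.integrable_cong[THEN iffD1, rotated 2]) (auto simp: cube_bump_eq_0 indicator_def)
qed

lemma integral_bb_pos: "0 < (LINT \<zeta>|lebesgue. cube_bump (\<zeta> :: real^'n::finite))"
proof -
  have "emeasure lebesgue {\<zeta>::real^'n. cube_bump \<zeta> \<noteq> 0} \<noteq> 0"
  proof -
    have "open {\<zeta>::real^'n. cube_bump \<zeta> \<noteq> 0}"
      using open_Collect_neq[OF continuous_cube_bump continuous_on_const] .
    moreover have "(0::real^'n) \<in> {\<zeta>. cube_bump \<zeta> \<noteq> 0}"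
      using bump_pos[of 0] by (simp add: cube_bump_def)
    ultimately show ?thesis
      using open_not_negligible[of "{\<zeta>::real^'n. cube_bump \<zeta> \<noteq> 0}"] negligible_iff_emeasure0[of "{\<zeta>::real^'n. cube_bump \<zeta> \<noteq> 0}"]
      by (auto intro: borel_open)
  qed
  then have "\<not> (AE \<zeta> in lebesgue. cube_bump (\<zeta>::real^'n) = 0)"
    by (subst AE_iff_measurable[OF _ refl]) auto
  then have "(LINT \<zeta>|lebesgue. cube_bump (\<zeta>::real^'n)) \<noteq> 0"
    by (subst integral_nonneg_eq_0_iff_AE[OF integrable_cube_bump]) (auto simp: cube_bump_nonneg)
  moreover have "(LINT \<zeta>|lebesgue. cube_bump (\<zeta>::real^'n)) \<ge> 0"
    by (rule integral_nonneg_AE) (simp add: cube_bump_nonneg)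
  ultimately show ?thesis by linarith
qed

section \<open>Affine substitution and change of domain in integrals\<close>

lemma lebesgue_integral_affine:
  fixes h :: "real^'n::finite \<Rightarrow> real"
  assumes h: "h \<in> borel_measurable lebesgue" and s: "s > 0"
  shows "(LINT z|lebesgue. h z) = s ^ CARD('n) * (LINT \<zeta>|lebesgue. h (c + s *\<^sub>R \<zeta>))"
    and "integrable lebesgue h \<Longrightarrow> integrable lebesgue (\<lambda>\<zeta>. h (c + s *\<^sub>R \<zeta>))"
proof -
  define T :: "real^'n \<Rightarrow> real^'n" where "T = (\<lambda>x. c + (\<Sum>j\<in>Basis. (s * (x \<bullet> j)) *\<^sub>R j))"
  have T: "T = (\<lambda>x. c + s *\<^sub>R x)"
    by (simp add: T_def fun_eq_iff euclidean_representation flip: scaleR_scaleR scaleR_sum_right)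
  have leb: "lebesgue = density (distr lebesgue lebesgue T) (\<lambda>_. ennreal (s ^ CARD('n)))"
    and meas: "T \<in> lebesgue \<rightarrow>\<^sub>M lebesgue"
    using lebesgue_affine_euclidean[of "\<lambda>_. s" c] lebesgue_affine_measurable[of "\<lambda>_. s" c] s
    by (auto simp: T_def)
  have "(LINT z|lebesgue. h z) = (LINT z|density (distr lebesgue lebesgue T) (\<lambda>_. ennreal (s ^ CARD('n))). h z)"
    using leb by simp
  also have "\<dots> = s ^ CARD('n) * (LINT \<zeta>|lebesgue. h (c + s *\<^sub>R \<zeta>))"
    using h meas s by (subst integral_density) (auto simp: integral_distr T)
  finally show "(LINT z|lebesgue. h z) = s ^ CARD('n) * (LINT \<zeta>|lebesgue. h (c + s *\<^sub>R \<zeta>))" .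
  assume "integrable lebesgue h"
  then have "integrable (density (distr lebesgue lebesgue T) (\<lambda>_. ennreal (s ^ CARD('n)))) h"
    using leb by simp
  then show "integrable lebesgue (\<lambda>\<zeta>. h (c + s *\<^sub>R \<zeta>))"
    using h meas s by (subst (asm) integrable_density) (auto simp: T integrable_distr_eq h)
qed

lemma set_integrable_continuous_mult:
  fixes f g :: "'a::euclidean_space \<Rightarrow> real"
  assumes "continuous_on K f" and "compact K" and "set_integrable lebesgue K g"
  shows "set_integrable lebesgue K (\<lambda>z. f z * g z)"
proof -
  have "K \<in> sets lebesgue" using assms(2) by (simp add: borel_compact)
  then show ?thesis
    using assms
    by (intro absolutely_integrable_bounded_measurable_product[OF bilinear_times]
        continuous_imp_measurable_on_sets_lebesgue compact_imp_bounded compact_continuous_image)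
qed

lemma set_integral_subset:
  assumes "A \<subseteq> B" and "\<And>z. z \<in> B - A \<Longrightarrow> f z = 0"
  shows "(LINT z:B|M. f z) = (LINT z:A|M. f z)"
  unfolding set_lebesgue_integral_def
  using assms by (intro Bochner_Integration.integral_cong) (auto simp: indicator_def)

lemma bump'_eq_0:
  assumes "\<bar>t\<bar> > 1" shows "bump' t = 0"
proof -
  have "((\<lambda>_. 0) has_real_derivative 0) (at t)" by simp
  then have "(bump has_real_derivative 0) (at t)"
    by (rule has_field_derivative_transform_within_open[where S="- cball 0 1"])
      (use assms in \<open>auto simp: bump_eq_0\<close>)
  then show ?thesis using bump_has_derivative DERIV_unique by blast
qed

text \<open>The scaled bump \<open>s\<^sup>-\<^sup>n cube_bump((z - c)/s)\<close>, with centre \<open>c\<close> and radius \<open>s\<close> moving affinely, satisfies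
  the continuity equation with velocity field \<open>a + \<sigma> (z - c)/s\<close>; the fluxes are test functions.\<close>

lemma cube_bump_flow:
  fixes u :: "real^'n::finite \<Rightarrow> real" and \<Gamma> :: "real^'n \<Rightarrow> real^'n" and c0 a l r :: "real^'n"
  assumes Q: "cbox l r \<subseteq> \<Omega>" and u: "continuous_on (cbox l r) u"
    and \<Gamma>: "\<And>j. set_integrable lebesgue (cbox l r) (\<lambda>z. \<Gamma> z $ j)"
    and W: "\<And>\<phi> j. \<phi> \<in> test_functions \<Omega> \<Longrightarrow>
       (LINT z:\<Omega>|lebesgue. u z * pdiff j \<phi> z) = - (LINT z:\<Omega>|lebesgue. \<Gamma> z $ j * \<phi> z)"
    and U: "open U" "convex U" and t: "t \<in> U"
    and pos: "\<And>t. t \<in> U \<Longrightarrow> s0 + t * \<sigma> > 0"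
    and inQ: "\<And>t j. t \<in> U \<Longrightarrow> l$j \<le> c0$j + t*a$j - (s0 + t*\<sigma>) \<and> c0$j + t*a$j + (s0 + t*\<sigma>) \<le> r$j"
  shows "((\<lambda>t. LINT \<zeta>|lebesgue. u (c0 + t *\<^sub>R a + (s0 + t*\<sigma>) *\<^sub>R \<zeta>) * cube_bump \<zeta>) has_real_derivative
     (LINT \<zeta>|lebesgue. (\<Gamma> (c0 + t *\<^sub>R a + (s0 + t*\<sigma>) *\<^sub>R \<zeta>) \<bullet> (a + \<sigma> *\<^sub>R \<zeta>)) * cube_bump \<zeta>)) (at t)"
proof -
  let ?n = "CARD('n)" and ?Q = "cbox l r"
  define s where "s t = s0 + t*\<sigma>" for t
  define c where "c t = c0 + t *\<^sub>R a" for t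
  define Z where "Z t z = (1 / s t) *\<^sub>R (z - c t)" for t z
  \<comment> \<open>In these terms \<open>B i t\<close> is the i-th partial derivative of the flux
    \<open>\<psi> i t\<close> (see \<open>test\<close>) and \<open>D\<close> is the time derivative
    of the scaled bump \<open>P\<close> (see \<open>dP\<close>). The definition of \<open>D\<close>
    is thus the continuity equation.\<close>
  define B where "B i t z = (\<sigma> / s t * bump (Z t z $ i) + (a$i + \<sigma> * Z t z $ i) / s t * bump' (Z t z $ i))
      * (\<Prod>j\<in>UNIV-{i}. bump (Z t z $ j))" for i :: 'n and t z
  define P where "P t z = cube_bump (Z t z) / s t ^ ?n" for t z
  define D where "D t z = - (1 / s t ^ ?n) * (\<Sum>i\<in>UNIV. B i t z)" for t z
  define \<psi> where "\<psi> i t z = (a$i + \<sigma> * Z t z $ i) * cube_bump (Z t z)" for i :: 'n and t z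
  have s_pos: "s t > 0" if "t \<in> U" for t using pos[OF that] by (simp add: s_def)
  have box: "l$j \<le> c t $ j - s t \<and> c t $ j + s t \<le> r$j" if "t \<in> U" for t j
    using inQ[OF that] by (simp add: s_def c_def)
  have out: "\<exists>j. \<bar>Z t z $ j\<bar> > 1" if tU: "t \<in> U" and z: "z \<notin> ?Q" for t z
  proof -
    obtain j where "z$j < l$j \<or> z$j > r$j" using z unfolding mem_box_cart by (meson not_le)
    then have "\<bar>z$j - c t $ j\<bar> > s t" using box[OF tU, of j] by auto
    then show ?thesis using s_pos[OF tU] by (auto simp: Z_def abs_mult field_simps)
  qed
  have cube_bump_out: "cube_bump (Z t z) = 0" if tz: "t \<in> U" "z \<notin> ?Q" for t z
  proof -
    obtain j where "\<bar>Z t z $ j\<bar> > 1" using out[OF tz] by blast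
    then show ?thesis using cube_bump_nonzero[of "Z t z" j] by linarith
  qed
  have B_out: "B i t z = 0" if tz: "t \<in> U" "z \<notin> ?Q" for i t z
  proof -
    obtain j where j: "\<bar>Z t z $ j\<bar> > 1" using out[OF tz] by blast
    show ?thesis
    proof (cases "j = i")
      case True then show ?thesis using j bump'_eq_0[OF j] bump_eq_0[of "Z t z $ j"] by (simp add: B_def)
    next
      case False then show ?thesis using j bump_eq_0[of "Z t z $ j"] by (auto simp: B_def)
    qed
  qed
  have Zback: "Z t (c t + s t *\<^sub>R \<zeta>) = \<zeta>" if "t \<in> U" for t \<zeta>
    using s_pos[OF that] by (auto simp: Z_def)
  \<comment> \<open>Substitution moves the dependence on \<open>t\<close> from the argument of
    \<open>u\<close>, which is merely continuous, to the smooth kernel \<open>P\<close>, over a box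
    that does not depend on \<open>t\<close>. Only in this form can one differentiate under the
    integral.\<close>
  have change: "(LINT \<zeta>|lebesgue. k (c t + s t *\<^sub>R \<zeta>) * q \<zeta> * cube_bump \<zeta>)
        = integral ?Q (\<lambda>z. k z * q (Z t z) * P t z)"
    if tU: "t \<in> U" and int: "set_integrable lebesgue ?Q (\<lambda>z. k z * q (Z t z) * P t z)" for k q t
  proof -
    let ?h = "\<lambda>z. indicator ?Q z *\<^sub>R (k z * q (Z t z) * P t z)"
    have "integral ?Q (\<lambda>z. k z * q (Z t z) * P t z) = (LINT z|lebesgue. ?h z)"
      using set_lebesgue_integral_eq_integral(2)[OF int] by (simp add: set_lebesgue_integral_def)
    also have "\<dots> = s t ^ ?n * (LINT \<zeta>|lebesgue. ?h (c t + s t *\<^sub>R \<zeta>))"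
      using int s_pos[OF tU] by (intro lebesgue_integral_affine) (auto simp: set_integrable_def)
    also have "\<dots> = (LINT \<zeta>|lebesgue. s t ^ ?n * ?h (c t + s t *\<^sub>R \<zeta>))"
      by simp
    also have "(\<lambda>\<zeta>. s t ^ ?n * ?h (c t + s t *\<^sub>R \<zeta>)) = (\<lambda>\<zeta>. k (c t + s t *\<^sub>R \<zeta>) * q \<zeta> * cube_bump \<zeta>)"
      using s_pos[OF tU] cube_bump_out[OF tU, of "c t + s t *\<^sub>R _"]
      by (auto simp: fun_eq_iff P_def Zback[OF tU] indicator_def)
    finally show ?thesis by simp
  qed
  have cZ: "continuous_on (U \<times> ?Q) (\<lambda>x. Z (fst x) (snd x))"
    unfolding Z_def c_def s_def using pos
    by (intro continuous_intros) (auto simp: less_imp_neq[symmetric])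
  have cZ1: "continuous_on ?Q (\<lambda>z. Z t z $ i)" for i t
    unfolding Z_def by (intro continuous_intros)
  have cP: "continuous_on ?Q (P t)" for t
    unfolding P_def divide_inverse Z_def
    by (intro continuous_intros continuous_on_compose2[OF continuous_cube_bump]) auto
  have c\<psi>: "continuous_on ?Q (\<psi> i t)" for i t
    unfolding \<psi>_def Z_def
    by (intro continuous_intros continuous_on_compose2[OF continuous_cube_bump]) auto
  have cD: "continuous_on (U \<times> ?Q) (\<lambda>(t,z). D t z)"
    unfolding D_def B_def split_beta
    by (intro continuous_intros cZ continuous_on_compose2[OF continuous_bump]
        continuous_on_compose2[OF continuous_bump'])
      (auto simp: s_def dest!: pos intro!: continuous_intros)
  have cB1: "continuous_on ?Q (B i t)" for i t
    unfolding B_def divide_inverse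
    by (intro continuous_intros continuous_on_compose2[OF continuous_bump] cZ1
        continuous_on_compose2[OF continuous_bump']) auto
  have dZ: "((\<lambda>t. Z t z $ i) has_real_derivative - (a$i + \<sigma> * Z t z $ i) / s t) (at t)"
    if tU: "t \<in> U" for t z i
  proof -
    have "((\<lambda>t. z$i - (c0$i + t * a$i)) has_real_derivative - a$i) (at t)"
      by (auto intro!: derivative_eq_intros)
    moreover have "(s has_real_derivative \<sigma>) (at t)"
      unfolding s_def[abs_def] by (auto intro!: derivative_eq_intros)
    ultimately have "((\<lambda>t. (z$i - (c0$i + t * a$i)) / s t) has_real_derivative
        (- a$i * s t - (z$i - (c0$i + t * a$i)) * \<sigma>) / (s t * s t)) (at t)"
      using s_pos[OF tU] by (intro DERIV_divide) auto
    moreover have "(- A * S - N * \<sigma>) / (S * S) = - (A + \<sigma> * (N / S)) / S" if "S \<noteq> 0" for A N S :: real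
      using that by (simp add: field_simps)
    ultimately show ?thesis
      using s_pos[OF tU] by (simp add: Z_def c_def)
  qed
  have dP: "((\<lambda>t. P t z) has_real_derivative D t z) (at t)" if tU: "t \<in> U" for t z
  proof -
    have 1: "((\<lambda>t. bump (Z t z $ i)) has_real_derivative
        bump' (Z t z $ i) * (- (a$i + \<sigma> * Z t z $ i) / s t)) (at t)" for i
      by (intro DERIV_chain2[where f=bump] bump_has_derivative dZ tU)
    have 2: "((\<lambda>t. cube_bump (Z t z)) has_real_derivative
      (\<Sum>i\<in>UNIV. bump' (Z t z $ i) * (- (a$i + \<sigma> * Z t z $ i) / s t) * (\<Prod>j\<in>UNIV-{i}. bump (Z t z $ j)))) (at t)"
      unfolding cube_bump_def by (intro has_field_derivative_prod 1)
    have 3: "((\<lambda>t. 1 / s t ^ ?n) has_real_derivative - (real ?n * \<sigma> / s t) * (1 / s t ^ ?n)) (at t)"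
    proof -
      have "((\<lambda>t. s t) has_real_derivative \<sigma>) (at t)"
        unfolding s_def by (auto intro!: derivative_eq_intros)
      then have "((\<lambda>t. inverse (s t ^ ?n)) has_real_derivative - (real ?n * s t ^ (?n - 1) * \<sigma>) * inverse ((s t ^ ?n)\<^sup>2)) (at t)"
        using s_pos[OF tU] by (auto intro!: derivative_eq_intros simp: power2_eq_square field_simps)
      moreover have "s t ^ ?n = s t * s t ^ (?n - 1)"
        by (metis power_eq_if zero_less_card_finite less_not_refl)
      then have "- (real ?n * s t ^ (?n - 1) * \<sigma>) * inverse ((s t ^ ?n)\<^sup>2) = - (real ?n * \<sigma> / s t) * (1 / s t ^ ?n)"
        using s_pos[OF tU] by (simp add: power2_eq_square field_simps)
      ultimately show ?thesis by (simp add: inverse_eq_divide)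
    qed
    have "D t z = (\<Sum>i\<in>UNIV. bump' (Z t z $ i) * (- (a$i + \<sigma> * Z t z $ i) / s t) * (\<Prod>j\<in>UNIV-{i}. bump (Z t z $ j)))
        * (1 / s t ^ ?n) + (- (real ?n * \<sigma> / s t) * (1 / s t ^ ?n)) * cube_bump (Z t z)"
    proof -
      have "bump (Z t z $ i) * (\<Prod>j\<in>UNIV-{i}. bump (Z t z $ j)) = cube_bump (Z t z)" for i
        unfolding cube_bump_def by (simp add: prod.remove[of UNIV i])
      moreover have "(\<sigma> / S * b + A / S * b') * q = \<sigma> / S * (b * q) - b' * (- A / S) * q" for S b A b' q :: real
        by (simp add: algebra_simps)
      ultimately have "B i t z = \<sigma> / s t * cube_bump (Z t z) - bump' (Z t z $ i) * (- (a$i + \<sigma> * Z t z $ i) / s t) * (\<Prod>j\<in>UNIV-{i}. bump (Z t z $ j))" for i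
        unfolding B_def by metis
      then have "(\<Sum>i\<in>UNIV. B i t z) = real ?n * (\<sigma> / s t * cube_bump (Z t z)) - (\<Sum>i\<in>UNIV. bump' (Z t z $ i) * (- (a$i + \<sigma> * Z t z $ i) / s t) * (\<Prod>j\<in>UNIV-{i}. bump (Z t z $ j)))"
        by (simp add: sum_subtractf)
      moreover have "- W * (m * (\<sigma> / S * b) - R) = R * W + (- (m * \<sigma> / S) * W) * b" for W m S b R :: real
        by (simp add: algebra_simps)
      ultimately show ?thesis
        unfolding D_def by metis
    qed
    moreover have "(\<lambda>t. P t z) = (\<lambda>t. cube_bump (Z t z) * (1 / s t ^ ?n))"
      by (simp add: P_def)
    ultimately show ?thesis
      using DERIV_mult[OF 2 3] by (simp add: mult.commute add.commute)
  qed
  have test: "(\<lambda>z. \<psi> i t z) \<in> test_functions \<Omega>" "pdiff i (\<lambda>z. \<psi> i t z) z = B i t z"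
    if tU: "t \<in> U" for i t z
  proof -
    define g where "g j \<tau> = (if j = i then a$i + \<sigma> * ((\<tau> - c t $ i) / s t) else 1) * bump ((\<tau> - c t $ j) / s t)" for j \<tau>
    define g' where "g' j \<tau> = (if j = i then \<sigma> / s t * bump ((\<tau> - c t $ i) / s t) + (a$i + \<sigma> * ((\<tau> - c t $ i) / s t)) / s t * bump' ((\<tau> - c t $ i) / s t)
        else bump' ((\<tau> - c t $ j) / s t) / s t)" for j \<tau>
    have Zi: "Z t z $ j = (z $ j - c t $ j) / s t" for z j by (simp add: Z_def)
    have eq: "(\<lambda>z. \<psi> i t z) = (\<lambda>z. \<Prod>j\<in>UNIV. g j (z$j))"
      unfolding \<psi>_def cube_bump_def g_def prod.distrib Zi by (simp add: prod.delta)
    have aff: "(\<tau> - x) / s t = (- x / s t) + (1 / s t) * \<tau>" for \<tau> x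
      by (simp add: diff_divide_distrib)
    have "nsmooth k (\<lambda>\<tau>. (if j = i then a$i + \<sigma> * ((\<tau> - c t $ i) / s t) else 1))" for j k
    proof (cases "j = i")
      case True
      have "nsmooth k (\<lambda>\<tau>. (a$i + \<sigma> * (- c t $ i / s t)) + (\<sigma> * (1 / s t)) * \<tau>)" by (rule nsmooth_affine)
      with True show ?thesis by (simp add: aff algebra_simps)
    qed (simp add: nsmooth_const)
    moreover have "nsmooth k (\<lambda>\<tau>. bump ((\<tau> - x) / s t))" for k x
      unfolding aff by (intro nsmooth_compose_affine nsmooth_bump)
    ultimately have sm: "nsmooth k (g j)" for j k
      unfolding g_def by (intro nsmooth_mult)
    have z: "g j \<tau> = 0" if "\<tau> \<notin> {l$j..r$j}" for j \<tau>
    proof -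
      have "\<bar>\<tau> - c t $ j\<bar> > s t" using box[OF tU, of j] that by auto
      then have "\<bar>(\<tau> - c t $ j) / s t\<bar> \<ge> 1" using s_pos[OF tU] by (simp add: abs_divide)
      then show ?thesis by (simp add: g_def bump_eq_0)
    qed
    show "(\<lambda>z. \<psi> i t z) \<in> test_functions \<Omega>"
      unfolding eq by (rule test_functions_coord_prod[where l=l and r=r]) (use sm z Q in auto)
    have db: "((\<lambda>\<tau>. bump ((\<tau> - x) / s t)) has_real_derivative bump' ((\<tau> - x) / s t) * (1 / s t)) (at \<tau>)" for \<tau> x
      by (rule DERIV_chain2[where f=bump, OF bump_has_derivative])
        (use s_pos[OF tU] in \<open>auto intro!: derivative_eq_intros\<close>)
    have "(g j has_real_derivative g' j \<tau>) (at \<tau>)" for j \<tau>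
    proof (cases "j = i")
      case True
      have "((\<lambda>\<tau>. a$i + \<sigma> * ((\<tau> - c t $ i) / s t)) has_real_derivative \<sigma> / s t) (at \<tau>)"
        using s_pos[OF tU] by (auto intro!: derivative_eq_intros)
      note d = DERIV_mult[OF this db[of "c t $ i" \<tau>]]
      have "g j = (\<lambda>\<tau>. (a$i + \<sigma> * ((\<tau> - c t $ i) / s t)) * bump ((\<tau> - c t $ i) / s t))"
        using True by (simp add: g_def[abs_def])
      moreover have "g' j \<tau> = \<sigma> / s t * bump ((\<tau> - c t $ i) / s t) +
          bump' ((\<tau> - c t $ i) / s t) * (1 / s t) * (a$i + \<sigma> * ((\<tau> - c t $ i) / s t))"
        using True by (simp add: g'_def)
      ultimately show ?thesis using d by simp
    next
      case False
      then show ?thesis using db[of "c t $ j" \<tau>] by (simp add: g_def[abs_def] g'_def)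
    qed
    from pdiff_coord_prod[of g g' i z, OF this]
    show "pdiff i (\<lambda>z. \<psi> i t z) z = B i t z"
      unfolding eq by (simp add: g_def g'_def B_def Zi)
  qed
  \<comment> \<open>Integration by parts in the weak sense. The integrands vanish off the box, which
    permits the passage between the box and \<Omega>.\<close>
  have IB: "integral ?Q (\<lambda>z. u z * B i t z) = - (LINT z:?Q|lebesgue. \<Gamma> z $ i * \<psi> i t z)" if tU: "t \<in> U" for i t
  proof -
    have "set_integrable lebesgue ?Q (\<lambda>z. u z * B i t z)"
      by (intro absolutely_integrable_continuous continuous_intros u cB1)
    then have "integral ?Q (\<lambda>z. u z * B i t z) = (LINT z:?Q|lebesgue. u z * B i t z)"
      by (rule set_lebesgue_integral_eq_integral(2)[symmetric])
    also have "\<dots> = (LINT z:\<Omega>|lebesgue. u z * B i t z)"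
      by (rule set_integral_subset[symmetric]) (use Q B_out[OF tU] in auto)
    also have "\<dots> = (LINT z:\<Omega>|lebesgue. u z * pdiff i (\<lambda>z. \<psi> i t z) z)"
      unfolding test(2)[OF tU] ..
    also have "\<dots> = - (LINT z:\<Omega>|lebesgue. \<Gamma> z $ i * \<psi> i t z)"
      by (rule W[OF test(1)[OF tU]])
    also have "(LINT z:\<Omega>|lebesgue. \<Gamma> z $ i * \<psi> i t z) = (LINT z:?Q|lebesgue. \<Gamma> z $ i * \<psi> i t z)"
      by (rule set_integral_subset) (use Q cube_bump_out[OF tU] in \<open>auto simp: \<psi>_def\<close>)
    finally show ?thesis .
  qed
  have i\<Gamma>: "set_integrable lebesgue ?Q (\<lambda>z. \<Gamma> z $ i * \<psi> i t z)" for i t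
    using set_integrable_continuous_mult[OF c\<psi> compact_cbox \<Gamma>, of i t i] by (simp add: mult.commute)
  have deriv: "((\<lambda>t. integral ?Q (\<lambda>z. u z * P t z)) has_real_derivative integral ?Q (\<lambda>z. u z * D t z)) (at t within U)"
  proof (rule leibniz_rule_field_derivative)
    show "((\<lambda>t. u z * P t z) has_real_derivative u z * D t z) (at t within U)" if "t \<in> U" for t z
      by (rule DERIV_subset[OF DERIV_cmult[OF dP[OF that]]]) simp
    show "(\<lambda>z. u z * P t z) integrable_on ?Q" for t
      by (intro integrable_continuous continuous_intros u cP)
    show "continuous_on (U \<times> ?Q) (\<lambda>(t, z). u z * D t z)"
      using cD unfolding split_beta by (intro continuous_intros continuous_on_compose2[OF u]) auto
  qed (use U t in auto)
  have F: "(LINT \<zeta>|lebesgue. u (c t + s t *\<^sub>R \<zeta>) * cube_bump \<zeta>) = integral ?Q (\<lambda>z. u z * P t z)" if tU: "t \<in> U" for t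
  proof -
    have "set_integrable lebesgue ?Q (\<lambda>z. u z * 1 * P t z)"
      by (intro absolutely_integrable_continuous continuous_intros u cP)
    from change[OF tU this] show ?thesis by simp
  qed
  have D: "integral ?Q (\<lambda>z. u z * D t z) = (LINT \<zeta>|lebesgue. (\<Gamma> (c t + s t *\<^sub>R \<zeta>) \<bullet> (a + \<sigma> *\<^sub>R \<zeta>)) * cube_bump \<zeta>)"
  proof -
    have "(\<lambda>z. u z * D t z) = (\<lambda>z. - (1 / s t ^ ?n) * (\<Sum>i\<in>UNIV. u z * B i t z))"
      by (simp add: D_def fun_eq_iff flip: sum_distrib_left)
    then have "integral ?Q (\<lambda>z. u z * D t z) = - (1 / s t ^ ?n) * (\<Sum>i\<in>UNIV. integral ?Q (\<lambda>z. u z * B i t z))"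
      by (simp only: integral_mult_right)
        (subst integral_sum, auto intro!: integrable_continuous continuous_intros u cB1)
    also have "\<dots> = (1 / s t ^ ?n) * (\<Sum>i\<in>UNIV. (LINT z:?Q|lebesgue. \<Gamma> z $ i * \<psi> i t z))"
      by (simp add: IB[OF t] sum_negf)
    also have "\<dots> = (\<Sum>i\<in>UNIV. (LINT \<zeta>|lebesgue. \<Gamma> (c t + s t *\<^sub>R \<zeta>) $ i * (a$i + \<sigma> * \<zeta>$i) * cube_bump \<zeta>))"
      unfolding sum_distrib_left
    proof (rule sum.cong[OF refl])
      fix i :: 'n
      have e: "(\<lambda>z. \<Gamma> z $ i * (a$i + \<sigma> * Z t z $ i) * P t z) = (\<lambda>z. (1 / s t ^ ?n) * (\<Gamma> z $ i * \<psi> i t z))"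
        by (simp add: P_def \<psi>_def fun_eq_iff)
      have i1: "set_integrable lebesgue ?Q (\<lambda>z. \<Gamma> z $ i * (a$i + \<sigma> * Z t z $ i) * P t z)"
        unfolding e by (intro set_integrable_mult_right i\<Gamma>)
      have "(LINT \<zeta>|lebesgue. \<Gamma> (c t + s t *\<^sub>R \<zeta>) $ i * (a$i + \<sigma> * \<zeta>$i) * cube_bump \<zeta>)
        = integral ?Q (\<lambda>z. \<Gamma> z $ i * (a$i + \<sigma> * Z t z $ i) * P t z)"
        using change[OF t, of "\<lambda>z. \<Gamma> z $ i" "\<lambda>\<zeta>. a$i + \<sigma> * \<zeta>$i"] i1 by simp
      also have "\<dots> = (1 / s t ^ ?n) * integral ?Q (\<lambda>z. \<Gamma> z $ i * \<psi> i t z)"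
        unfolding e by (rule integral_mult_right)
      also have "integral ?Q (\<lambda>z. \<Gamma> z $ i * \<psi> i t z) = (LINT z:?Q|lebesgue. \<Gamma> z $ i * \<psi> i t z)"
        by (rule set_lebesgue_integral_eq_integral(2)[OF i\<Gamma>, symmetric])
      finally show "1 / s t ^ ?n * (LINT z:?Q|lebesgue. \<Gamma> z $ i * \<psi> i t z)
        = (LINT \<zeta>|lebesgue. \<Gamma> (c t + s t *\<^sub>R \<zeta>) $ i * (a$i + \<sigma> * \<zeta>$i) * cube_bump \<zeta>)" by simp
    qed
    also have "\<dots> = (LINT \<zeta>|lebesgue. (\<Sum>i\<in>UNIV. \<Gamma> (c t + s t *\<^sub>R \<zeta>) $ i * (a$i + \<sigma> * \<zeta>$i) * cube_bump \<zeta>))"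
    proof (rule Bochner_Integration.integral_sum[symmetric])
      fix i :: 'n
      let ?h = "\<lambda>z. indicator ?Q z *\<^sub>R (\<Gamma> z $ i * \<psi> i t z)"
      have "integrable lebesgue (\<lambda>\<zeta>. ?h (c t + s t *\<^sub>R \<zeta>))"
        using i\<Gamma>[of i t] s_pos[OF t] unfolding set_integrable_def
        by (intro lebesgue_integral_affine(2)) auto
      moreover have "(\<lambda>\<zeta>. ?h (c t + s t *\<^sub>R \<zeta>)) = (\<lambda>\<zeta>. \<Gamma> (c t + s t *\<^sub>R \<zeta>) $ i * (a$i + \<sigma> * \<zeta>$i) * cube_bump \<zeta>)"
        using cube_bump_out[OF t, of "c t + s t *\<^sub>R _"]
        by (auto simp: fun_eq_iff \<psi>_def Zback[OF t] indicator_def)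
      ultimately show "integrable lebesgue (\<lambda>\<zeta>. \<Gamma> (c t + s t *\<^sub>R \<zeta>) $ i * (a$i + \<sigma> * \<zeta>$i) * cube_bump \<zeta>)" by simp
    qed
    finally show ?thesis
      by (simp add: inner_vec_def sum_distrib_right)
  qed
  have "((\<lambda>t. LINT \<zeta>|lebesgue. u (c t + s t *\<^sub>R \<zeta>) * cube_bump \<zeta>) has_real_derivative
     (LINT \<zeta>|lebesgue. (\<Gamma> (c t + s t *\<^sub>R \<zeta>) \<bullet> (a + \<sigma> *\<^sub>R \<zeta>)) * cube_bump \<zeta>)) (at t within U)"
    using deriv unfolding D by (rule has_field_derivative_transform_within[where d=1]) (auto simp: F t)
  then show ?thesis
    using at_within_open[OF t U(1)] by (simp add: c_def s_def)
qed

section \<open>Lebesgue points\<close>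

lemma content_cball_scale:
  fixes c :: "'a::euclidean_space"
  assumes "r \<ge> 0"
  shows "measure lborel (cball c r) = r ^ DIM('a) * measure lborel (cball (0::'a) 1)"
  using content_ball_conv_unit_ball[OF assms, of c] by (simp add: content_cball_conv_ball)

lemma set_integral_subset_mono:
  fixes k :: "'a \<Rightarrow> real"
  assumes "set_integrable M B k" and "A \<in> sets M" and "A \<subseteq> B" and "\<And>z. z \<in> B \<Longrightarrow> k z \<ge> 0"
  shows "(LINT z:A|M. k z) \<le> (LINT z:B|M. k z)"
proof -
  have "set_integrable M A k" using assms(1-3) by (rule set_integrable_subset)
  then show ?thesis
    using assms unfolding set_integrable_def set_lebesgue_integral_def
    by (intro integral_mono) (auto split: split_indicator)
qed

text \<open>The weak-type bound for the maximal function. By Vitali's lemma, which requires bounded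
  radii, disjoint balls of radius r, each of mass more than b r^n, can be chosen so that the balls
  of five times the radius still cover \<open>E\<close>; the disjoint balls together carry at most
  the mass of \<open>U\<close>. A measurable superset \<open>T\<close> is produced because
  \<open>E\<close> is not known to be measurable.\<close>

lemma small_mass_covering:
  fixes k :: "'a::euclidean_space \<Rightarrow> real"
  assumes k: "integrable lebesgue k" "\<And>z. k z \<ge> 0" and b: "b > 0"
    and U: "U \<in> sets lebesgue" and E: "\<And>z. z \<in> E \<Longrightarrow> \<exists>r>0. r \<le> 1 \<and> cball z r \<subseteq> U \<and> b * r ^ DIM('a) < (LINT w:cball z r|lebesgue. k w)"
  obtains T where "E \<subseteq> T" "T \<in> lmeasurable"
    "measure lebesgue T \<le> 5 ^ DIM('a) * measure lborel (cball (0::'a) 1) / b * (LINT w:U|lebesgue. k w)"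
proof -
  let ?B = "5 ^ DIM('a) * measure lborel (cball (0::'a) 1) / b * (LINT w:U|lebesgue. k w)"
  obtain r where r: "\<And>z. z \<in> E \<Longrightarrow> 0 < r z \<and> r z \<le> 1 \<and> cball z (r z) \<subseteq> U \<and> b * r z ^ DIM('a) < (LINT w:cball z (r z)|lebesgue. k w)"
    using E by metis
  have "E \<subseteq> (\<Union>z\<in>E. cball z (r z))"
    using r by (fastforce simp: less_imp_le)
  then obtain C where C: "countable C" "C \<subseteq> E"
     "pairwise (\<lambda>i j. disjnt (cball i (r i)) (cball j (r j))) C"
     "E \<subseteq> (\<Union>i\<in>C. cball i (5 * r i))"
    by (rule Vitali_covering_lemma_cballs[where a="\<lambda>z. z" and B=1]) (use r in auto)
  have si: "set_integrable lebesgue A k" if "A \<in> sets lebesgue" for A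
    using k(1) that unfolding set_integrable_def by (intro integrable_mult_indicator)
  have bound: "measure lebesgue (\<Union>i\<in>I. cball i (5 * r i)) \<le> ?B" if I: "I \<subseteq> C" "finite I" for I
  proof -
    have "measure lebesgue (\<Union>i\<in>I. cball i (5 * r i)) \<le> (\<Sum>i\<in>I. measure lebesgue (cball i (5 * r i)))"
      by (intro measure_UNION_le I) auto
    also have "\<dots> \<le> (\<Sum>i\<in>I. 5 ^ DIM('a) * measure lborel (cball (0::'a) 1) / b * (LINT w:cball i (r i)|lebesgue. k w))"
    proof (rule sum_mono)
      fix i assume "i \<in> I"
      then have i: "0 < r i" "b * r i ^ DIM('a) < (LINT w:cball i (r i)|lebesgue. k w)"
        using r I C by blast+
      have "measure lebesgue (cball i (5 * r i)) = 5 ^ DIM('a) * measure lborel (cball (0::'a) 1) * r i ^ DIM('a)"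
        using i content_cball_scale[of "5 * r i" i] by (simp add: power_mult_distrib)
      also have "\<dots> = 5 ^ DIM('a) * measure lborel (cball (0::'a) 1) / b * (b * r i ^ DIM('a))"
        using b by simp
      also have "\<dots> \<le> 5 ^ DIM('a) * measure lborel (cball (0::'a) 1) / b * (LINT w:cball i (r i)|lebesgue. k w)"
        using b i by (intro mult_left_mono) auto
      finally show "measure lebesgue (cball i (5 * r i)) \<le> 5 ^ DIM('a) * measure lborel (cball (0::'a) 1) / b * (LINT w:cball i (r i)|lebesgue. k w)" .
    qed
    also have "\<dots> = 5 ^ DIM('a) * measure lborel (cball (0::'a) 1) / b * (LINT w:(\<Union>i\<in>I. cball i (r i))|lebesgue. k w)"
    proof -
      have "disjoint_family_on (\<lambda>i. cball i (r i)) I"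
        using C(3) I unfolding disjoint_family_on_def pairwise_def disjnt_def by blast
      then show ?thesis
        unfolding sum_distrib_left[symmetric]
        by (subst set_integral_finite_Union) (use I si in auto)
    qed
    also have "\<dots> \<le> ?B"
    proof (intro mult_left_mono)
      have "(\<Union>i\<in>I. cball i (r i)) \<subseteq> U" using r I C by blast
      then show "(LINT w:(\<Union>i\<in>I. cball i (r i))|lebesgue. k w) \<le> (LINT w:U|lebesgue. k w)"
        using si[OF U] I(2) k(2) by (intro set_integral_subset_mono) auto
    qed (use b in auto)
    finally show ?thesis .
  qed
  show ?thesis
  proof
    show "(\<Union>i\<in>C. cball i (5 * r i)) \<in> lmeasurable"
      by (rule fmeasurable_UN_bound[OF C(1) _ bound]) auto
    show "measure lebesgue (\<Union>i\<in>C. cball i (5 * r i)) \<le> ?B"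
      by (rule measure_UN_bound[OF C(1) _ bound]) auto
  qed (use C in auto)
qed

text \<open>On a compact part \<open>K\<close> of \<open>S\<close>, the points where the averages
  exceed a level \<open>b\<close> infinitely often lie in a set of measure at most a constant times
  the mass of \<open>k\<close> on any neighbourhood of \<open>K\<close>. That mass tends to 0 as the
  neighbourhoods shrink, since \<open>k\<close> vanishes on \<open>K\<close>. Inner regularity
  exhausts \<open>S\<close> by compact sets up to a null set.\<close>

lemma AE_zero_density:
  fixes k :: "'a::euclidean_space \<Rightarrow> real"
  assumes k: "integrable lebesgue k" "\<And>z. k z \<ge> 0" and S: "S \<in> sets lebesgue" "\<And>z. z \<in> S \<Longrightarrow> k z = 0"
  shows "AE z in lebesgue. z \<in> S \<longrightarrow> ((\<lambda>r. (LINT w:cball z r|lebesgue. k w) / r ^ DIM('a)) \<longlongrightarrow> 0) (at_right 0)"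
proof -
  define bad where "bad K b = {z \<in> K. \<not> (\<forall>\<^sub>F r in at_right 0. (LINT w:cball z r|lebesgue. k w) \<le> b * r ^ DIM('a))}" for K b
  have neg: "negligible (bad K b)" if K: "compact K" "K \<subseteq> S" and b: "b > 0" for K b
    unfolding negligible_outer_le
  proof (intro allI impI)
    fix e :: real assume e: "e > 0"
    let ?c = "5 ^ DIM('a) * measure lborel (cball (0::'a) 1) / b"
    show "\<exists>T. bad K b \<subseteq> T \<and> T \<in> lmeasurable \<and> measure lebesgue T \<le> e"
    proof (cases "K = {}")
      case True
      then show ?thesis using e by (intro exI[of _ "{}"]) (auto simp: bad_def)
    next
      case False
      define U where "U m = {z. infdist z K < 1 / real (Suc m)}" for m
      have opU: "open (U m)" for m
        unfolding U_def by (intro open_Collect_less continuous_intros)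
      have KU: "K \<subseteq> U m" for m unfolding U_def by auto
      have "(\<lambda>m. LINT w:U m|lebesgue. k w) \<longlonglongrightarrow> (LINT w:(\<Inter>m. U m)|lebesgue. k w)"
      proof (rule set_integral_cont_down)
        show "decseq U" unfolding U_def decseq_def
          by (auto elim!: less_le_trans simp: frac_le)
        show "set_integrable lebesgue (U 0) k"
          using k(1) borel_open[OF opU[of 0]] unfolding set_integrable_def
          by (intro integrable_mult_indicator) auto
      qed (use opU in auto)
      also have "(\<Inter>m. U m) = K"
      proof -
        have "z \<in> K" if z: "\<And>m. infdist z K < 1 / real (Suc m)" for z
        proof -
          have "infdist z K \<le> 0"
          proof (rule field_le_epsilon)
            fix e :: real assume "e > 0"
            then obtain m where "1 / real (Suc m) < e" using nat_approx_posE by blast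
            then show "infdist z K \<le> 0 + e" using z[of m] by simp
          qed
          then have "infdist z K = 0" using infdist_nonneg[of z K] by linarith
          then show ?thesis using in_closed_iff_infdist_zero[of K z] K(1) False compact_imp_closed by blast
        qed
        then show ?thesis using KU by (auto simp: U_def)
      qed
      also have "(LINT w:K|lebesgue. k w) = (LINT w:K|lebesgue. 0)"
        by (rule set_lebesgue_integral_cong) (use K S in \<open>auto simp: borel_compact\<close>)
      finally have lim: "(\<lambda>m. LINT w:U m|lebesgue. k w) \<longlonglongrightarrow> 0" by simp
      have c: "?c > 0" using b by simp
      then obtain m where m: "(LINT w:U m|lebesgue. k w) < e / ?c"
        using order_tendstoD(2)[OF lim, of "e / ?c"] e by (auto simp: eventually_sequentially simp del: times_divide_eq_right divide_divide_eq_right divide_divide_eq_left times_divide_eq_left)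
      have "\<exists>r>0. r \<le> 1 \<and> cball z r \<subseteq> U m \<and> b * r ^ DIM('a) < (LINT w:cball z r|lebesgue. k w)" if z: "z \<in> bad K b" for z
      proof -
        obtain d where d: "d > 0" "cball z d \<subseteq> U m"
          using opU KU z open_contains_cball unfolding bad_def by blast
        have "\<exists>\<^sub>F r in at_right 0. b * r ^ DIM('a) < (LINT w:cball z r|lebesgue. k w)"
          using z unfolding bad_def by (auto simp: not_eventually not_le)
        moreover have "\<forall>\<^sub>F r in at_right 0. 0 < r \<and> r < min d 1"
          using eventually_at_right_real[of 0 "min d 1"] d(1) by (auto elim: eventually_mono)
        ultimately obtain r where "0 < r" "r < min d 1" "b * r ^ DIM('a) < (LINT w:cball z r|lebesgue. k w)"
          using frequently_ex[OF frequently_eventually_conj] by (metis (mono_tags, lifting))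
        then show ?thesis using d subset_cball[of r d z] by (intro exI[of _ r]) auto
      qed
      from small_mass_covering[OF k b _ this] obtain T where T: "bad K b \<subseteq> T" "T \<in> lmeasurable"
          "measure lebesgue T \<le> ?c * (LINT w:U m|lebesgue. k w)"
        using opU by (metis borel_open sets_completionI_sets sets_lborel)
      have "?c * (LINT w:U m|lebesgue. k w) \<le> e"
        using m unfolding pos_less_divide_eq[OF c] by (simp only: mult.commute less_imp_le)
      then show ?thesis using T by (intro exI[of _ T]) linarith
    qed
  qed
  obtain N C where NC: "negligible N" "\<And>n::nat. compact (C n)" "S = (\<Union>n. C n) \<union> N"
    using lebesgue_regular_inner[OF S(1)] by metis
  have "negligible (N \<union> (\<Union>n. \<Union>j. bad (C n) (1 / real (Suc j))))"
    using NC by (intro negligible_Un negligible_countable_Union[of "range _"] | auto intro!: neg negligible_countable_Union)+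
  then have "AE z in lebesgue. z \<notin> N \<union> (\<Union>n. \<Union>j. bad (C n) (1 / real (Suc j)))"
    unfolding negligible_iff_null_sets by (rule AE_not_in)
  then show ?thesis
  proof (rule AE_mp, intro AE_I2 impI)
    fix z assume z: "z \<notin> N \<union> (\<Union>n. \<Union>j. bad (C n) (1 / real (Suc j)))" and "z \<in> S"
    then obtain n where n: "z \<in> C n" using NC(3) by auto
    have ev: "\<forall>\<^sub>F r in at_right 0. (LINT w:cball z r|lebesgue. k w) \<le> 1 / real (Suc j) * r ^ DIM('a)" for j
      using z n by (auto simp: bad_def)
    show "((\<lambda>r. (LINT w:cball z r|lebesgue. k w) / r ^ DIM('a)) \<longlongrightarrow> 0) (at_right 0)"
    proof (rule tendstoI)
      fix e :: real assume "e > 0"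
      then obtain j where j: "1 / real (Suc j) < e" using nat_approx_posE by blast
      from ev[of j] eventually_at_right_less[of "0::real"]
      show "\<forall>\<^sub>F r in at_right 0. dist ((LINT w:cball z r|lebesgue. k w) / r ^ DIM('a)) 0 < e"
      proof eventually_elim
        case (elim r)
        have "(LINT w:cball z r|lebesgue. k w) \<ge> 0"
          unfolding set_lebesgue_integral_def using k(2) by (intro integral_nonneg_AE) auto
        moreover have "(LINT w:cball z r|lebesgue. k w) / r ^ DIM('a) \<le> 1 / real (Suc j)"
          using elim by (simp add: pos_divide_le_eq)
        ultimately show ?case using j elim by (simp add: dist_real_def)
      qed
    qed
  qed
qed

lemma powr_add_le:
  fixes a b q :: real
  assumes "a \<ge> 0" "b \<ge> 0" "q \<ge> 0"
  shows "(a + b) powr q \<le> 2 powr q * (a powr q + b powr q)"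
proof -
  have "(a + b) powr q \<le> (2 * max a b) powr q"
    using assms by (intro powr_mono2) auto
  also have "\<dots> = 2 powr q * max a b powr q"
    using assms by (simp add: powr_mult)
  also have "max a b powr q \<le> a powr q + b powr q"
    by (auto simp: max_def)
  finally show ?thesis by simp
qed

lemma set_integrable_norm_diff_powr:
  fixes \<Gamma> :: "'a::euclidean_space \<Rightarrow> 'b::euclidean_space" and q :: real
  assumes K: "compact K" and q: "q > 0" and [measurable]: "\<Gamma> \<in> borel_measurable (lebesgue_on K)"
    and int: "set_integrable lebesgue K (\<lambda>z. norm (\<Gamma> z) powr q)"
  shows "set_integrable lebesgue K (\<lambda>z. norm (\<Gamma> z - c) powr q)"
proof -
  have Ks: "K \<in> sets lebesgue" "K \<in> lmeasurable" using K by (simp_all add: borel_compact lmeasurable_compact)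
  have "(\<lambda>z. norm (\<Gamma> z - c) powr q) \<in> borel_measurable (lebesgue_on K)" by measurable
  then have m: "set_borel_measurable lebesgue K (\<lambda>z. norm (\<Gamma> z - c) powr q)"
    using Ks by (simp add: borel_measurable_restrict_space_iff set_borel_measurable_def)
  have "set_integrable lebesgue K (\<lambda>z. 2 powr q * (norm (\<Gamma> z) powr q + norm c powr q))"
    using Ks(2) by (intro set_integrable_mult_right set_integral_add int) (auto simp: absolutely_integrable_on_const)
  then show ?thesis
  proof (rule set_integrable_bound[OF _ m], intro AE_I2 impI)
    fix z
    have "norm (\<Gamma> z - c) powr q \<le> (norm (\<Gamma> z) + norm c) powr q"
      using q norm_triangle_ineq4 by (intro powr_mono2) auto
    also have "\<dots> \<le> 2 powr q * (norm (\<Gamma> z) powr q + norm c powr q)"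
      using q by (intro powr_add_le) auto
    finally show "norm (norm (\<Gamma> z - c) powr q) \<le> norm (2 powr q * (norm (\<Gamma> z) powr q + norm c powr q))" by simp
  qed
qed

text \<open>Where \<Gamma> is within \<eta> of a constant c, the function
  \<open>k m c \<eta>\<close> vanishes, so it has zero density at almost all such points. There
  \<Gamma> differs from its value at the centre by at most 2 \<eta>, up to a part controlled by
  \<open>k\<close>. Constants c from a countable dense set and \<eta> = 1/(j+1) keep the exceptional
  sets countable in number.\<close>

lemma AE_Lebesgue_point:
  fixes \<Gamma> :: "'a::euclidean_space \<Rightarrow> 'b::euclidean_space" and q :: real
  assumes \<Omega>: "open \<Omega>" and q: "q > 0"
    and meas: "\<And>K. compact K \<Longrightarrow> K \<subseteq> \<Omega> \<Longrightarrow> \<Gamma> \<in> borel_measurable (lebesgue_on K)"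
    and int: "\<And>K. compact K \<Longrightarrow> K \<subseteq> \<Omega> \<Longrightarrow> set_integrable lebesgue K (\<lambda>z. norm (\<Gamma> z) powr q)"
  shows "AE z in lebesgue. z \<in> \<Omega> \<longrightarrow>
    ((\<lambda>r. (LINT w:cball z r|lebesgue. norm (\<Gamma> w - \<Gamma> z) powr q) / r ^ DIM('a)) \<longlongrightarrow> 0) (at_right 0)"
proof -
  obtain C where C: "\<And>n. compact (C n)" "\<And>n. C n \<subseteq> \<Omega>" "\<And>n. C n \<subseteq> interior (C (Suc n))"
      "\<Union>(range C) = \<Omega>"
    using open_Union_compact_subsets[OF \<Omega>] by metis
  obtain D :: "'b set" where D: "countable D" "\<And>X. open X \<Longrightarrow> X \<noteq> {} \<Longrightarrow> \<exists>d\<in>D. d \<in> X"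
    using countable_dense_setE by blast
  define S where "S m c \<eta> = {z \<in> C m. norm (\<Gamma> z - c) < \<eta>}" for m c \<eta>
  define k where "k m c \<eta> z = indicator (C m - S m c \<eta>) z * norm (\<Gamma> z - c) powr q" for m c \<eta> z
  have Cs: "C m \<in> sets lebesgue" for m using C(1) by (simp add: borel_compact)
  have S_sets: "S m c \<eta> \<in> sets lebesgue" for m c \<eta>
  proof -
    have [measurable]: "\<Gamma> \<in> borel_measurable (lebesgue_on (C m))" by (intro meas C)
    have "{z \<in> space (lebesgue_on (C m)). norm (\<Gamma> z - c) < \<eta>} \<in> sets (lebesgue_on (C m))" by measurable
    then show ?thesis
      using Cs[of m] by (simp add: S_def sets_restrict_space_iff space_restrict_space)
  qed
  have pint: "set_integrable lebesgue K (\<lambda>z. norm (\<Gamma> z - c) powr q)"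
    if K: "compact K" "K \<subseteq> \<Omega>" for K c
    by (rule set_integrable_norm_diff_powr[OF K(1) q meas[OF K] int[OF K]])
  have kint: "integrable lebesgue (k m c \<eta>)" for m c \<eta>
  proof -
    have "set_integrable lebesgue (C m - S m c \<eta>) (\<lambda>z. norm (\<Gamma> z - c) powr q)"
      using Cs S_sets by (intro set_integrable_subset[OF pint[OF C(1,2)[of m]]]) auto
    then show ?thesis by (simp add: set_integrable_def k_def[abs_def])
  qed
  have "AE z in lebesgue. z \<in> S m c \<eta> \<longrightarrow>
      ((\<lambda>r. (LINT w:cball z r|lebesgue. k m c \<eta> w) / r ^ DIM('a)) \<longlongrightarrow> 0) (at_right 0)" for m c \<eta>
    by (rule AE_zero_density[OF kint _ S_sets]) (auto simp: k_def)
  then have "AE z in lebesgue. \<forall>m. \<forall>c\<in>D. \<forall>j::nat. z \<in> S m c (1 / Suc j) \<longrightarrow>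
      ((\<lambda>r. (LINT w:cball z r|lebesgue. k m c (1 / Suc j) w) / r ^ DIM('a)) \<longlongrightarrow> 0) (at_right 0)"
    unfolding AE_all_countable AE_ball_countable[OF D(1)] by blast
  then show ?thesis
  proof (rule AE_mp, intro AE_I2 impI)
    fix z assume good: "\<forall>m. \<forall>c\<in>D. \<forall>j::nat. z \<in> S m c (1 / Suc j) \<longrightarrow>
      ((\<lambda>r. (LINT w:cball z r|lebesgue. k m c (1 / Suc j) w) / r ^ DIM('a)) \<longlongrightarrow> 0) (at_right 0)"
      and z: "z \<in> \<Omega>"
    obtain m where m: "z \<in> interior (C m)" using z C(3,4) by blast
    then obtain d where d: "d > 0" "cball z d \<subseteq> C m"
      by (meson interior_subset open_contains_cball open_interior subset_trans)
    define v where "v = measure lborel (cball (0::'a) 1)"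
    have v: "v \<ge> 0" by (simp add: v_def)
    show "((\<lambda>r. (LINT w:cball z r|lebesgue. norm (\<Gamma> w - \<Gamma> z) powr q) / r ^ DIM('a)) \<longlongrightarrow> 0) (at_right 0)"
    proof (rule tendstoI)
      fix e :: real assume e: "e > 0"
      \<comment> \<open>Two terms \<eta>^q integrated over a ball of volume v r^n (one for passing
        from \<Gamma> z to c, one for the points of \<open>S\<close>), and one \<eta>^q for the
        average of \<open>k\<close>; the factor \<open>2 powr q\<close> comes from
        \<open>powr_add_le\<close>.\<close>
      define A where "A = 2 powr q * (2 * v + 1)"
      have A: "A > 0" using v by (simp add: A_def add_nonneg_pos)
      obtain j :: nat where j: "1 / Suc j < (e / A) powr (1/q)"
        using nat_approx_posE[of "(e / A) powr (1/q)"] e A by auto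
      define \<eta> where "\<eta> = 1 / real (Suc j)"
      have \<eta>0: "\<eta> > 0" by (simp add: \<eta>_def)
      have "\<eta> powr q < ((e / A) powr (1/q)) powr q"
        using j q by (intro powr_less_mono2) (auto simp: \<eta>_def)
      then have \<eta>: "A * \<eta> powr q < e"
        using e A q by (simp add: powr_powr field_simps)
      obtain c where c: "c \<in> D" "norm (\<Gamma> z - c) < \<eta>"
        using D(2)[of "ball (\<Gamma> z) \<eta>"] \<eta>0 by (auto simp: dist_norm)
      have "z \<in> S m c \<eta>" using c m interior_subset by (auto simp: S_def)
      with good c(1) have "((\<lambda>r. (LINT w:cball z r|lebesgue. k m c \<eta> w) / r ^ DIM('a)) \<longlongrightarrow> 0) (at_right 0)"
        unfolding \<eta>_def by blast
      then have "\<forall>\<^sub>F r in at_right 0. (LINT w:cball z r|lebesgue. k m c \<eta> w) / r ^ DIM('a) < \<eta> powr q"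
        using \<eta>0 by (intro order_tendstoD) auto
      moreover have "\<forall>\<^sub>F r in at_right 0. 0 < r \<and> r < d"
        using eventually_at_right_real[of 0 d] d(1) by (auto elim: eventually_mono)
      ultimately show "\<forall>\<^sub>F r in at_right 0. dist ((LINT w:cball z r|lebesgue. norm (\<Gamma> w - \<Gamma> z) powr q) / r ^ DIM('a)) 0 < e"
      proof eventually_elim
        case (elim r)
        let ?B = "cball z r"
        have B: "?B \<subseteq> C m" "?B \<subseteq> \<Omega>" using d elim C(2)[of m] subset_cball[of r d z] by auto
        have "norm (\<Gamma> w - \<Gamma> z) powr q \<le> 2 powr q * (k m c \<eta> w + 2 * \<eta> powr q)" if w: "w \<in> ?B" for w
        proof -
          have "norm (\<Gamma> w - \<Gamma> z) \<le> norm (\<Gamma> w - c) + \<eta>"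
            using c(2) norm_triangle_ineq4[of "\<Gamma> w - c" "\<Gamma> z - c"] by simp
          then have "norm (\<Gamma> w - \<Gamma> z) powr q \<le> (norm (\<Gamma> w - c) + \<eta>) powr q"
            using q by (intro powr_mono2) auto
          also have "\<dots> \<le> 2 powr q * (norm (\<Gamma> w - c) powr q + \<eta> powr q)"
            using q \<eta>0 by (intro powr_add_le) auto
          also have "norm (\<Gamma> w - c) powr q \<le> k m c \<eta> w + \<eta> powr q"
          proof (cases "w \<in> S m c \<eta>")
            case True
            then have "norm (\<Gamma> w - c) powr q \<le> \<eta> powr q"
              using q by (intro powr_mono2) (auto simp: S_def)
            then show ?thesis by (simp add: k_def add_increasing)
          next
            case False
            then show ?thesis using w B by (auto simp: k_def)
          qed
          finally show ?thesis by (simp add: add.commute)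
        qed
        moreover have ki: "set_integrable lebesgue ?B (k m c \<eta>)"
          using kint[of m c \<eta>] unfolding set_integrable_def by (intro integrable_mult_indicator) auto
        moreover have ci: "set_integrable lebesgue ?B (\<lambda>_. x)" for x :: real
          by (rule absolutely_integrable_on_const) auto
        ultimately have "(LINT w:?B|lebesgue. norm (\<Gamma> w - \<Gamma> z) powr q) \<le> (LINT w:?B|lebesgue. 2 powr q * (k m c \<eta> w + 2 * \<eta> powr q))"
          using B by (intro set_integral_mono pint set_integrable_mult_right set_integral_add) auto
        also have "\<dots> = 2 powr q * ((LINT w:?B|lebesgue. k m c \<eta> w) + 2 * \<eta> powr q * (v * r ^ DIM('a)))"
        proof -
          have "(LINT w:?B|lebesgue. 2 * \<eta> powr q) = 2 * \<eta> powr q * (v * r ^ DIM('a))"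
            using content_cball_scale[of r z] elim unfolding set_lebesgue_integral_def
            by (simp add: v_def mult.commute)
          then show ?thesis
            using ki ci by (subst set_integral_mult_right, subst set_integral_add) auto
        qed
        also have "\<dots> \<le> 2 powr q * (\<eta> powr q * r ^ DIM('a) + 2 * \<eta> powr q * (v * r ^ DIM('a)))"
          using elim by (intro mult_left_mono add_right_mono) (auto simp: pos_divide_less_eq less_imp_le)
        also have "\<dots> = A * \<eta> powr q * r ^ DIM('a)"
          by (simp add: A_def algebra_simps)
        finally have "(LINT w:?B|lebesgue. norm (\<Gamma> w - \<Gamma> z) powr q) / r ^ DIM('a) \<le> A * \<eta> powr q"
          using elim by (simp add: pos_divide_le_eq)
        moreover have "(LINT w:?B|lebesgue. norm (\<Gamma> w - \<Gamma> z) powr q) \<ge> 0"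
          unfolding set_lebesgue_integral_def by (intro integral_nonneg_AE) auto
        ultimately show ?case using \<eta> elim by (simp add: dist_real_def)
      qed
    qed
  qed
qed

section \<open>Differentiability by Morrey's estimate\<close>

text \<open>If \<open>f\<close> is not integrable, its integral is 0 by convention, and
  \<open>g\<close> dominates an absolute value, so the bound persists. This spares integrability
  proofs for integrands that involve the weak gradient.\<close>

lemma abs_integral_le:
  fixes f g :: "'a \<Rightarrow> real"
  assumes "integrable M g" and "AE x in M. \<bar>f x\<bar> \<le> g x"
  shows "\<bar>integral\<^sup>L M f\<bar> \<le> integral\<^sup>L M g"
proof (cases "integrable M f")
  case True
  have "\<bar>integral\<^sup>L M f\<bar> \<le> (LINT x|M. \<bar>f x\<bar>)"
    using integral_norm_bound[of M f] by simp
  also have "\<dots> \<le> integral\<^sup>L M g"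
    using True assms by (intro integral_mono_AE) auto
  finally show ?thesis .
next
  case False
  then show ?thesis
    using assms(2) by (auto simp: not_integrable_integral_eq intro!: integral_nonneg_AE elim: eventually_mono)
qed

lemma AE_lebesgue_affine:
  fixes c :: "'a::euclidean_space"
  assumes "AE z in lebesgue. P z" and "s \<noteq> 0"
  shows "AE \<zeta> in lebesgue. P (c + s *\<^sub>R \<zeta>)"
proof -
  obtain N where N: "negligible N" "{z. \<not> P z} \<subseteq> N"
    using assms(1) unfolding eventually_ae_filter by (auto simp: negligible_iff_null_sets)
  have "negligible ((\<lambda>z. (1/s) *\<^sub>R (z - c)) ` N)"
    by (intro negligible_differentiable_image_negligible N) (auto intro!: derivative_intros)
  moreover have "\<zeta> \<in> (\<lambda>z. (1/s) *\<^sub>R (z - c)) ` N" if "\<not> P (c + s *\<^sub>R \<zeta>)" for \<zeta>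
    using that N(2) assms(2) by (auto simp: image_image intro!: image_eqI[of _ _ "c + s *\<^sub>R \<zeta>"])
  ultimately show ?thesis
    unfolding negligible_iff_null_sets by (intro AE_I') auto
qed

section \<open>Averages against the bump\<close>

definition bump_mass :: "'n::finite itself \<Rightarrow> real" where
  "bump_mass _ = (LINT \<zeta>|lebesgue. cube_bump (\<zeta> :: real^'n))"

lemma bump_mass_pos: "bump_mass TYPE('n::finite) > 0"
  unfolding bump_mass_def by (rule integral_bb_pos)

lemma integrable_mult_cube_bump:
  fixes g :: "real^'n::finite \<Rightarrow> real"
  assumes "continuous_on (cbox (-1) 1) g"
  shows "integrable lebesgue (\<lambda>\<zeta>. g \<zeta> * cube_bump \<zeta>)"
proof -
  have "(\<lambda>\<zeta>. g \<zeta> * cube_bump \<zeta>) absolutely_integrable_on cbox (-1::real^'n) 1"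
    by (intro absolutely_integrable_continuous continuous_intros assms continuous_on_subset[OF continuous_cube_bump]) auto
  then show ?thesis
    unfolding set_integrable_def
    by (rule Bochner_Integration.integrable_cong[THEN iffD1, rotated 2]) (auto simp: cube_bump_eq_0 indicator_def)
qed

lemma norm_le_if_bb_nonzero:
  fixes \<zeta> :: "real^'n::finite"
  assumes "cube_bump \<zeta> \<noteq> 0" shows "norm \<zeta> \<le> real CARD('n)"
proof -
  have "norm \<zeta> \<le> (\<Sum>j\<in>UNIV. \<bar>\<zeta>$j\<bar>)" by (rule norm_le_l1_cart)
  also have "\<dots> \<le> (\<Sum>j\<in>(UNIV::'n set). 1)"
    using cube_bump_nonzero[OF assms] by (intro sum_mono) (simp add: less_imp_le)
  finally show ?thesis by simp
qed

lemma cube_bump_average_close: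
  fixes g :: "real^'n::finite \<Rightarrow> real"
  assumes "integrable lebesgue (\<lambda>\<zeta>. g \<zeta> * cube_bump \<zeta>)" and "\<And>\<zeta>. cube_bump \<zeta> \<noteq> 0 \<Longrightarrow> \<bar>g \<zeta> - A\<bar> \<le> \<omega>"
  shows "\<bar>(LINT \<zeta>|lebesgue. g \<zeta> * cube_bump \<zeta>) - A * bump_mass TYPE('n)\<bar> \<le> \<omega> * bump_mass TYPE('n)"
proof -
  have "(LINT \<zeta>|lebesgue. g \<zeta> * cube_bump \<zeta>) - A * bump_mass TYPE('n) = (LINT \<zeta>|lebesgue. g \<zeta> * cube_bump \<zeta> - A * cube_bump \<zeta>)"
    using assms(1) integrable_cube_bump by (subst Bochner_Integration.integral_diff) (auto simp: bump_mass_def)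
  also have "\<bar>\<dots>\<bar> \<le> (LINT \<zeta>|lebesgue. \<omega> * cube_bump (\<zeta> :: real^'n))"
  proof (rule abs_integral_le)
    show "integrable lebesgue (\<lambda>\<zeta> :: real^'n. \<omega> * cube_bump \<zeta>)" by (simp add: integrable_cube_bump)
    show "AE \<zeta> in lebesgue. \<bar>g \<zeta> * cube_bump \<zeta> - A * cube_bump \<zeta>\<bar> \<le> \<omega> * cube_bump \<zeta>"
    proof (rule AE_I2)
      fix \<zeta> :: "real^'n"
      show "\<bar>g \<zeta> * cube_bump \<zeta> - A * cube_bump \<zeta>\<bar> \<le> \<omega> * cube_bump \<zeta>"
        using assms(2)[of \<zeta>] cube_bump_nonneg[of \<zeta>]
        by (cases "cube_bump \<zeta> = 0") (auto simp: abs_mult intro!: mult_right_mono simp flip: left_diff_distrib)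
    qed
  qed
  finally show ?thesis by (simp add: bump_mass_def)
qed

text \<open>The value of the averages at time 0. The centre may move with the radius, as it does in
  \<open>Morrey_path\<close>. The kernel is not normalised, so its mass appears in the
  limit.\<close>

lemma cube_bump_average_tendsto:
  fixes u :: "real^'n::finite \<Rightarrow> real" and c :: "real \<Rightarrow> real^'n"
  assumes \<Omega>: "open \<Omega>" "continuous_on \<Omega> u" "w \<in> \<Omega>" and c: "(c \<longlongrightarrow> w) (at_right 0)"
  shows "((\<lambda>t. LINT \<zeta>|lebesgue. u (c t + t *\<^sub>R \<zeta>) * cube_bump \<zeta>) \<longlongrightarrow> u w * bump_mass TYPE('n)) (at_right 0)"
proof (rule tendstoI)
  let ?n = "real CARD('n)"
  have k: "bump_mass TYPE('n) > 0" by (rule bump_mass_pos)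
  fix e :: real assume "e > 0"
  define \<omega> where "\<omega> = e / (2 * bump_mass TYPE('n))"
  have \<omega>: "\<omega> > 0" using \<open>e > 0\<close> k by (simp add: \<omega>_def)
  have "isCont u w" using \<Omega> by (simp add: continuous_on_eq_continuous_at)
  then obtain d1 where d1: "d1 > 0" "\<And>z. dist z w < d1 \<Longrightarrow> dist (u z) (u w) < \<omega>"
    using \<omega> unfolding continuous_at_eps_delta by blast
  obtain d2 where d2: "d2 > 0" "ball w d2 \<subseteq> \<Omega>" using \<Omega> open_contains_ball by blast
  define d where "d = min d1 d2"
  have d: "d > 0" "ball w d \<subseteq> \<Omega>" "\<And>z. dist z w < d \<Longrightarrow> dist (u z) (u w) < \<omega>"
    using d1 d2 by (auto simp: d_def)
  have "\<forall>\<^sub>F t in at_right 0. dist (c t) w < d / 2"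
    using c d(1) by (intro tendstoD) auto
  moreover have "\<forall>\<^sub>F t in at_right 0. 0 < t \<and> t < d / (2 * ?n)"
    using eventually_at_right_real[of 0 "d / (2 * ?n)"] d(1) by (auto elim: eventually_mono)
  ultimately show "\<forall>\<^sub>F t in at_right 0. dist (LINT \<zeta>|lebesgue. u (c t + t *\<^sub>R \<zeta>) * cube_bump \<zeta>) (u w * bump_mass TYPE('n)) < e"
  proof eventually_elim
    case (elim t)
    have close: "dist (c t + t *\<^sub>R \<zeta>) w < d" if "norm \<zeta> \<le> ?n" for \<zeta>
    proof -
      have "norm (t *\<^sub>R \<zeta>) \<le> t * ?n" using that elim by (simp add: mult_left_mono)
      also have "\<dots> < d / 2" using elim by (simp add: pos_less_divide_eq mult_ac)
      finally show ?thesis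
        using elim norm_triangle_ineq[of "c t - w" "t *\<^sub>R \<zeta>"] by (simp add: dist_norm algebra_simps)
    qed
    have box: "norm \<zeta> \<le> ?n" if "\<zeta> \<in> cbox (-1) 1" for \<zeta> :: "real^'n"
    proof -
      have "norm \<zeta> \<le> (\<Sum>j\<in>UNIV. \<bar>\<zeta>$j\<bar>)" by (rule norm_le_l1_cart)
      also have "\<dots> \<le> (\<Sum>j\<in>(UNIV::'n set). 1)"
        using that by (intro sum_mono) (auto simp: mem_box_cart abs_le_iff minus_le_iff)
      finally show ?thesis by simp
    qed
    have "\<bar>(LINT \<zeta>|lebesgue. u (c t + t *\<^sub>R \<zeta>) * cube_bump \<zeta>) - u w * bump_mass TYPE('n)\<bar> \<le> \<omega> * bump_mass TYPE('n)"
    proof (rule cube_bump_average_close)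
      show "integrable lebesgue (\<lambda>\<zeta>. u (c t + t *\<^sub>R \<zeta>) * cube_bump \<zeta>)"
      proof (intro integrable_mult_cube_bump continuous_on_compose2[OF \<Omega>(2)] continuous_intros image_subsetI)
        fix \<zeta> :: "real^'n" assume "\<zeta> \<in> cbox (-1) 1"
        then show "c t + t *\<^sub>R \<zeta> \<in> \<Omega>"
          using d(2) close box by (auto simp: dist_commute)
      qed
      fix \<zeta> :: "real^'n" assume "cube_bump \<zeta> \<noteq> 0"
      then show "\<bar>u (c t + t *\<^sub>R \<zeta>) - u w\<bar> \<le> \<omega>"
        using d(3)[OF close] norm_le_if_bb_nonzero by (fastforce simp: dist_real_def less_imp_le)
    qed
    also have "\<dots> < e" using k \<open>e > 0\<close> by (simp add: \<omega>_def)
    finally show ?case by (simp add: dist_real_def)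
  qed
qed

text \<open>One row of \<open>weak_jacobian\<close>. The function \<open>u\<close> will come with
  continuity, from which its integrability on boxes is derived.\<close>

definition weak_gradient :: "(real^'n::finite) set \<Rightarrow> (real^'n \<Rightarrow> real) \<Rightarrow> (real^'n \<Rightarrow> real^'n) \<Rightarrow> bool" where
  "weak_gradient \<Omega> u \<Gamma> \<longleftrightarrow>
     (\<forall>K j. compact K \<and> K \<subseteq> \<Omega> \<longrightarrow> set_integrable lebesgue K (\<lambda>z. \<Gamma> z $ j)) \<and>
     (\<forall>\<phi>\<in>test_functions \<Omega>. \<forall>j.
        (LINT z:\<Omega>|lebesgue. u z * pdiff j \<phi> z) = - (LINT z:\<Omega>|lebesgue. \<Gamma> z $ j * \<phi> z))"

lemma cbox_around_subset:
  fixes p :: "real^'n::finite"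
  assumes "h \<ge> 0"
  shows "cbox (p - (\<chi> j. h)) (p + (\<chi> j. h)) \<subseteq> cball p (real CARD('n) * h)"
proof
  fix z assume z: "z \<in> cbox (p - (\<chi> j. h)) (p + (\<chi> j. h))"
  have "\<bar>(z - p)$j\<bar> \<le> h" for j
  proof -
    have "p$j - h \<le> z$j \<and> z$j \<le> p$j + h" using z by (simp add: mem_box_cart)
    then show ?thesis by (simp add: abs_le_iff)
  qed
  then have "(\<Sum>j\<in>UNIV. \<bar>(z - p)$j\<bar>) \<le> (\<Sum>j\<in>(UNIV::'n set). h)" by (intro sum_mono)
  then show "z \<in> cball p (real CARD('n) * h)"
    using norm_le_l1_cart[of "z - p"] by (simp add: dist_norm norm_minus_commute)
qed

text \<open>A bound on \<Gamma> almost everywhere says nothing about a single segment. The averages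
  of \<open>u\<close> with fixed radius s, however, are differentiable along the segment, with an
  average of \<Gamma> \<bullet> a as derivative; the mean value theorem applies to them, and then s
  tends to 0. The dimension appears in the last hypothesis because the flow lives in a cube, and a
  cube of half side h needs a ball of radius n h.\<close>

lemma directional_Lipschitz:
  fixes u :: "real^'n::finite \<Rightarrow> real" and \<Gamma> :: "real^'n \<Rightarrow> real^'n" and p a :: "real^'n"
  assumes \<Omega>: "open \<Omega>" "continuous_on \<Omega> u" and W: "weak_gradient \<Omega> u \<Gamma>"
    and V: "ball p \<rho> \<subseteq> \<Omega>" and M: "AE z in lebesgue. z \<in> ball p \<rho> \<longrightarrow> \<bar>\<Gamma> z \<bullet> a\<bar> \<le> M"
    and a: "real CARD('n) * norm a < \<rho>"
  shows "\<bar>u (p + a) - u p\<bar> \<le> M"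
proof -
  let ?n = "real CARD('n)" and ?k = "bump_mass TYPE('n)"
  have n: "?n \<ge> 1" by (simp add: Suc_leI)
  \<comment> \<open>\<tau> spends half of the slack \<rho> - n |a|. It serves as the overshoot of
    the time interval, which must be open and contain 0 and 1, and as the bound on the radius s;
    \<open>h\<close> below is then the half side of a cube containing all the moving cubes.\<close>
  define \<tau> where "\<tau> = (\<rho> - ?n * norm a) / (2 * ?n * (norm a + 1))"
  have \<tau>: "\<tau> > 0" using a n by (simp add: \<tau>_def add_nonneg_pos)
  have "?n * (\<tau> * (norm a + 1)) = (\<rho> - ?n * norm a) / 2"
    using n by (simp add: \<tau>_def field_simps add_nonneg_eq_0_iff)
  then have \<tau>2: "?n * ((1 + \<tau>) * norm a + \<tau>) < \<rho>"
    using a by (simp add: algebra_simps)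
  define h where "h = (1 + \<tau>) * norm a + \<tau>"
  have h: "h \<ge> 0" using \<tau> by (simp add: h_def)
  have Q: "cbox (p - (\<chi> j. h)) (p + (\<chi> j. h)) \<subseteq> ball p \<rho>"
    using cbox_around_subset[OF h, of p] \<tau>2 by (force simp: h_def)
  define F where "F s t = (LINT \<zeta>|lebesgue. u (p + t *\<^sub>R a + s *\<^sub>R \<zeta>) * cube_bump \<zeta>)" for s t
  have bound: "\<bar>F s 1 - F s 0\<bar> \<le> M * ?k" if s: "0 < s" "s < \<tau>" for s
  proof -
    define F' where "F' t = (LINT \<zeta>|lebesgue. (\<Gamma> (p + t *\<^sub>R a + s *\<^sub>R \<zeta>) \<bullet> a) * cube_bump \<zeta>)" for t
    have small: "\<bar>t * a$j\<bar> \<le> (1 + \<tau>) * norm a" if "t \<in> {- \<tau><..<1 + \<tau>}" for t j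
      using that component_le_norm_cart[of a j] \<tau> unfolding abs_mult by (intro mult_mono) auto
    have "(F s has_real_derivative F' t) (at t)" if t: "t \<in> {- \<tau><..<1 + \<tau>}" for t
    proof -
      have "((\<lambda>t. LINT \<zeta>|lebesgue. u (p + t *\<^sub>R a + (s + t*0) *\<^sub>R \<zeta>) * cube_bump \<zeta>) has_real_derivative
        (LINT \<zeta>|lebesgue. (\<Gamma> (p + t *\<^sub>R a + (s + t*0) *\<^sub>R \<zeta>) \<bullet> (a + 0 *\<^sub>R \<zeta>)) * cube_bump \<zeta>)) (at t)"
      proof (rule cube_bump_flow[where U="{- \<tau><..<1 + \<tau>}" and l="p - (\<chi> j. h)" and r="p + (\<chi> j. h)"])
        show "cbox (p - (\<chi> j. h)) (p + (\<chi> j. h)) \<subseteq> \<Omega>" using Q V by blast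
        then show "continuous_on (cbox (p - (\<chi> j. h)) (p + (\<chi> j. h))) u" using \<Omega> continuous_on_subset by blast
        show "set_integrable lebesgue (cbox (p - (\<chi> j. h)) (p + (\<chi> j. h))) (\<lambda>z. \<Gamma> z $ j)" for j
          using W Q V unfolding weak_gradient_def by (meson compact_cbox order_trans)
        show "(LINT z:\<Omega>|lebesgue. u z * pdiff j \<phi> z) = - (LINT z:\<Omega>|lebesgue. \<Gamma> z $ j * \<phi> z)"
          if "\<phi> \<in> test_functions \<Omega>" for \<phi> j
          using W that unfolding weak_gradient_def by blast
        fix t j assume "t \<in> {- \<tau><..<1 + \<tau>}"
        from small[OF this, of j]
        show "(p - (\<chi> j. h)) $ j \<le> p $ j + t * a $ j - (s + t * 0) \<and> p $ j + t * a $ j + (s + t * 0) \<le> (p + (\<chi> j. h)) $ j"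
          using s by (auto simp: h_def abs_le_iff)
      qed (use s t in auto)
      then show ?thesis by (simp add: F_def[abs_def] F'_def)
    qed
    then obtain \<xi> where \<xi>: "0 < \<xi>" "\<xi> < 1" "F s 1 - F s 0 = (1 - 0) * F' \<xi>"
      using MVT2[of 0 1 "F s" F'] \<tau> by auto
    have "\<bar>F' \<xi>\<bar> \<le> (LINT \<zeta>|lebesgue. M * cube_bump (\<zeta> :: real^'n))"
      unfolding F'_def
    proof (rule abs_integral_le)
      show "AE \<zeta> in lebesgue. \<bar>(\<Gamma> (p + \<xi> *\<^sub>R a + s *\<^sub>R \<zeta>) \<bullet> a) * cube_bump \<zeta>\<bar> \<le> M * cube_bump \<zeta>"
        using AE_lebesgue_affine[OF M, of s "p + \<xi> *\<^sub>R a"]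
      proof (rule AE_mp, use s in simp, intro AE_I2 impI)
        fix \<zeta> :: "real^'n"
        assume *: "p + \<xi> *\<^sub>R a + s *\<^sub>R \<zeta> \<in> ball p \<rho> \<longrightarrow> \<bar>\<Gamma> (p + \<xi> *\<^sub>R a + s *\<^sub>R \<zeta>) \<bullet> a\<bar> \<le> M"
        show "\<bar>(\<Gamma> (p + \<xi> *\<^sub>R a + s *\<^sub>R \<zeta>) \<bullet> a) * cube_bump \<zeta>\<bar> \<le> M * cube_bump \<zeta>"
        proof (cases "cube_bump \<zeta> = 0")
          case False
          have "norm (\<xi> *\<^sub>R a + s *\<^sub>R \<zeta>) \<le> norm (\<xi> *\<^sub>R a) + norm (s *\<^sub>R \<zeta>)" by (rule norm_triangle_ineq)
          also have "\<dots> \<le> norm a + \<tau> * ?n"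
            using \<xi> s norm_le_if_bb_nonzero[OF False]
            by (intro add_mono) (auto intro!: mult_mono mult_left_le_one_le)
          also have "\<dots> \<le> ?n * ((1 + \<tau>) * norm a + \<tau>)"
          proof -
            have "norm a \<le> ?n * norm a" "0 \<le> ?n * (\<tau> * norm a)"
              using n \<tau> mult_right_mono[OF n, of "norm a"] by auto
            then show ?thesis by (simp add: algebra_simps)
          qed
          also have "\<dots> < \<rho>" by (rule \<tau>2)
          also have "norm (\<xi> *\<^sub>R a + s *\<^sub>R \<zeta>) = dist p (p + (\<xi> *\<^sub>R a + s *\<^sub>R \<zeta>))"
            by (metis add_diff_cancel_left' dist_commute dist_norm)
          finally have "dist p (p + (\<xi> *\<^sub>R a + s *\<^sub>R \<zeta>)) < \<rho>" .
          then have "p + \<xi> *\<^sub>R a + s *\<^sub>R \<zeta> \<in> ball p \<rho>"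
            by (simp only: mem_ball add.assoc)
          with * show ?thesis using cube_bump_nonneg[of \<zeta>] by (simp add: abs_mult mult_right_mono)
        qed simp
      qed
    qed (simp add: integrable_cube_bump)
    then show ?thesis using \<xi> by (simp add: bump_mass_def)
  qed
  have in\<Omega>: "p \<in> \<Omega>" "p + a \<in> \<Omega>"
  proof -
    have "norm a \<le> ?n * norm a" using mult_right_mono[OF n, of "norm a"] by simp
    then have "norm a < \<rho>" using a by linarith
    then show "p + a \<in> \<Omega>" using V by (auto simp: dist_norm)
    have "\<rho> > 0" using \<open>norm a < \<rho>\<close> norm_ge_zero[of a] by linarith
    then show "p \<in> \<Omega>" using V by auto
  qed
  have "((\<lambda>s. \<bar>F s 1 - F s 0\<bar>) \<longlongrightarrow> \<bar>u (p + a) * ?k - u p * ?k\<bar>) (at_right 0)"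
  proof (intro tendsto_intros)
    show "((\<lambda>s. F s 1) \<longlongrightarrow> u (p + a) * ?k) (at_right 0)" "((\<lambda>s. F s 0) \<longlongrightarrow> u p * ?k) (at_right 0)"
      using cube_bump_average_tendsto[OF \<Omega> in\<Omega>(2), of "\<lambda>_. p + a"] cube_bump_average_tendsto[OF \<Omega> in\<Omega>(1), of "\<lambda>_. p"]
      by (simp_all add: F_def)
  qed
  moreover have "\<forall>\<^sub>F s in at_right 0. \<bar>F s 1 - F s 0\<bar> \<le> M * ?k"
    using eventually_at_right_real[OF \<tau>] by eventually_elim (use bound in auto)
  ultimately have "\<bar>u (p + a) * ?k - u p * ?k\<bar> \<le> M * ?k"
    by (rule tendsto_upperbound) simp
  then have "\<bar>u (p + a) - u p\<bar> * ?k \<le> M * ?k"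
    using bump_mass_pos[where 'n='n] by (simp add: abs_mult flip: left_diff_distrib)
  then show ?thesis using bump_mass_pos[where 'n='n] by simp
qed

text \<open>Stands in for Hoelder's inequality: if \<mu>^q bounds the integral of a^q, then after
  integration both terms on the right are of order \<mu>.\<close>

lemma Young_bound:
  fixes a \<mu> q :: real
  assumes "a \<ge> 0" "\<mu> > 0" "q \<ge> 1"
  shows "a \<le> \<mu> + \<mu> powr (1 - q) * a powr q"
proof (cases "a \<le> \<mu>")
  case True
  then show ?thesis by (simp add: add_increasing2)
next
  case False
  have "a = a powr (1 - q) * a powr q"
    using False assms by (simp flip: powr_add)
  also have "\<dots> \<le> \<mu> powr (1 - q) * a powr q"
    using False assms by (intro mult_right_mono powr_mono2') auto
  finally show ?thesis using assms by linarith
qed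

text \<open>The bound on \<open>H'\<close> is integrable at 0 since \<theta> < 1. As
  \<open>H'\<close> itself need not be integrable, it is not integrated: with \<open>G\<close> a
  primitive of the bound, G - H and G + H are nondecreasing.\<close>

lemma singular_derivative_bound:
  fixes H H' :: "real \<Rightarrow> real"
  assumes \<theta>: "0 \<le> \<theta>" "\<theta> < 1" and r: "0 < r" and K: "0 \<le> K"
    and d: "\<And>t. 0 < t \<Longrightarrow> t \<le> r \<Longrightarrow> (H has_real_derivative H' t) (at t)"
    and b: "\<And>t. 0 < t \<Longrightarrow> t \<le> r \<Longrightarrow> \<bar>H' t\<bar> \<le> K * t powr (- \<theta>)"
    and lim: "(H \<longlongrightarrow> A) (at_right 0)"
  shows "\<bar>H r - A\<bar> \<le> K / (1 - \<theta>) * r powr (1 - \<theta>)"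
proof -
  define G where "G t = K / (1 - \<theta>) * t powr (1 - \<theta>)" for t
  have G: "(G has_real_derivative K * t powr (- \<theta>)) (at t)" if "t > 0" for t
    unfolding G_def[abs_def] using that \<theta> by (auto intro!: derivative_eq_intros)
  have le: "\<bar>H r - H t\<bar> \<le> G r" if t: "0 < t" "t < r" for t
  proof -
    have "G t - H t \<le> G r - H r"
    proof (intro DERIV_nonneg_imp_nondecreasing[of t r "\<lambda>t. G t - H t"] exI conjI)
      fix x assume x: "t \<le> x" "x \<le> r"
      then show "0 \<le> K * x powr (- \<theta>) - H' x" using b[of x] t by (simp add: abs_le_iff)
      show "((\<lambda>t. G t - H t) has_real_derivative K * x powr (- \<theta>) - H' x) (at x)"
        using x t by (intro DERIV_diff[OF G d]) auto
    qed (use t in auto)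
    moreover have "G t + H t \<le> G r + H r"
    proof (intro DERIV_nonneg_imp_nondecreasing[of t r "\<lambda>t. G t + H t"] exI conjI)
      fix x assume x: "t \<le> x" "x \<le> r"
      then show "0 \<le> K * x powr (- \<theta>) + H' x" using b[of x] t by (simp add: abs_le_iff)
      show "((\<lambda>t. G t + H t) has_real_derivative K * x powr (- \<theta>) + H' x) (at x)"
        using x t by (intro DERIV_add[OF G d]) auto
    qed (use t in auto)
    moreover have "G t \<ge> 0" using K \<theta> by (simp add: G_def)
    ultimately show ?thesis by (simp add: abs_le_iff)
  qed
  have "((\<lambda>t. \<bar>H r - H t\<bar>) \<longlongrightarrow> \<bar>H r - A\<bar>) (at_right 0)"
    by (intro tendsto_intros lim)
  moreover have "\<forall>\<^sub>F t in at_right 0. \<bar>H r - H t\<bar> \<le> G r"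
    using eventually_at_right_real[OF r] by eventually_elim (use le in auto)
  ultimately show ?thesis unfolding G_def by (rule tendsto_upperbound) simp
qed

text \<open>The bump has radius t and centre w + t e. It starts concentrated at w and at time r is
  the bump of radius r around z0, whatever w was, so two starting points can be compared through
  this common average. Rescaling to the unit bump turns the mass bound into \<alpha>^q (r/t)^n, so
  the derivative of the average of u - L is of order \<alpha> (r/t)^(n/q), which integrates over
  (0,r] to a multiple of \<alpha> r.\<close>

lemma Morrey_path:
  fixes u :: "real^'n::finite \<Rightarrow> real" and \<Gamma> :: "real^'n \<Rightarrow> real^'n" and w z0 e L :: "real^'n"
  assumes \<Omega>: "open \<Omega>" "continuous_on \<Omega> u" and W: "weak_gradient \<Omega> u \<Gamma>"
    and q: "q > real CARD('n)" and r: "r > 0" and e: "norm e \<le> 1" "w + r *\<^sub>R e = z0"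
    and V: "cball z0 (3 * real CARD('n) * r) \<subseteq> \<Omega>"
    and int: "set_integrable lebesgue (cball z0 (3 * real CARD('n) * r)) (\<lambda>z. norm (\<Gamma> z - L) powr q)"
    and \<alpha>: "\<alpha> > 0"
      "(LINT z:cball z0 (3 * real CARD('n) * r)|lebesgue. norm (\<Gamma> z - L) powr q) \<le> \<alpha> powr q * r ^ CARD('n)"
  shows "\<bar>(LINT \<zeta>|lebesgue. u (z0 + r *\<^sub>R \<zeta>) * cube_bump \<zeta>) - (LINT \<zeta>|lebesgue. (L \<bullet> (z0 + r *\<^sub>R \<zeta>)) * cube_bump \<zeta>)
      - (u w - L \<bullet> w) * bump_mass TYPE('n)\<bar>
    \<le> (1 + real CARD('n)) * (bump_mass TYPE('n) + 1) / (1 - real CARD('n) / q) * \<alpha> * r"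
proof -
  let ?n = "real CARD('n)" and ?k = "bump_mass TYPE('n)"
  have n: "?n \<ge> 1" by (simp add: Suc_leI)
  have k: "?k > 0" by (rule bump_mass_pos)
  define \<theta> where "\<theta> = ?n / q"
  have \<theta>: "0 \<le> \<theta>" "\<theta> < 1" using n q by (auto simp: \<theta>_def)
  have q1: "q > 1" using n q by linarith
  \<comment> \<open>The flow needs an open time interval containing r, here (0, 2r). During it the
    centre stays within r of z0 in each coordinate and the radius below 2r; hence the half side
    3r.\<close>
  let ?l = "z0 - (\<chi> j. 3 * r)" and ?r = "z0 + (\<chi> j. 3 * r)"
  let ?C = "cball z0 (3 * ?n * r)"
  have Q: "cbox ?l ?r \<subseteq> ?C"
    using cbox_around_subset[of "3 * r" z0] r by (simp add: mult_ac)
  define c where "c t = w + t *\<^sub>R e" for t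
  have cz: "c t - z0 = (t - r) *\<^sub>R e" for t
    using e(2) by (auto simp: c_def algebra_simps)
  have cj: "\<bar>c t $ j - z0 $ j\<bar> \<le> r" if "0 < t" "t < 2 * r" for t j
  proof -
    have "c t $ j - z0 $ j = (t - r) * e $ j"
      using arg_cong[OF cz[of t], of "\<lambda>v. v $ j"] by simp
    then have "\<bar>c t $ j - z0 $ j\<bar> = \<bar>t - r\<bar> * \<bar>e $ j\<bar>"
      by (simp add: abs_mult)
    also have "\<dots> \<le> r * 1"
      using that component_le_norm_cart[of e j] e(1) by (intro mult_mono) auto
    finally show ?thesis by simp
  qed
  define F where "F t = (LINT \<zeta>|lebesgue. u (c t + t *\<^sub>R \<zeta>) * cube_bump \<zeta>)" for t
  define F' where "F' t = (LINT \<zeta>|lebesgue. (\<Gamma> (c t + t *\<^sub>R \<zeta>) \<bullet> (e + \<zeta>)) * cube_bump \<zeta>)" for t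
  define m where "m = (LINT \<zeta>|lebesgue. (L \<bullet> \<zeta>) * cube_bump (\<zeta> :: real^'n))"
  \<comment> \<open>The average of u minus that of the linear function L; the bracket is the latter
    in closed form, with \<open>m\<close> its first moment.\<close>
  define H where "H t = F t - ((L \<bullet> c t) * ?k + t * m)" for t
  define H' where "H' t = F' t - ((L \<bullet> e) * ?k + m)" for t
  have il: "integrable lebesgue (\<lambda>\<zeta>. (L \<bullet> \<zeta>) * cube_bump (\<zeta> :: real^'n))"
    by (intro integrable_mult_cube_bump continuous_intros)
  have lin: "(LINT \<zeta>|lebesgue. (L \<bullet> (a + s *\<^sub>R \<zeta>)) * cube_bump \<zeta>) = (L \<bullet> a) * ?k + s * m" for a :: "real^'n" and s
  proof -
    have "(\<lambda>\<zeta>::real^'n. (L \<bullet> (a + s *\<^sub>R \<zeta>)) * cube_bump \<zeta>) = (\<lambda>\<zeta>. (L \<bullet> a) * cube_bump \<zeta> + s * ((L \<bullet> \<zeta>) * cube_bump \<zeta>))"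
      by (simp add: fun_eq_iff inner_add_right distrib_right)
    then show ?thesis using il by (simp add: integrable_cube_bump bump_mass_def m_def)
  qed
  have dF: "(F has_real_derivative F' t) (at t)" if t: "0 < t" "t \<le> r" for t
  proof -
    have "((\<lambda>t. LINT \<zeta>|lebesgue. u (w + t *\<^sub>R e + (0 + t*1) *\<^sub>R \<zeta>) * cube_bump \<zeta>) has_real_derivative
      (LINT \<zeta>|lebesgue. (\<Gamma> (w + t *\<^sub>R e + (0 + t*1) *\<^sub>R \<zeta>) \<bullet> (e + 1 *\<^sub>R \<zeta>)) * cube_bump \<zeta>)) (at t)"
    proof (rule cube_bump_flow[where U="{0<..<2 * r}" and l="?l" and r="?r"])
      show "cbox ?l ?r \<subseteq> \<Omega>" using Q V by blast
      then show "continuous_on (cbox ?l ?r) u" using \<Omega> continuous_on_subset by blast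
      show "set_integrable lebesgue (cbox ?l ?r) (\<lambda>z. \<Gamma> z $ j)" for j
        using W Q V unfolding weak_gradient_def by (meson compact_cbox order_trans)
      show "(LINT z:\<Omega>|lebesgue. u z * pdiff j \<phi> z) = - (LINT z:\<Omega>|lebesgue. \<Gamma> z $ j * \<phi> z)"
        if "\<phi> \<in> test_functions \<Omega>" for \<phi> j
        using W that unfolding weak_gradient_def by blast
      fix t j assume t: "t \<in> {0<..<2 * r}"
      then show "?l $ j \<le> w $ j + t * e $ j - (0 + t * 1) \<and> w $ j + t * e $ j + (0 + t * 1) \<le> ?r $ j"
        using cj[of t j] by (auto simp: c_def abs_le_iff)
    qed (use t r in auto)
    then show ?thesis by (simp add: F_def[abs_def] F'_def c_def)
  qed
  have dH: "(H has_real_derivative H' t) (at t)" if t: "0 < t" "t \<le> r" for t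
  proof -
    have "((\<lambda>t. L \<bullet> c t) has_real_derivative L \<bullet> e) (at t)"
      unfolding c_def inner_add_right inner_scaleR_right by (auto intro!: derivative_eq_intros)
    then show ?thesis
      unfolding H_def[abs_def] H'_def using dF[OF t] by (auto intro!: derivative_eq_intros)
  qed
  have C\<Omega>: "set_integrable lebesgue ?C (\<lambda>z. \<Gamma> z $ j)" for j
    using W V unfolding weak_gradient_def by (meson compact_cball)
  have inC: "c t + t *\<^sub>R \<zeta> \<in> ?C" if t: "0 < t" "t \<le> r" and "norm \<zeta> \<le> ?n" for t \<zeta>
  proof -
    have "norm (c t - z0 + t *\<^sub>R \<zeta>) \<le> norm (c t - z0) + norm (t *\<^sub>R \<zeta>)" by (rule norm_triangle_ineq)
    also have "\<dots> \<le> r * 1 + r * ?n"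
      unfolding cz norm_scaleR using t e that by (intro add_mono mult_mono) auto
    also have "\<dots> \<le> 3 * ?n * r"
      using mult_right_mono[OF n, of r] r by (simp only: algebra_simps) linarith
    finally show ?thesis by (simp add: dist_norm norm_minus_commute algebra_simps)
  qed
  have bH: "\<bar>H' t\<bar> \<le> (1 + ?n) * (?k + 1) * \<alpha> * r powr \<theta> * t powr (- \<theta>)" if t: "0 < t" "t \<le> r" for t
  proof -
    \<comment> \<open>The q-th root of \<alpha>^q (r/t)^n, which bounds the rescaled integral of
      |\<Gamma> - L|^q. With this value the two terms of \<open>Young_bound\<close> balance.\<close>
    define \<mu> where "\<mu> = \<alpha> * (r / t) powr \<theta>"
    have \<mu>: "\<mu> > 0" using \<alpha> t r by (simp add: \<mu>_def)
    let ?h = "\<lambda>z. indicator ?C z * norm (\<Gamma> z - L) powr q"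
    have ih: "integrable lebesgue ?h" using int by (simp add: set_integrable_def)
    have ih2: "integrable lebesgue (\<lambda>\<zeta>. ?h (c t + t *\<^sub>R \<zeta>))"
      using ih t by (intro lebesgue_integral_affine(2)) auto
    have "(LINT \<zeta>|lebesgue. ?h (c t + t *\<^sub>R \<zeta>)) = (LINT z|lebesgue. ?h z) / t ^ CARD('n)"
      using lebesgue_integral_affine(1)[of ?h t "c t"] ih t by (simp add: field_simps)
    also have "\<dots> \<le> (\<alpha> powr q * r ^ CARD('n)) / t ^ CARD('n)"
      using \<alpha>(2) t by (intro divide_right_mono) (auto simp: set_lebesgue_integral_def)
    also have "\<dots> = \<mu> powr q"
    proof -
      have "((r / t) powr \<theta>) powr q = (r / t) ^ CARD('n)"
      proof -
        have "\<theta> * q = ?n" using q1 by (simp add: \<theta>_def)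
        then show ?thesis using r t powr_realpow[of "r / t" "CARD('n)"] by (simp only: powr_powr) simp
      qed
      then show ?thesis using \<alpha> r t by (simp add: \<mu>_def powr_mult power_divide)
    qed
    finally have hb: "(LINT \<zeta>|lebesgue. ?h (c t + t *\<^sub>R \<zeta>)) \<le> \<mu> powr q" .
    have eqH: "H' t = (LINT \<zeta>|lebesgue. ((\<Gamma> (c t + t *\<^sub>R \<zeta>) - L) \<bullet> (e + \<zeta>)) * cube_bump \<zeta>)"
    proof -
      have "integrable lebesgue (\<lambda>\<zeta>. (\<Gamma> (c t + t *\<^sub>R \<zeta>) \<bullet> (e + \<zeta>)) * cube_bump \<zeta>)"
      proof -
        have "set_integrable lebesgue ?C (\<lambda>z. ((e + (1/t) *\<^sub>R (z - c t)) $ j * cube_bump ((1/t) *\<^sub>R (z - c t))) * \<Gamma> z $ j)" for j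
          using t by (intro set_integrable_continuous_mult C\<Omega> continuous_intros continuous_on_compose2[OF continuous_cube_bump]) auto
        then have iS: "integrable lebesgue (\<lambda>z. indicator ?C z * (\<Sum>j\<in>UNIV. ((e + (1/t) *\<^sub>R (z - c t)) $ j * cube_bump ((1/t) *\<^sub>R (z - c t))) * \<Gamma> z $ j))"
          unfolding sum_distrib_left by (intro Bochner_Integration.integrable_sum) (simp add: set_integrable_def)
        have "integrable lebesgue (\<lambda>\<zeta>. indicator ?C (c t + t *\<^sub>R \<zeta>) * (\<Sum>j\<in>UNIV. ((e + \<zeta>) $ j * cube_bump \<zeta>) * \<Gamma> (c t + t *\<^sub>R \<zeta>) $ j))"
          using lebesgue_integral_affine(2)[OF borel_measurable_integrable[OF iS] t(1) iS, of "c t"] t(1) by simp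
        moreover have "indicator ?C (c t + t *\<^sub>R \<zeta>) * (\<Sum>j\<in>UNIV. ((e + \<zeta>) $ j * cube_bump \<zeta>) * \<Gamma> (c t + t *\<^sub>R \<zeta>) $ j)
           = (\<Gamma> (c t + t *\<^sub>R \<zeta>) \<bullet> (e + \<zeta>)) * cube_bump \<zeta>" for \<zeta>
        proof (cases "cube_bump \<zeta> = 0")
          case False
          then show ?thesis using inC[OF t norm_le_if_bb_nonzero[OF False]]
            by (simp add: inner_vec_def sum_distrib_left sum_distrib_right mult_ac)
        qed simp
        ultimately show ?thesis by simp
      qed
      moreover have "integrable lebesgue (\<lambda>\<zeta>. (L \<bullet> (e + 1 *\<^sub>R \<zeta>)) * cube_bump \<zeta>)"
        by (intro integrable_mult_cube_bump continuous_intros)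
      ultimately have "(LINT \<zeta>|lebesgue. (\<Gamma> (c t + t *\<^sub>R \<zeta>) \<bullet> (e + \<zeta>)) * cube_bump \<zeta> - (L \<bullet> (e + 1 *\<^sub>R \<zeta>)) * cube_bump \<zeta>)
         = F' t - ((L \<bullet> e) * ?k + 1 * m)"
        unfolding lin[of e 1, symmetric] F'_def by (rule Bochner_Integration.integral_diff)
      then show ?thesis by (simp add: H'_def inner_diff_left left_diff_distrib)
    qed
    \<comment> \<open>The factor \<open>1 + ?n\<close> bounds |e + \<zeta>| on the support of the
      bump. The bump is kept in the first Young term and bounded by 1 in the second, whence
      \<open>?k + 1\<close> in the final constant.\<close>
    have le1: "\<bar>H' t\<bar> \<le> (LINT \<zeta>|lebesgue. (1 + ?n) * (\<mu> * cube_bump \<zeta> + \<mu> powr (1 - q) * ?h (c t + t *\<^sub>R \<zeta>)))"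
      unfolding eqH
    proof (rule abs_integral_le)
      show "integrable lebesgue (\<lambda>\<zeta>. (1 + ?n) * (\<mu> * cube_bump \<zeta> + \<mu> powr (1 - q) * ?h (c t + t *\<^sub>R \<zeta>)))"
        using ih2 by (simp add: integrable_cube_bump)
      show "AE \<zeta> in lebesgue. \<bar>((\<Gamma> (c t + t *\<^sub>R \<zeta>) - L) \<bullet> (e + \<zeta>)) * cube_bump \<zeta>\<bar>
        \<le> (1 + ?n) * (\<mu> * cube_bump \<zeta> + \<mu> powr (1 - q) * ?h (c t + t *\<^sub>R \<zeta>))"
      proof (rule AE_I2)
        fix \<zeta> :: "real^'n"
        show "\<bar>((\<Gamma> (c t + t *\<^sub>R \<zeta>) - L) \<bullet> (e + \<zeta>)) * cube_bump \<zeta>\<bar>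
          \<le> (1 + ?n) * (\<mu> * cube_bump \<zeta> + \<mu> powr (1 - q) * ?h (c t + t *\<^sub>R \<zeta>))"
        proof (cases "cube_bump \<zeta> = 0")
          case True then show ?thesis using n by simp
        next
          case False
          let ?g = "norm (\<Gamma> (c t + t *\<^sub>R \<zeta>) - L)"
          have \<zeta>n: "norm \<zeta> \<le> ?n" by (rule norm_le_if_bb_nonzero[OF False])
          have "norm (e + \<zeta>) \<le> 1 + ?n" using norm_triangle_ineq[of e \<zeta>] \<zeta>n e(1) by linarith
          then have "\<bar>(\<Gamma> (c t + t *\<^sub>R \<zeta>) - L) \<bullet> (e + \<zeta>)\<bar> \<le> ?g * (1 + ?n)"
            by (intro order_trans[OF Cauchy_Schwarz_ineq2] mult_left_mono) auto
          then have "\<bar>((\<Gamma> (c t + t *\<^sub>R \<zeta>) - L) \<bullet> (e + \<zeta>)) * cube_bump \<zeta>\<bar> \<le> (1 + ?n) * (?g * cube_bump \<zeta>)"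
            using mult_right_mono[OF _ cube_bump_nonneg[of \<zeta>]] cube_bump_nonneg[of \<zeta>] by (fastforce simp: abs_mult mult_ac)
          also have "?g * cube_bump \<zeta> \<le> (\<mu> + \<mu> powr (1 - q) * ?g powr q) * cube_bump \<zeta>"
            using \<mu> q1 by (intro mult_right_mono Young_bound cube_bump_nonneg) auto
          also have "\<dots> \<le> \<mu> * cube_bump \<zeta> + \<mu> powr (1 - q) * ?g powr q"
            using cube_bump_le_1[of \<zeta>] by (simp add: distrib_right mult_left_le)
          also have "?g powr q = ?h (c t + t *\<^sub>R \<zeta>)"
            using inC[OF t \<zeta>n] by simp
          finally show ?thesis using n by simp
        qed
      qed
    qed
    have eq2: "(LINT \<zeta>|lebesgue. (1 + ?n) * (\<mu> * cube_bump \<zeta> + \<mu> powr (1 - q) * ?h (c t + t *\<^sub>R \<zeta>)))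
        = (1 + ?n) * (\<mu> * ?k + \<mu> powr (1 - q) * (LINT \<zeta>|lebesgue. ?h (c t + t *\<^sub>R \<zeta>)))"
    proof -
      have I: "(LINT \<zeta>|lebesgue. A * (B * cube_bump \<zeta> + C * g \<zeta>)) = A * (B * ?k + C * (LINT \<zeta>|lebesgue. g \<zeta>))"
        if "integrable lebesgue g" for A B C :: real and g :: "real^'n \<Rightarrow> real"
      proof -
        have "(LINT \<zeta>|lebesgue. B * cube_bump \<zeta> + C * g \<zeta>) = (LINT \<zeta>|lebesgue. B * cube_bump (\<zeta> :: real^'n)) + (LINT \<zeta>|lebesgue. C * g \<zeta>)"
          by (rule Bochner_Integration.integral_add) (simp_all add: integrable_cube_bump that)
        then show ?thesis by (simp add: bump_mass_def)
      qed
      show ?thesis by (rule I[OF ih2, of "1 + ?n" \<mu> "\<mu> powr (1 - q)"])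
    qed
    have "\<bar>H' t\<bar> \<le> (1 + ?n) * (\<mu> * ?k + \<mu> powr (1 - q) * \<mu> powr q)"
    proof (rule order_trans[OF le1], subst eq2)
      show "(1 + ?n) * (\<mu> * ?k + \<mu> powr (1 - q) * (LINT \<zeta>|lebesgue. ?h (c t + t *\<^sub>R \<zeta>)))
        \<le> (1 + ?n) * (\<mu> * ?k + \<mu> powr (1 - q) * \<mu> powr q)"
        using hb n by (intro mult_left_mono add_left_mono) auto
    qed
    also have "\<mu> powr (1 - q) * \<mu> powr q = \<mu>"
      using \<mu> by (simp flip: powr_add)
    also have "(1 + ?n) * (\<mu> * ?k + \<mu>) = (1 + ?n) * (?k + 1) * \<alpha> * r powr \<theta> * t powr (- \<theta>)"
    proof -
      have "\<mu> = \<alpha> * (r powr \<theta> * t powr (- \<theta>))"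
        using r t by (simp add: \<mu>_def powr_divide powr_minus_divide)
      moreover have "(1 + ?n) * (M * ?k + M) = (1 + ?n) * (?k + 1) * M" for M
        by (simp add: algebra_simps)
      then have "(1 + ?n) * (\<mu> * ?k + \<mu>) = (1 + ?n) * (?k + 1) * \<mu>" .
      ultimately show ?thesis by (metis mult.assoc)
    qed
    finally show ?thesis .
  qed
  have w\<Omega>: "w \<in> \<Omega>"
  proof -
    have "norm (r *\<^sub>R e) \<le> r * 1" using e(1) r unfolding norm_scaleR by (intro mult_mono) auto
    also have "\<dots> \<le> 3 * ?n * r" using mult_right_mono[OF n, of r] r by linarith
    finally have "w \<in> ?C" using e(2) by (auto simp: dist_norm)
    then show ?thesis using V by blast
  qed
  have clim: "(c \<longlongrightarrow> w) (at_right 0)"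
  proof -
    have "(c \<longlongrightarrow> w + 0 *\<^sub>R e) (at_right 0)" unfolding c_def by (intro tendsto_intros)
    then show ?thesis by simp
  qed
  have lim: "(H \<longlongrightarrow> u w * ?k - ((L \<bullet> w) * ?k + 0 * m)) (at_right 0)"
    unfolding H_def F_def
    by (intro tendsto_diff cube_bump_average_tendsto[OF \<Omega> w\<Omega> clim]) (intro tendsto_intros clim)
  have K: "0 \<le> (1 + ?n) * (?k + 1) * \<alpha> * r powr \<theta>" using n k \<alpha> by simp
  have "\<bar>H r - (u w * ?k - ((L \<bullet> w) * ?k + 0 * m))\<bar> \<le> ((1 + ?n) * (?k + 1) * \<alpha> * r powr \<theta>) / (1 - \<theta>) * r powr (1 - \<theta>)"
    by (rule singular_derivative_bound[OF \<theta> r K dH bH lim])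
  also have "\<dots> = (1 + ?n) * (?k + 1) / (1 - \<theta>) * \<alpha> * (r powr \<theta> * r powr (1 - \<theta>))" by simp
  also have "r powr \<theta> * r powr (1 - \<theta>) = r" using r by (simp flip: powr_add)
  also have "H r = (LINT \<zeta>|lebesgue. u (z0 + r *\<^sub>R \<zeta>) * cube_bump \<zeta>) - (LINT \<zeta>|lebesgue. (L \<bullet> (z0 + r *\<^sub>R \<zeta>)) * cube_bump \<zeta>)"
    unfolding lin using e(2) by (simp add: H_def F_def c_def)
  finally show ?thesis by (simp add: \<theta>_def left_diff_distrib)
qed

text \<open>At a Lebesgue point z in the q-th mean, take L = \<Gamma> z and r = |y - z|.
  \<open>Morrey_path\<close> is applied with the same final ball around z to the starting points y
  and z; the common average cancels and leaves the increment of u - L, which is o(r).\<close>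

lemma weak_gradient_has_derivative:
  fixes u :: "real^'n::finite \<Rightarrow> real" and \<Gamma> :: "real^'n \<Rightarrow> real^'n"
  assumes \<Omega>: "open \<Omega>" "continuous_on \<Omega> u" and W: "weak_gradient \<Omega> u \<Gamma>"
    and q: "q > real CARD('n)"
    and meas: "\<And>K. compact K \<Longrightarrow> K \<subseteq> \<Omega> \<Longrightarrow> \<Gamma> \<in> borel_measurable (lebesgue_on K)"
    and int: "\<And>K. compact K \<Longrightarrow> K \<subseteq> \<Omega> \<Longrightarrow> set_integrable lebesgue K (\<lambda>z. norm (\<Gamma> z) powr q)"
  shows "AE z in lebesgue. z \<in> \<Omega> \<longrightarrow> (u has_derivative (\<lambda>h. \<Gamma> z \<bullet> h)) (at z)"
proof -
  let ?n = "real CARD('n)" and ?k = "bump_mass TYPE('n)"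
  have n: "?n \<ge> 1" by (simp add: Suc_leI)
  have q0: "q > 0" using n q by linarith
  have k: "?k > 0" by (rule bump_mass_pos)
  have intL: "set_integrable lebesgue K (\<lambda>z. norm (\<Gamma> z - L) powr q)"
    if K: "compact K" "K \<subseteq> \<Omega>" for K L
    by (rule set_integrable_norm_diff_powr[OF K(1) q0 meas[OF K] int[OF K]])
  have "AE z in lebesgue. z \<in> \<Omega> \<longrightarrow>
      ((\<lambda>r. (LINT w:cball z r|lebesgue. norm (\<Gamma> w - \<Gamma> z) powr q) / r ^ DIM(real^'n)) \<longlongrightarrow> 0) (at_right 0)"
    by (rule AE_Lebesgue_point[OF \<Omega>(1) q0]) (use meas int in auto)
  then show ?thesis
  proof (rule AE_mp, intro AE_I2 impI)
    fix z assume z: "z \<in> \<Omega>" and "z \<in> \<Omega> \<longrightarrow>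
      ((\<lambda>r. (LINT w:cball z r|lebesgue. norm (\<Gamma> w - \<Gamma> z) powr q) / r ^ DIM(real^'n)) \<longlongrightarrow> 0) (at_right 0)"
    then have lim: "((\<lambda>r. (LINT w:cball z r|lebesgue. norm (\<Gamma> w - \<Gamma> z) powr q) / r ^ CARD('n)) \<longlongrightarrow> 0) (at_right 0)"
      by simp
    obtain R where R: "R > 0" "cball z R \<subseteq> \<Omega>" using z \<Omega>(1) open_contains_cball by blast
    show "(u has_derivative (\<lambda>h. \<Gamma> z \<bullet> h)) (at z)"
      unfolding has_derivative_at_alt
    proof (intro conjI allI impI bounded_linear_inner_right)
      fix e :: real assume e: "e > 0"
      define B where "B = (1 + ?n) * (?k + 1) / (1 - ?n / q)"
      have B: "B > 0" using n k q q0 by (simp add: B_def)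
      \<comment> \<open>The estimate B \<alpha> r is used twice, and the sum is to be e r times the
        bump mass.\<close>
      define \<alpha> where "\<alpha> = e * ?k / (2 * B)"
      have \<alpha>: "\<alpha> > 0" using e k B by (simp add: \<alpha>_def)
      have "\<forall>\<^sub>F r in at_right 0. (LINT w:cball z r|lebesgue. norm (\<Gamma> w - \<Gamma> z) powr q) / r ^ CARD('n) < \<alpha> powr q / (3 * ?n) ^ CARD('n)"
        using \<alpha> n by (intro order_tendstoD(2)[OF lim]) auto
      then obtain d where d: "d > 0" "\<And>r. 0 < r \<Longrightarrow> r < d \<Longrightarrow> (LINT w:cball z r|lebesgue. norm (\<Gamma> w - \<Gamma> z) powr q) / r ^ CARD('n) < \<alpha> powr q / (3 * ?n) ^ CARD('n)"
        unfolding eventually_at_right_field by auto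
      \<comment> \<open>The ball in \<open>Morrey_path\<close> has radius 3 n r; it must lie in
        \<Omega> and be small enough for the Lebesgue point bound.\<close>
      define d' where "d' = min d R / (3 * ?n)"
      have d': "d' > 0" using d R n by (simp add: d'_def)
      have "norm (u y - u z - \<Gamma> z \<bullet> (y - z)) \<le> e * norm (y - z)" if y: "norm (y - z) < d'" for y
      proof (cases "y = z")
        case False
        define r where "r = norm (y - z)"
        have r: "r > 0" using False by (simp add: r_def)
        have Nr: "3 * ?n * r < min d R"
          using y n by (simp add: r_def d'_def pos_less_divide_eq mult_ac)
        have V: "cball z (3 * ?n * r) \<subseteq> \<Omega>" using R(2) Nr by (meson min_less_iff_conj less_imp_le order_trans subset_cball)
        let ?I = "LINT w:cball z (3 * ?n * r)|lebesgue. norm (\<Gamma> w - \<Gamma> z) powr q"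
        have "?I / (3 * ?n * r) ^ CARD('n) < \<alpha> powr q / (3 * ?n) ^ CARD('n)"
          using d(2)[of "3 * ?n * r"] Nr r n by simp
        then have "?I < \<alpha> powr q / (3 * ?n) ^ CARD('n) * (3 * ?n * r) ^ CARD('n)"
          using r n by (subst (asm) pos_divide_less_eq) auto
        also have "\<dots> = \<alpha> powr q * r ^ CARD('n)"
          using n by (simp add: power_mult_distrib)
        finally have I: "?I \<le> \<alpha> powr q * r ^ CARD('n)" by simp
        note M = Morrey_path[OF \<Omega> W q r _ _ V intL[OF compact_cball V] \<alpha> I, folded B_def]
        let ?X = "(LINT \<zeta>|lebesgue. u (z + r *\<^sub>R \<zeta>) * cube_bump \<zeta>) - (LINT \<zeta>|lebesgue. (\<Gamma> z \<bullet> (z + r *\<^sub>R \<zeta>)) * cube_bump \<zeta>)"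
        have 1: "\<bar>?X - (u y - \<Gamma> z \<bullet> y) * ?k\<bar> \<le> B * \<alpha> * r"
          using r by (intro M[of "(1/r) *\<^sub>R (z - y)"]) (auto simp: r_def norm_minus_commute)
        have 2: "\<bar>?X - (u z - \<Gamma> z \<bullet> z) * ?k\<bar> \<le> B * \<alpha> * r"
          by (intro M[of 0]) auto
        have "\<bar>(u y - u z - \<Gamma> z \<bullet> (y - z)) * ?k\<bar>
          = \<bar>(?X - (u z - \<Gamma> z \<bullet> z) * ?k) - (?X - (u y - \<Gamma> z \<bullet> y) * ?k)\<bar>"
          by (simp add: inner_diff_right algebra_simps)
        also have "\<dots> \<le> B * \<alpha> * r + B * \<alpha> * r" using 1 2 by linarith
        also have "\<dots> = e * r * ?k" using B by (simp add: \<alpha>_def)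
        finally show ?thesis using k by (simp add: abs_mult r_def)
      qed simp
      then show "\<exists>d>0. \<forall>y. norm (y - z) < d \<longrightarrow> norm (u y - u z - \<Gamma> z \<bullet> (y - z)) \<le> e * norm (y - z)"
        using d' by blast
    qed
  qed
qed

section \<open>Integration with respect to positive charges\<close>

text \<open>Boundedness, which \<open>ba\<close> requires, is automatic here: by monotonicity a
  positive real-valued charge is bounded by its value on \<Omega>.\<close>

locale positive_charge =
  fixes \<Omega> :: "'a::topological_space set" and \<mu> :: "'a set \<Rightarrow> real"
  assumes \<Omega>_borel: "\<Omega> \<in> sets borel"
    and additive: "\<And>A B. A \<in> borel_subsets \<Omega> \<Longrightarrow> B \<in> borel_subsets \<Omega> \<Longrightarrow> A \<inter> B = {} \<Longrightarrow> \<mu> (A \<union> B) = \<mu> A + \<mu> B"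
    and nonneg: "\<And>A. A \<in> borel_subsets \<Omega> \<Longrightarrow> 0 \<le> \<mu> A"
begin

lemma charge_empty: "\<mu> {} = 0"
  using additive[of "{}" "{}"] by (simp add: borel_subsets_def)

lemma mono:
  assumes "A \<in> borel_subsets \<Omega>" "B \<in> borel_subsets \<Omega>" "A \<subseteq> B"
  shows "\<mu> A \<le> \<mu> B"
proof -
  have "B - A \<in> borel_subsets \<Omega>" using assms by (auto simp: borel_subsets_def)
  moreover have "A \<union> (B - A) = B" using assms(3) by blast
  ultimately show ?thesis using additive[of A "B - A"] nonneg[of "B - A"] assms by auto
qed

lemma subadditive:
  assumes "A \<in> borel_subsets \<Omega>" "B \<in> borel_subsets \<Omega>"
  shows "\<mu> (A \<union> B) \<le> \<mu> A + \<mu> B"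
proof -
  have "B - A \<in> borel_subsets \<Omega>" using assms by (auto simp: borel_subsets_def)
  then show ?thesis using additive[of A "B - A"] mono[of "B - A" B] assms by auto
qed

lemma finite_additive:
  assumes "finite I" "\<And>i. i \<in> I \<Longrightarrow> A i \<in> borel_subsets \<Omega>" "disjoint_family_on A I"
  shows "\<mu> (\<Union>i\<in>I. A i) = (\<Sum>i\<in>I. \<mu> (A i))"
  using assms
proof (induction I)
  case (insert i I)
  have "(\<Union>i\<in>I. A i) \<in> borel_subsets \<Omega>"
    using insert.prems(1) insert.hyps(1) unfolding borel_subsets_def by (auto intro!: sets.finite_UN)
  moreover have "A i \<inter> (\<Union>i\<in>I. A i) = {} \<and> disjoint_family_on A I"
    using insert.prems(2) insert.hyps(2) by (simp add: disjoint_family_on_insert)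
  moreover have "A i \<in> borel_subsets \<Omega>" using insert.prems(1) by simp
  moreover have "disjoint_family_on A I \<Longrightarrow> \<mu> (\<Union>i\<in>I. A i) = (\<Sum>i\<in>I. \<mu> (A i))"
    using insert.IH insert.prems(1) by simp
  ultimately show ?case using insert.hyps additive[of "A i" "\<Union>i\<in>I. A i"] by simp
qed (simp add: charge_empty)

text \<open>\<open>step_integral\<close> sums over the distinct values of a function, so functions
  with different coincidences of values are summed over different partitions. Regrouping along the
  level sets of a finer map \<open>k\<close> puts them all over one partition, and linearity and
  monotonicity become termwise.\<close>

lemma step_integral_compose:
  fixes k :: "'a \<Rightarrow> 'b" and \<phi> :: "'b \<Rightarrow> real"
  assumes fin: "finite (k ` \<Omega>)" and k: "\<And>l. k -` {l} \<inter> \<Omega> \<in> borel_subsets \<Omega>"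
  shows "step_integral \<Omega> \<mu> (\<lambda>z. \<phi> (k z)) = (\<Sum>l\<in>k ` \<Omega>. \<phi> l * \<mu> (k -` {l} \<inter> \<Omega>))"
proof -
  have eq: "v * \<mu> ((\<lambda>z. \<phi> (k z)) -` {v} \<inter> \<Omega>) = (\<Sum>l\<in>{l \<in> k ` \<Omega>. \<phi> l = v}. \<phi> l * \<mu> (k -` {l} \<inter> \<Omega>))" for v
  proof -
    have "(\<lambda>z. \<phi> (k z)) -` {v} \<inter> \<Omega> = (\<Union>l\<in>{l \<in> k ` \<Omega>. \<phi> l = v}. k -` {l} \<inter> \<Omega>)" by auto
    also have "\<mu> \<dots> = (\<Sum>l\<in>{l \<in> k ` \<Omega>. \<phi> l = v}. \<mu> (k -` {l} \<inter> \<Omega>))"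
      using fin k by (intro finite_additive) (auto simp: disjoint_family_on_def)
    finally show ?thesis by (simp add: sum_distrib_left)
  qed
  have img: "(\<lambda>z. \<phi> (k z)) ` \<Omega> = \<phi> ` (k ` \<Omega>)" by auto
  show ?thesis
    unfolding step_integral_def eq img by (rule sum.image_gen[OF fin, symmetric])
qed

text \<open>The level sets of the pair are the common refinement of the two partitions.\<close>

lemma step_function_pair:
  assumes "step_function \<Omega> h1" "step_function \<Omega> h2"
  shows "finite ((\<lambda>z. (h1 z, h2 z)) ` \<Omega>)" "(\<lambda>z. (h1 z, h2 z)) -` {l} \<inter> \<Omega> \<in> borel_subsets \<Omega>"
proof -
  have f: "finite (h1 ` \<Omega>)" "finite (h2 ` \<Omega>)"
    using assms by (auto simp: step_function_def simple_function_def space_restrict_space)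
  show "finite ((\<lambda>z. (h1 z, h2 z)) ` \<Omega>)"
    by (rule finite_subset[OF _ finite_cartesian_product[OF f]]) auto
  have P: "h -` {v} \<inter> \<Omega> \<in> sets borel" if "step_function \<Omega> h" for h v
  proof (cases "v \<in> h ` \<Omega>")
    case True
    then show ?thesis
      using that \<Omega>_borel unfolding step_function_def simple_function_def
      by (auto simp: space_restrict_space sets_restrict_space_iff)
  next
    case False
    then have "h -` {v} \<inter> \<Omega> = {}" by auto
    then show ?thesis by (metis sets.empty_sets)
  qed
  have "(h1 -` {fst l} \<inter> \<Omega>) \<inter> (h2 -` {snd l} \<inter> \<Omega>) \<in> sets borel"
    using P[OF assms(1)] P[OF assms(2)] by (rule sets.Int)
  moreover have "(h1 -` {fst l} \<inter> \<Omega>) \<inter> (h2 -` {snd l} \<inter> \<Omega>) = (\<lambda>z. (h1 z, h2 z)) -` {l} \<inter> \<Omega>" by (cases l) auto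
  ultimately show "(\<lambda>z. (h1 z, h2 z)) -` {l} \<inter> \<Omega> \<in> borel_subsets \<Omega>"
    by (auto simp: borel_subsets_def)
qed

lemma step_integral_pair:
  assumes "step_function \<Omega> h1" "step_function \<Omega> h2"
  shows "step_integral \<Omega> \<mu> (\<lambda>z. \<phi> (h1 z) (h2 z)) =
    (\<Sum>l\<in>(\<lambda>z. (h1 z, h2 z)) ` \<Omega>. \<phi> (fst l) (snd l) * \<mu> ((\<lambda>z. (h1 z, h2 z)) -` {l} \<inter> \<Omega>))"
  using step_integral_compose[OF step_function_pair[OF assms], of "\<lambda>l. \<phi> (fst l) (snd l)"] by simp

lemma step_function_binary:
  assumes "step_function \<Omega> h1" "step_function \<Omega> h2"
  shows "step_function \<Omega> (\<lambda>z. \<phi> (h1 z) (h2 z))"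
  using assms unfolding step_function_def by (rule simple_function_compose2)

lemma step_function_const: "step_function \<Omega> (\<lambda>_. c)"
  by (simp add: step_function_def)

lemma step_functionI: "h \<in> borel_measurable borel \<Longrightarrow> finite (h ` \<Omega>) \<Longrightarrow> step_function \<Omega> h"
  unfolding step_function_def
  by (rule simple_function_borel_measurable) (auto simp: space_restrict_space measurable_restrict_space1)

lemma step_function_indicator:
  assumes "A \<in> sets borel" shows "step_function \<Omega> (indicator A)"
proof (rule step_functionI)
  show "indicator A \<in> borel_measurable borel" using assms by (rule borel_measurable_indicator)
  have "indicator A ` \<Omega> \<subseteq> {0, 1::real}" by (auto simp: indicator_def)
  then show "finite (indicator A ` \<Omega> :: real set)" by (rule finite_subset) simp
qed

lemma step_integral_add:
  assumes "step_function \<Omega> h1" "step_function \<Omega> h2"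
  shows "step_integral \<Omega> \<mu> (\<lambda>z. h1 z + h2 z) = step_integral \<Omega> \<mu> h1 + step_integral \<Omega> \<mu> h2"
  using step_integral_pair[OF assms, of "\<lambda>a b. a"] step_integral_pair[OF assms, of "\<lambda>a b. b"]
    step_integral_pair[OF assms, of "\<lambda>a b. a + b"]
  by (simp add: distrib_right sum.distrib)

lemma step_integral_mono:
  assumes "step_function \<Omega> h1" "step_function \<Omega> h2" "\<And>z. z \<in> \<Omega> \<Longrightarrow> h1 z \<le> h2 z"
  shows "step_integral \<Omega> \<mu> h1 \<le> step_integral \<Omega> \<mu> h2"
proof -
  let ?k = "\<lambda>z. (h1 z, h2 z)"
  have "(\<Sum>l\<in>?k ` \<Omega>. fst l * \<mu> (?k -` {l} \<inter> \<Omega>)) \<le> (\<Sum>l\<in>?k ` \<Omega>. snd l * \<mu> (?k -` {l} \<inter> \<Omega>))"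
  proof (intro sum_mono mult_right_mono)
    fix l assume "l \<in> ?k ` \<Omega>"
    then show "fst l \<le> snd l" using assms(3) by force
    show "0 \<le> \<mu> (?k -` {l} \<inter> \<Omega>)" by (rule nonneg[OF step_function_pair(2)[OF assms(1,2)]])
  qed
  then show ?thesis
    unfolding step_integral_pair[OF assms(1,2), of "\<lambda>a b. a", symmetric]
      step_integral_pair[OF assms(1,2), of "\<lambda>a b. b", symmetric] .
qed

text \<open>Pairing \<open>h\<close> with itself keeps the partition of \<open>h\<close> on both
  sides; so c = 0, where all values collapse, needs no separate case.\<close>

lemma step_integral_cmult:
  assumes "step_function \<Omega> h"
  shows "step_integral \<Omega> \<mu> (\<lambda>z. c * h z) = c * step_integral \<Omega> \<mu> h"
  using step_integral_pair[OF assms assms, of "\<lambda>a b. a"] step_integral_pair[OF assms assms, of "\<lambda>a b. c * a"]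
  by (simp add: sum_distrib_left mult.assoc)

lemma step_integral_const: "step_integral \<Omega> \<mu> (\<lambda>_. c) = c * \<mu> \<Omega>"
  by (cases "\<Omega> = {}") (auto simp: step_integral_def charge_empty image_constant_conv)

lemma step_integral_indicator:
  assumes "A \<in> sets borel"
  shows "step_integral \<Omega> \<mu> (indicator A) = \<mu> (A \<inter> \<Omega>)"
proof -
  let ?k = "\<lambda>z. z \<in> A"
  have "?k -` {l} \<inter> \<Omega> \<in> borel_subsets \<Omega>" for l
    using assms \<Omega>_borel by (cases l) (auto simp: borel_subsets_def vimage_def Collect_neg_eq Int_commute
        intro: sets.Int sets.Diff simp flip: Diff_eq)
  moreover have "finite (?k ` \<Omega>)" by (rule finite_subset[of _ UNIV]) auto
  ultimately have "step_integral \<Omega> \<mu> (\<lambda>z. of_bool (?k z)) = (\<Sum>l\<in>?k ` \<Omega>. of_bool l * \<mu> (?k -` {l} \<inter> \<Omega>))"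
    by (intro step_integral_compose)
  \<comment> \<open>\<open>True\<close> is not attained when \<open>A\<close> misses \<Omega>; its
    level set is then empty and contributes 0.\<close>
  also have "\<dots> = (\<Sum>l\<in>{True}. of_bool l * \<mu> (?k -` {l} \<inter> \<Omega>))"
  proof (rule sum.mono_neutral_cong)
    fix l assume "l \<in> {True} - ?k ` \<Omega>"
    then have "?k -` {l} \<inter> \<Omega> = {}" by auto
    then show "of_bool l * \<mu> (?k -` {l} \<inter> \<Omega>) = 0" by (simp only: charge_empty)
  qed (use \<open>finite (?k ` \<Omega>)\<close> in auto)
  also have "\<dots> = \<mu> (A \<inter> \<Omega>)" by (simp add: vimage_def)
  finally show ?thesis by (simp add: indicator_def[abs_def])
qed

lemma step_integral_diff:
  assumes "step_function \<Omega> h1" "step_function \<Omega> h2"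
  shows "step_integral \<Omega> \<mu> (\<lambda>z. h1 z - h2 z) = step_integral \<Omega> \<mu> h1 - step_integral \<Omega> \<mu> h2"
  using step_integral_add[OF assms(1) step_function_binary[OF assms(2,2), of "\<lambda>a _. (-1) * a"]]
    step_integral_cmult[OF assms(2), of "-1"] by simp

lemma step_integral_abs:
  assumes "step_function \<Omega> h"
  shows "\<bar>step_integral \<Omega> \<mu> h\<bar> \<le> step_integral \<Omega> \<mu> (\<lambda>z. \<bar>h z\<bar>)"
proof -
  have s: "step_function \<Omega> (\<lambda>z. \<bar>h z\<bar>)" "step_function \<Omega> (\<lambda>z. (-1) * h z)"
    using step_function_binary[OF assms assms, of "\<lambda>a _. \<bar>a\<bar>"] step_function_binary[OF assms assms, of "\<lambda>a _. (-1) * a"] by auto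
  have "step_integral \<Omega> \<mu> h \<le> step_integral \<Omega> \<mu> (\<lambda>z. \<bar>h z\<bar>)"
    by (intro step_integral_mono assms s) auto
  moreover have "step_integral \<Omega> \<mu> (\<lambda>z. (-1) * h z) \<le> step_integral \<Omega> \<mu> (\<lambda>z. \<bar>h z\<bar>)"
    by (intro step_integral_mono assms s) auto
  ultimately show ?thesis using step_integral_cmult[OF assms, of "-1"] by linarith
qed

text \<open>Inclusion in \<Omega> guarantees that the infimum is taken over a nonempty set, as
  \<Omega> itself is a competitor.\<close>

lemma outer_nonneg:
  assumes "A \<subseteq> \<Omega>" shows "outer \<Omega> \<mu> A \<ge> 0"
  unfolding outer_def
  by (rule cInf_greatest) (use assms \<Omega>_borel nonneg in \<open>auto simp: borel_subsets_def\<close>)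

lemma outer_le:
  assumes "A \<subseteq> B" "B \<in> borel_subsets \<Omega>" shows "outer \<Omega> \<mu> A \<le> \<mu> B"
  unfolding outer_def
proof (rule cInf_lower)
  show "\<mu> B \<in> {\<mu> B |B. B \<in> borel_subsets \<Omega> \<and> A \<subseteq> B}" using assms by blast
  show "bdd_below {\<mu> B |B. B \<in> borel_subsets \<Omega> \<and> A \<subseteq> B}"
    by (rule bdd_belowI[of _ 0]) (use nonneg in blast)
qed

lemma outer_empty: "outer \<Omega> \<mu> {} = 0"
  using outer_le[of "{}" "{}"] outer_nonneg[of "{}"] by (simp add: borel_subsets_def charge_empty)

lemma outer_less_imp:
  assumes "A \<subseteq> \<Omega>" "outer \<Omega> \<mu> A < e"
  obtains B where "A \<subseteq> B" "B \<in> borel_subsets \<Omega>" "\<mu> B < e"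
proof -
  have "{\<mu> B |B. B \<in> borel_subsets \<Omega> \<and> A \<subseteq> B} \<noteq> {}"
    using assms(1) \<Omega>_borel by (auto simp: borel_subsets_def)
  from cInf_lessD[OF this assms(2)[unfolded outer_def]] show ?thesis using that by auto
qed

lemma outer_subadditive:
  assumes "A \<subseteq> \<Omega>" "B \<subseteq> \<Omega>" "D \<subseteq> A \<union> B"
  shows "outer \<Omega> \<mu> D \<le> outer \<Omega> \<mu> A + outer \<Omega> \<mu> B"
proof (rule field_le_epsilon)
  fix e :: real assume e: "e > 0"
  obtain A' where A': "A \<subseteq> A'" "A' \<in> borel_subsets \<Omega>" "\<mu> A' < outer \<Omega> \<mu> A + e / 2"
    using outer_less_imp[OF assms(1), of "outer \<Omega> \<mu> A + e / 2"] e by auto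
  obtain B' where B': "B \<subseteq> B'" "B' \<in> borel_subsets \<Omega>" "\<mu> B' < outer \<Omega> \<mu> B + e / 2"
    using outer_less_imp[OF assms(2), of "outer \<Omega> \<mu> B + e / 2"] e by auto
  have "outer \<Omega> \<mu> D \<le> \<mu> (A' \<union> B')"
    by (rule outer_le) (use A' B' assms in \<open>auto simp: borel_subsets_def\<close>)
  then show "outer \<Omega> \<mu> D \<le> outer \<Omega> \<mu> A + outer \<Omega> \<mu> B + e"
    using subadditive[OF A'(2) B'(2)] A'(3) B'(3) by linarith
qed

section \<open>Approximating sequences: uniqueness and linearity of the integral\<close>

lemma approximates_combine:
  assumes h: "approximates \<Omega> \<mu> h g" and h': "approximates \<Omega> \<mu> h' g'"
  shows "approximates \<Omega> \<mu> (\<lambda>k z. h k z + c * h' k z) (\<lambda>z. g z + c * g' z)"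
proof -
  \<comment> \<open>A bound for |c| that remains positive when c = 0, so that \<epsilon> / (2 C) is
    an admissible threshold.\<close>
  define C where "C = \<bar>c\<bar> + 1"
  have C: "C > 0" "\<bar>c\<bar> < C" by (auto simp: C_def)
  have st: "step_function \<Omega> (h k)" "step_function \<Omega> (h' k)" for k
    using h h' by (auto simp: approximates_def)
  have ab: "step_function \<Omega> (\<lambda>z. \<bar>h k z - h l z\<bar>)" "step_function \<Omega> (\<lambda>z. \<bar>h' k z - h' l z\<bar>)" for k l
    using step_function_binary[of "h k" "h l" "\<lambda>a b. \<bar>a - b\<bar>"] step_function_binary[of "h' k" "h' l" "\<lambda>a b. \<bar>a - b\<bar>"] st by auto
  have cst: "step_function \<Omega> (\<lambda>z. h k z + c * h' k z)" for k
    using step_function_binary[of "h k" "h' k" "\<lambda>a b. a + c * b"] st by auto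
  show ?thesis
    unfolding approximates_def
  proof (intro conjI allI impI cst)
    fix \<epsilon> :: real assume \<epsilon>: "\<epsilon> > 0"
    let ?A = "\<lambda>k. {z \<in> \<Omega>. \<bar>h k z - g z\<bar> > \<epsilon> / 2}" and ?B = "\<lambda>k. {z \<in> \<Omega>. \<bar>h' k z - g' z\<bar> > \<epsilon> / (2 * C)}"
    let ?D = "\<lambda>k. {z \<in> \<Omega>. \<bar>h k z + c * h' k z - (g z + c * g' z)\<bar> > \<epsilon>}"
    have sub: "?D k \<subseteq> ?A k \<union> ?B k" for k
    proof
      fix z assume z: "z \<in> ?D k"
      show "z \<in> ?A k \<union> ?B k"
      proof (rule ccontr)
        assume "z \<notin> ?A k \<union> ?B k"
        then have *: "\<bar>h k z - g z\<bar> \<le> \<epsilon> / 2" "\<bar>h' k z - g' z\<bar> \<le> \<epsilon> / (2 * C)" using z by auto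
        have "\<bar>c * (h' k z - g' z)\<bar> \<le> C * (\<epsilon> / (2 * C))"
          unfolding abs_mult using C * by (intro mult_mono) auto
        then have "\<bar>c * (h' k z - g' z)\<bar> \<le> \<epsilon> / 2" using C by simp
        moreover have "h k z + c * h' k z - (g z + c * g' z) = (h k z - g z) + c * (h' k z - g' z)"
          by (simp add: algebra_simps)
        ultimately have "\<bar>h k z + c * h' k z - (g z + c * g' z)\<bar> \<le> \<epsilon>" using *(1) by linarith
        then show False using z by auto
      qed
    qed
    have "\<epsilon> / 2 > 0" "\<epsilon> / (2 * C) > 0" using \<epsilon> C by auto
    then have "(\<lambda>k. outer \<Omega> \<mu> (?A k)) \<longlonglongrightarrow> 0" "(\<lambda>k. outer \<Omega> \<mu> (?B k)) \<longlonglongrightarrow> 0"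
      using h h' unfolding approximates_def by blast+
    then have "(\<lambda>k. outer \<Omega> \<mu> (?A k) + outer \<Omega> \<mu> (?B k)) \<longlonglongrightarrow> 0 + 0"
      by (rule tendsto_add)
    then have lim: "(\<lambda>k. outer \<Omega> \<mu> (?A k) + outer \<Omega> \<mu> (?B k)) \<longlonglongrightarrow> 0" by simp
    have D1: "0 \<le> outer \<Omega> \<mu> (?D k)" for k by (rule outer_nonneg) blast
    have D2: "outer \<Omega> \<mu> (?D k) \<le> outer \<Omega> \<mu> (?A k) + outer \<Omega> \<mu> (?B k)" for k
      by (rule outer_subadditive[OF _ _ sub]) blast+
    show "(\<lambda>k. outer \<Omega> \<mu> (?D k)) \<longlonglongrightarrow> 0"
      by (rule tendsto_sandwich[OF always_eventually[OF allI[OF D1]] always_eventually[OF allI[OF D2]] tendsto_const lim])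
  next
    fix \<epsilon> :: real assume \<epsilon>: "\<epsilon> > 0"
    obtain N1 where N1: "\<And>k l. k \<ge> N1 \<Longrightarrow> l \<ge> N1 \<Longrightarrow> step_integral \<Omega> \<mu> (\<lambda>z. \<bar>h k z - h l z\<bar>) < \<epsilon> / 2"
      using h \<epsilon> unfolding approximates_def by (meson half_gt_zero)
    have "\<epsilon> / (2 * C) > 0" using \<epsilon> C by simp
    then obtain N2 where N2: "\<And>k l. k \<ge> N2 \<Longrightarrow> l \<ge> N2 \<Longrightarrow> step_integral \<Omega> \<mu> (\<lambda>z. \<bar>h' k z - h' l z\<bar>) < \<epsilon> / (2 * C)"
      using h' unfolding approximates_def by meson
    show "\<exists>N. \<forall>k\<ge>N. \<forall>l\<ge>N. step_integral \<Omega> \<mu> (\<lambda>z. \<bar>h k z + c * h' k z - (h l z + c * h' l z)\<bar>) < \<epsilon>"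
    proof (intro exI[of _ "max N1 N2"] allI impI)
      fix k l assume kl: "max N1 N2 \<le> k" "max N1 N2 \<le> l"
      have "step_integral \<Omega> \<mu> (\<lambda>z. \<bar>h k z + c * h' k z - (h l z + c * h' l z)\<bar>)
        \<le> step_integral \<Omega> \<mu> (\<lambda>z. \<bar>h k z - h l z\<bar> + \<bar>c\<bar> * \<bar>h' k z - h' l z\<bar>)"
      proof (rule step_integral_mono)
        show "step_function \<Omega> (\<lambda>z. \<bar>h k z + c * h' k z - (h l z + c * h' l z)\<bar>)"
          using step_function_binary[OF cst[of k] cst[of l], of "\<lambda>a b. \<bar>a - b\<bar>"] .
        show "step_function \<Omega> (\<lambda>z. \<bar>h k z - h l z\<bar> + \<bar>c\<bar> * \<bar>h' k z - h' l z\<bar>)"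
          using step_function_binary[OF ab(1)[of k l] ab(2)[of k l], of "\<lambda>a b. a + \<bar>c\<bar> * b"] .
        fix z
        have eq: "h k z + c * h' k z - (h l z + c * h' l z) = (h k z - h l z) + c * (h' k z - h' l z)"
          by (simp add: algebra_simps)
        show "\<bar>h k z + c * h' k z - (h l z + c * h' l z)\<bar> \<le> \<bar>h k z - h l z\<bar> + \<bar>c\<bar> * \<bar>h' k z - h' l z\<bar>"
          unfolding eq abs_mult[symmetric] by (rule abs_triangle_ineq)
      qed
      also have "\<dots> = step_integral \<Omega> \<mu> (\<lambda>z. \<bar>h k z - h l z\<bar>) + \<bar>c\<bar> * step_integral \<Omega> \<mu> (\<lambda>z. \<bar>h' k z - h' l z\<bar>)"
        using step_integral_add[OF ab(1)[of k l] step_function_binary[OF ab(2)[of k l] ab(2)[of k l], of "\<lambda>a _. \<bar>c\<bar> * a"]]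
          step_integral_cmult[OF ab(2)[of k l], of "\<bar>c\<bar>"] by simp
      also have "\<dots> < \<epsilon> / 2 + C * (\<epsilon> / (2 * C))"
      proof (rule add_less_le_mono)
        show "step_integral \<Omega> \<mu> (\<lambda>z. \<bar>h k z - h l z\<bar>) < \<epsilon> / 2" using N1 kl by auto
        show "\<bar>c\<bar> * step_integral \<Omega> \<mu> (\<lambda>z. \<bar>h' k z - h' l z\<bar>) \<le> C * (\<epsilon> / (2 * C))"
        proof (rule mult_mono)
          show "step_integral \<Omega> \<mu> (\<lambda>z. \<bar>h' k z - h' l z\<bar>) \<le> \<epsilon> / (2 * C)"
            using N2[of k l] kl by simp
          show "0 \<le> step_integral \<Omega> \<mu> (\<lambda>z. \<bar>h' k z - h' l z\<bar>)"
            using step_integral_mono[OF step_function_const[of 0] ab(2)[of k l]] by (simp add: step_integral_const)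
        qed (use C in auto)
      qed
      also have "\<dots> = \<epsilon>" using C by simp
      finally show "step_integral \<Omega> \<mu> (\<lambda>z. \<bar>h k z + c * h' k z - (h l z + c * h' l z)\<bar>) < \<epsilon>" .
    qed
  qed
qed

text \<open>Split the integral of \<open>\<bar>h\<^sub>k\<bar>\<close> at the level \<open>\<epsilon>\<close>, and compare it with the bounded
  function \<open>h\<^sub>N\<close> where \<open>\<bar>h\<^sub>k\<bar> > \<epsilon>\<close>.\<close>

lemma approximates_zero:
  assumes h: "approximates \<Omega> \<mu> h (\<lambda>_. 0)"
  shows "(\<lambda>k. step_integral \<Omega> \<mu> (h k)) \<longlonglongrightarrow> 0"
proof (rule LIMSEQ_I)
  fix e :: real assume e: "e > 0"
  have st: "step_function \<Omega> (h k)" for k using h by (auto simp: approximates_def)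
  have ab: "step_function \<Omega> (\<lambda>z. \<bar>h k z\<bar>)" "step_function \<Omega> (\<lambda>z. \<bar>h k z - h l z\<bar>)" for k l
    using step_function_binary[OF st[of k] st[of l], of "\<lambda>a b. \<bar>a\<bar>"]
      step_function_binary[OF st[of k] st[of l], of "\<lambda>a b. \<bar>a - b\<bar>"] by auto
  have \<mu>\<Omega>: "\<mu> \<Omega> \<ge> 0" using nonneg \<Omega>_borel by (simp add: borel_subsets_def)
  \<comment> \<open>The error is split into three thirds of \<open>e\<close>: the level \<epsilon>
    on all of \<Omega>, the bound \<open>M\<close> of \<open>h N\<close> on a set of small charge,
    and the Cauchy distance from \<open>h k\<close> to \<open>h N\<close>. The summand 1 covers
    \<mu> \<Omega> = 0.\<close>
  define \<epsilon> where "\<epsilon> = e / (3 * (\<mu> \<Omega> + 1))"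
  have \<epsilon>: "\<epsilon> > 0" "\<epsilon> * \<mu> \<Omega> \<le> e / 3"
    using e \<mu>\<Omega> by (auto simp: \<epsilon>_def field_simps)
  obtain N where N: "\<And>k. k \<ge> N \<Longrightarrow> step_integral \<Omega> \<mu> (\<lambda>z. \<bar>h k z - h N z\<bar>) < e / 3"
    using h e unfolding approximates_def by (metis divide_pos_pos order_refl zero_less_numeral)
  have "finite (h N ` \<Omega>)"
    using st[of N] by (auto simp: step_function_def simple_function_def space_restrict_space)
  then obtain M where M: "M > 0" "\<And>z. z \<in> \<Omega> \<Longrightarrow> \<bar>h N z\<bar> \<le> M"
    using finite_imp_bounded[of "h N ` \<Omega>"] unfolding bounded_pos by auto
  have "(\<lambda>k. outer \<Omega> \<mu> {z \<in> \<Omega>. \<bar>h k z - 0\<bar> > \<epsilon>}) \<longlonglongrightarrow> 0"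
    using h \<epsilon> unfolding approximates_def by blast
  then have "\<forall>\<^sub>F k in sequentially. outer \<Omega> \<mu> {z \<in> \<Omega>. \<bar>h k z - 0\<bar> > \<epsilon>} < e / (3 * M)"
    using e M by (intro order_tendstoD) auto
  then obtain N' where N': "\<And>k. k \<ge> N' \<Longrightarrow> outer \<Omega> \<mu> {z \<in> \<Omega>. \<bar>h k z - 0\<bar> > \<epsilon>} < e / (3 * M)"
    unfolding eventually_sequentially by blast
  show "\<exists>no. \<forall>k\<ge>no. norm (step_integral \<Omega> \<mu> (h k) - 0) < e"
  proof (intro exI[of _ "max N N'"] allI impI)
    fix k assume k: "k \<ge> max N N'"
    obtain E where E: "{z \<in> \<Omega>. \<bar>h k z - 0\<bar> > \<epsilon>} \<subseteq> E" "E \<in> borel_subsets \<Omega>" "\<mu> E < e / (3 * M)"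
      using outer_less_imp[OF _ N'[of k]] k by auto
    have E': "E \<in> sets borel" "E \<inter> \<Omega> = E" using E(2) by (auto simp: borel_subsets_def)
    note sI = step_function_indicator[OF E'(1)]
    have s1: "step_function \<Omega> (\<lambda>z. \<epsilon> + M * indicator E z)"
      using step_function_binary[OF sI sI, of "\<lambda>a _. \<epsilon> + M * a"] .
    have "\<bar>step_integral \<Omega> \<mu> (h k)\<bar> \<le> step_integral \<Omega> \<mu> (\<lambda>z. \<bar>h k z\<bar>)"
      by (rule step_integral_abs[OF st])
    also have "\<dots> \<le> step_integral \<Omega> \<mu> (\<lambda>z. (\<epsilon> + M * indicator E z) + \<bar>h k z - h N z\<bar>)"
    proof (rule step_integral_mono[OF ab(1)])
      show "step_function \<Omega> (\<lambda>z. (\<epsilon> + M * indicator E z) + \<bar>h k z - h N z\<bar>)"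
        by (rule step_function_binary[OF s1 ab(2)])
      fix z assume z: "z \<in> \<Omega>"
      show "\<bar>h k z\<bar> \<le> (\<epsilon> + M * indicator E z) + \<bar>h k z - h N z\<bar>"
      proof (cases "z \<in> E")
        case True
        have "\<bar>h k z\<bar> \<le> \<bar>h k z - h N z\<bar> + \<bar>h N z\<bar>" by linarith
        with True show ?thesis using M(2)[OF z] \<epsilon> by simp
      next
        case False
        then have "\<bar>h k z\<bar> \<le> \<epsilon>" using E(1) z by force
        then show ?thesis using False by simp
      qed
    qed
    also have "\<dots> = \<epsilon> * \<mu> \<Omega> + M * \<mu> E + step_integral \<Omega> \<mu> (\<lambda>z. \<bar>h k z - h N z\<bar>)"
      using step_integral_add[OF s1 ab(2)[of k N]]
        step_integral_add[OF step_function_const[of \<epsilon>] step_function_binary[OF sI sI, of "\<lambda>a _. M * a"]]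
        step_integral_cmult[OF sI, of M] step_integral_indicator[OF E'(1)] E'(2)
      by (simp add: step_integral_const)
    also have "\<dots> < e / 3 + M * (e / (3 * M)) + e / 3"
    proof (intro add_le_less_mono add_mono)
      show "M * \<mu> E \<le> M * (e / (3 * M))" using M E(3) by (intro mult_left_mono) auto
    qed (use \<epsilon> N k in auto)
    also have "\<dots> = e" using M by simp
    finally show "norm (step_integral \<Omega> \<mu> (h k) - 0) < e" by simp
  qed
qed

text \<open>The difference of the two sequences approximates 0, so \<open>approximates_zero\<close>
  applies. This gives the uniqueness that the \<open>THE\<close> in \<open>fa_integral\<close>
  relies on.\<close>

lemma approximates_unique:
  assumes "approximates \<Omega> \<mu> h g" "approximates \<Omega> \<mu> h' g"
    and "(\<lambda>k. step_integral \<Omega> \<mu> (h k)) \<longlonglongrightarrow> a" "(\<lambda>k. step_integral \<Omega> \<mu> (h' k)) \<longlonglongrightarrow> b"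
  shows "a = b"
proof -
  have st: "step_function \<Omega> (h k)" "step_function \<Omega> (h' k)" for k
    using assms(1,2) by (auto simp: approximates_def)
  have "approximates \<Omega> \<mu> (\<lambda>k z. h k z - h' k z) (\<lambda>_. 0)"
    using approximates_combine[OF assms(1,2), of "-1"] by simp
  from approximates_zero[OF this] have "(\<lambda>k. step_integral \<Omega> \<mu> (h k) - step_integral \<Omega> \<mu> (h' k)) \<longlonglongrightarrow> 0"
    by (simp add: step_integral_diff st)
  moreover have "(\<lambda>k. step_integral \<Omega> \<mu> (h k) - step_integral \<Omega> \<mu> (h' k)) \<longlonglongrightarrow> a - b"
    by (intro tendsto_diff assms)
  ultimately show ?thesis using LIMSEQ_unique by fastforce
qed

lemma fa_integral_eqI:
  assumes "approximates \<Omega> \<mu> h g" "(\<lambda>k. step_integral \<Omega> \<mu> (h k)) \<longlonglongrightarrow> a"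
  shows "fa_integral \<Omega> \<mu> g = a"
  unfolding fa_integral_def using assms approximates_unique by (intro the_equality) blast+

text \<open>The existence half of the definite description: the Cauchy condition in
  \<open>approximates\<close> makes the step integrals a Cauchy sequence of reals.\<close>

lemma fa_integrableE:
  assumes "fa_integrable \<Omega> \<mu> g"
  obtains h where "approximates \<Omega> \<mu> h g" "(\<lambda>k. step_integral \<Omega> \<mu> (h k)) \<longlonglongrightarrow> fa_integral \<Omega> \<mu> g"
proof -
  obtain h where h: "approximates \<Omega> \<mu> h g" using assms by (auto simp: fa_integrable_def)
  have st: "step_function \<Omega> (h k)" for k using h by (auto simp: approximates_def)
  have "Cauchy (\<lambda>k. step_integral \<Omega> \<mu> (h k))"
  proof (rule CauchyI)
    fix e :: real assume "e > 0"
    then obtain N where N: "\<And>k l. k \<ge> N \<Longrightarrow> l \<ge> N \<Longrightarrow> step_integral \<Omega> \<mu> (\<lambda>z. \<bar>h k z - h l z\<bar>) < e"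
      using h unfolding approximates_def by meson
    have "\<bar>step_integral \<Omega> \<mu> (h k) - step_integral \<Omega> \<mu> (h l)\<bar> \<le> step_integral \<Omega> \<mu> (\<lambda>z. \<bar>h k z - h l z\<bar>)" for k l
      using step_integral_abs[OF step_function_binary[OF st[of k] st[of l], of "(-)"]] step_integral_diff[OF st[of k] st[of l]] by simp
    then have "norm (step_integral \<Omega> \<mu> (h k) - step_integral \<Omega> \<mu> (h l)) < e" if "k \<ge> N" "l \<ge> N" for k l
      using N[OF that] unfolding real_norm_def by (rule order_le_less_trans)
    then show "\<exists>M. \<forall>m\<ge>M. \<forall>n\<ge>M. norm (step_integral \<Omega> \<mu> (h m) - step_integral \<Omega> \<mu> (h n)) < e"
      by (intro exI[of _ N] allI impI)
  qed
  then obtain a where a: "(\<lambda>k. step_integral \<Omega> \<mu> (h k)) \<longlonglongrightarrow> a"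
    using Cauchy_convergent_iff convergent_def by blast
  with fa_integral_eqI[OF h a] h that show ?thesis by blast
qed

lemma fa_integral_combine:
  assumes "fa_integrable \<Omega> \<mu> g" "fa_integrable \<Omega> \<mu> g'"
  shows "fa_integrable \<Omega> \<mu> (\<lambda>z. g z + c * g' z)"
    and "fa_integral \<Omega> \<mu> (\<lambda>z. g z + c * g' z) = fa_integral \<Omega> \<mu> g + c * fa_integral \<Omega> \<mu> g'"
proof -
  obtain h where h: "approximates \<Omega> \<mu> h g" "(\<lambda>k. step_integral \<Omega> \<mu> (h k)) \<longlonglongrightarrow> fa_integral \<Omega> \<mu> g"
    using fa_integrableE[OF assms(1)] .
  obtain h' where h': "approximates \<Omega> \<mu> h' g'" "(\<lambda>k. step_integral \<Omega> \<mu> (h' k)) \<longlonglongrightarrow> fa_integral \<Omega> \<mu> g'"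
    using fa_integrableE[OF assms(2)] .
  have st: "step_function \<Omega> (h k)" "step_function \<Omega> (h' k)" for k
    using h(1) h'(1) by (auto simp: approximates_def)
  note ap = approximates_combine[OF h(1) h'(1), of c]
  show "fa_integrable \<Omega> \<mu> (\<lambda>z. g z + c * g' z)" using ap by (auto simp: fa_integrable_def)
  have "step_integral \<Omega> \<mu> (\<lambda>z. h k z + c * h' k z) = step_integral \<Omega> \<mu> (h k) + c * step_integral \<Omega> \<mu> (h' k)" for k
    using step_integral_add[OF st(1)[of k] step_function_binary[OF st(2)[of k] st(2)[of k], of "\<lambda>a _. c * a"]]
      step_integral_cmult[OF st(2)[of k], of c] by simp
  then have "(\<lambda>k. step_integral \<Omega> \<mu> (\<lambda>z. h k z + c * h' k z)) \<longlonglongrightarrow> fa_integral \<Omega> \<mu> g + c * fa_integral \<Omega> \<mu> g'"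
    using h(2) h'(2) by (simp add: tendsto_intros)
  then show "fa_integral \<Omega> \<mu> (\<lambda>z. g z + c * g' z) = fa_integral \<Omega> \<mu> g + c * fa_integral \<Omega> \<mu> g'"
    by (rule fa_integral_eqI[OF ap])
qed

lemma fa_integral_sum:
  assumes "finite J" "\<And>j. j \<in> J \<Longrightarrow> fa_integrable \<Omega> \<mu> (g j)"
  shows "fa_integrable \<Omega> \<mu> (\<lambda>z. \<Sum>j\<in>J. g j z * c j) \<and>
    fa_integral \<Omega> \<mu> (\<lambda>z. \<Sum>j\<in>J. g j z * c j) = (\<Sum>j\<in>J. fa_integral \<Omega> \<mu> (g j) * c j)"
  using assms
proof (induction J)
  case empty
  have "approximates \<Omega> \<mu> (\<lambda>_ _. 0) (\<lambda>_. 0)"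
    by (auto simp: approximates_def step_function_const step_integral_const outer_empty)
  moreover have "(\<lambda>k. step_integral \<Omega> \<mu> (\<lambda>_. 0)) \<longlonglongrightarrow> 0" by (simp add: step_integral_const)
  ultimately show ?case using fa_integral_eqI by (auto simp: fa_integrable_def)
next
  case (insert i J)
  then have IH: "fa_integrable \<Omega> \<mu> (\<lambda>z. \<Sum>j\<in>J. g j z * c j)"
      "fa_integral \<Omega> \<mu> (\<lambda>z. \<Sum>j\<in>J. g j z * c j) = (\<Sum>j\<in>J. fa_integral \<Omega> \<mu> (g j) * c j)"
    and i: "fa_integrable \<Omega> \<mu> (g i)" by auto
  have eq: "(\<lambda>z. \<Sum>j\<in>insert i J. g j z * c j) = (\<lambda>z. (\<Sum>j\<in>J. g j z * c j) + c i * g i z)"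
    using insert.hyps by (simp add: fun_eq_iff mult.commute add.commute)
  show ?case
    unfolding eq using fa_integral_combine[OF IH(1) i, of "c i"] IH(2) insert.hyps
    by (simp add: mult.commute add.commute)
qed

end

section \<open>Density charges\<close>

lemma finite_lborel_bounded: "bounded A \<Longrightarrow> emeasure lborel A \<noteq> \<infinity>"
  using emeasure_bounded_finite[of A] by auto

lemma measure_lborel_mono_bounded:
  assumes "A \<subseteq> B" "A \<in> sets borel" "B \<in> sets borel" "bounded B"
  shows "measure lborel A \<le> measure lborel B"
  using assms finite_lborel_bounded[OF assms(4)] by (intro measure_mono_fmeasurable) (auto simp: fmeasurable_def less_top)

lemma measure_lborel_split_bounded:
  assumes "A \<in> sets borel" "B \<in> sets borel" "bounded A"
  shows "measure lborel A = measure lborel (A \<inter> B) + measure lborel (A - B)"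
proof -
  have "A = (A \<inter> B) \<union> (A - B)" by blast
  moreover have "measure lborel ((A \<inter> B) \<union> (A - B)) = measure lborel (A \<inter> B) + measure lborel (A - B)"
    using assms by (intro measure_Union finite_lborel_bounded) (auto intro: bounded_subset[OF assms(3)])
  ultimately show ?thesis by simp
qed

text \<open>The measure of A inside a ball grows continuously with the radius, because its
  increments are dominated by those of the volume of the ball; the intermediate value theorem then
  gives the half.\<close>

lemma exists_half_measure:
  fixes A :: "'a::euclidean_space set"
  assumes A: "A \<in> sets borel" "bounded A"
  shows "\<exists>A'. A' \<subseteq> A \<and> A' \<in> sets borel \<and> 2 * measure lborel A' = measure lborel A"
proof -
  obtain R where R: "R > 0" "A \<subseteq> cball 0 R"
    using A(2) unfolding bounded_pos by (auto simp: subset_iff)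
  define F where "F t = measure lborel (A \<inter> cball 0 t)" for t
  define G where "G t = measure lborel (cball (0::'a) t)" for t
  have bA: "bounded (A \<inter> X)" for X using A(2) by (rule bounded_subset) blast
  have FG: "\<bar>F t - F s\<bar> \<le> \<bar>G t - G s\<bar>" if "s \<le> t" for s t
  proof -
    have 1: "A \<inter> cball 0 t \<inter> cball 0 s = A \<inter> cball 0 s" "cball 0 t \<inter> cball 0 s = cball (0::'a) s"
      using subset_cball[OF that, of 0] by auto
    have "F t - F s = measure lborel (A \<inter> cball 0 t - cball 0 s)"
      using measure_lborel_split_bounded[of "A \<inter> cball 0 t" "cball 0 s"] A(1) bA 1(1) by (simp add: F_def)
    moreover have "G t - G s = measure lborel (cball 0 t - cball (0::'a) s)"
      using measure_lborel_split_bounded[of "cball (0::'a) t" "cball 0 s"] 1(2) by (simp add: G_def)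
    moreover have "measure lborel (A \<inter> cball 0 t - cball 0 s) \<le> measure lborel (cball 0 t - cball (0::'a) s)"
      using A(1) by (intro measure_lborel_mono_bounded) (auto intro: bounded_diff)
    ultimately show ?thesis by simp
  qed
  have "continuous_on {0..R} (\<lambda>t. t ^ DIM('a) * measure lborel (cball (0::'a) 1))"
    by (intro continuous_intros)
  moreover have "G t = t ^ DIM('a) * measure lborel (cball (0::'a) 1)" if "t \<in> {0..R}" for t
    unfolding G_def using that by (intro content_cball_scale) simp
  ultimately have G: "continuous_on {0..R} G"
    using continuous_on_cong[OF refl, of "{0..R}" G] by metis
  have "continuous_on {0..R} F"
    unfolding continuous_on_iff
  proof (intro ballI allI impI)
    fix t e :: real assume "t \<in> {0..R}" "e > 0"
    then obtain d where d: "d > 0" "\<And>s. s \<in> {0..R} \<Longrightarrow> dist s t < d \<Longrightarrow> dist (G s) (G t) < e"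
      using G unfolding continuous_on_iff by blast
    have "dist (F s) (F t) < e" if "s \<in> {0..R}" "dist s t < d" for s
    proof -
      have "\<bar>F s - F t\<bar> \<le> \<bar>G s - G t\<bar>"
        using FG[of s t] FG[of t s] by (cases "s \<le> t") (auto simp: abs_minus_commute)
      then show ?thesis using d(2)[OF that] by (simp add: dist_real_def)
    qed
    then show "\<exists>d>0. \<forall>s\<in>{0..R}. dist s t < d \<longrightarrow> dist (F s) (F t) < e" using d(1) by blast
  qed
  moreover have "F 0 = 0"
  proof -
    have "F 0 \<le> measure lborel {0::'a}"
      unfolding F_def using A(1) by (intro measure_lborel_mono_bounded) auto
    also have "\<dots> = 0" by simp
    finally have "F 0 \<le> 0" .
    moreover have "F 0 \<ge> 0" unfolding F_def by (rule measure_nonneg)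
    ultimately show ?thesis by linarith
  qed
  moreover have "F R = measure lborel A" using R(2) by (simp add: F_def Int_absorb2)
  ultimately obtain t where "0 \<le> t" "t \<le> R" "F t = measure lborel A / 2"
    using IVT'[of F 0 "measure lborel A / 2" R] R(1) by auto
  then show ?thesis using A(1) by (intro exI[of _ "A \<inter> cball 0 t"]) (auto simp: F_def)
qed

text \<open>The tubes enter only through these properties. \<open>upper\<close> is the Limsup
  condition with the denominator cleared; one side is enough because \<open>total\<close> converts
  bounds for complements. \<open>B_scale\<close> makes a shell relatively thin when the ratio of its
  radii is near 1, and \<open>B_null\<close> ensures that no volume escapes the shells.\<close>

locale density_charge = positive_charge \<Omega> \<mu>
  for \<Omega> :: "'a::euclidean_space set" and \<mu> :: "'a set \<Rightarrow> real" +
  fixes B :: "real \<Rightarrow> 'a set" and d0 :: real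
  assumes total: "\<mu> \<Omega> = 1"
    and upper: "\<And>A L. A \<in> borel_subsets \<Omega> \<Longrightarrow>
      (\<And>e. e > 0 \<Longrightarrow> \<forall>\<^sub>F \<delta> in at_right 0. measure lborel (A \<inter> B \<delta>) \<le> (L + e) * measure lborel (B \<delta>)) \<Longrightarrow> \<mu> A \<le> L"
    and d0: "d0 > 0"
    and B_borel: "\<And>\<delta>. B \<delta> \<in> sets borel" and B_mono: "\<And>\<delta> \<delta>'. \<delta> \<le> \<delta>' \<Longrightarrow> B \<delta> \<subseteq> B \<delta>'"
    and B_bounded: "\<And>\<delta>. bounded (B \<delta>)"
    and B_pos: "\<And>\<delta>. \<delta> > 0 \<Longrightarrow> measure lborel (B \<delta>) > 0"
    and B_scale: "\<And>\<delta> c. 0 < \<delta> \<Longrightarrow> 1 \<le> c \<Longrightarrow> measure lborel (B (c * \<delta>)) \<le> c ^ DIM('a) * measure lborel (B \<delta>)"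
    and B_null: "(\<lambda>k. measure lborel (B (d0 / real (Suc k)))) \<longlonglongrightarrow> 0"
begin

abbreviation m :: "'a set \<Rightarrow> real" where "m \<equiv> measure lborel"

lemma bounded_B_subset: "X \<subseteq> B \<delta> \<Longrightarrow> bounded X"
  using B_bounded bounded_subset by blast

text \<open>The proportion must be right at every small \<delta>, so A is halved separately in each
  shell between consecutive radii d0/(k+1). The halving is then exact at these radii. A \<delta> in
  between adds part of one shell, of relative volume at most (1 + 1/(k+1))^n - 1, which tends to
  0.\<close>

lemma exists_asymptotic_half:
  assumes A: "A \<in> sets borel"
  shows "\<exists>A'. A' \<subseteq> A \<and> A' \<in> sets borel \<and>
    (\<forall>e>0. \<forall>\<^sub>F \<delta> in at_right 0. \<bar>2 * m (A' \<inter> B \<delta>) - m (A \<inter> B \<delta>)\<bar> \<le> e * m (B \<delta>))"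
proof -
  define r where "r k = d0 / real (Suc k)" for k
  have r: "r k > 0" "r (Suc k) \<le> r k" for k using d0 by (auto simp: r_def field_simps)
  have r_anti: "r l \<le> r k" if "k \<le> l" for k l using that d0 by (auto simp: r_def field_simps)
  define S where "S k = B (r k) - B (r (Suc k))" for k
  have "\<exists>H. H \<subseteq> A \<inter> S k \<and> H \<in> sets borel \<and> 2 * m H = m (A \<inter> S k)" for k
    using A B_borel by (intro exists_half_measure) (auto simp: S_def intro: bounded_B_subset[of _ "r k"])
  then obtain H where H: "\<And>k. H k \<subseteq> A \<inter> S k" "\<And>k. H k \<in> sets borel" "\<And>k. 2 * m (H k) = m (A \<inter> S k)"
    by metis
  have S_disj: "S k \<inter> S l = {}" if "k < l" for k l
    using B_mono[OF r_anti[of "Suc k" l]] that by (auto simp: S_def)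
  have S_disj': "z \<in> S k \<Longrightarrow> z \<in> S l \<Longrightarrow> k = l" for z k l
    using S_disj[of k l] S_disj[of l k] by (metis IntI emptyE linorder_neqE_nat)
  define A' where "A' = (\<Union>k. H k)"
  have A': "A' \<subseteq> A" "A' \<in> sets borel" using H by (auto simp: A'_def)
  have A'S: "A' \<inter> S k = H k" for k
  proof -
    have "z \<in> H k" if "z \<in> H l" "z \<in> S k" for z l
      using that H(1)[of l] S_disj'[of z k l] by auto
    then show ?thesis using H(1)[of k] by (auto simp: A'_def)
  qed
  have split: "m (X \<inter> B \<delta>) = m (X \<inter> B \<delta>') + m (X \<inter> (B \<delta> - B \<delta>'))" if "X \<in> sets borel" "\<delta>' \<le> \<delta>" for X \<delta> \<delta>'
  proof -
    have "X \<inter> B \<delta> \<inter> B \<delta>' = X \<inter> B \<delta>'" using B_mono[OF that(2)] by blast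
    moreover have "X \<inter> B \<delta> - B \<delta>' = X \<inter> (B \<delta> - B \<delta>')" by blast
    ultimately show ?thesis
      using measure_lborel_split_bounded[of "X \<inter> B \<delta>" "B \<delta>'"] that(1) B_borel bounded_B_subset[of "X \<inter> B \<delta>" \<delta>] by auto
  qed
  \<comment> \<open>The defect at the radius \<open>r k\<close>. It does not change with k, since
    each shell is halved exactly, and it tends to 0 with the volume of the tubes; so it is 0. This
    replaces a summation over infinitely many shells.\<close>
  define D where "D k = 2 * m (A' \<inter> B (r k)) - m (A \<inter> B (r k))" for k
  have "D k = D (Suc k)" for k
    using split[OF A r(2)[of k]] split[OF A'(2) r(2)[of k]] H(3)[of k] A'S[of k]
    by (simp add: D_def S_def)
  then have D0: "D k = D 0" for k by (induction k) auto
  have "D \<longlonglongrightarrow> 0"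
  proof (rule Lim_null_comparison[OF _ tendsto_mult_right_zero[OF B_null, of 2, folded r_def]])
    have "\<bar>D k\<bar> \<le> 2 * m (B (r k))" for k
    proof -
      have "m (A' \<inter> B (r k)) \<le> m (B (r k))" "m (A \<inter> B (r k)) \<le> m (B (r k))"
        using A A' B_borel by (auto intro!: measure_lborel_mono_bounded B_bounded)
      moreover have "m (A' \<inter> B (r k)) \<ge> 0" "m (A \<inter> B (r k)) \<ge> 0" by auto
      ultimately show ?thesis unfolding D_def abs_le_iff by linarith
    qed
    then show "\<forall>\<^sub>F k in sequentially. norm (D k) \<le> 2 * m (B (r k))" by simp
  qed
  then have D: "D k = 0" for k
    using D0 LIMSEQ_unique[of D 0 "D 0"] by (metis LIMSEQ_const_iff ext)
  have "\<forall>\<^sub>F \<delta> in at_right 0. \<bar>2 * m (A' \<inter> B \<delta>) - m (A \<inter> B \<delta>)\<bar> \<le> e * m (B \<delta>)" if e: "e > 0" for e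
  proof -
    have "(\<lambda>k. (1 + 1 / real (Suc k)) ^ DIM('a) - 1) \<longlonglongrightarrow> (1 + 0) ^ DIM('a) - 1"
      by (intro tendsto_intros LIMSEQ_Suc[OF lim_1_over_n])
    then have "\<forall>\<^sub>F k in sequentially. (1 + 1 / real (Suc k)) ^ DIM('a) - 1 < e"
      using e by (intro order_tendstoD) auto
    then obtain K where K: "\<And>k. k \<ge> K \<Longrightarrow> (1 + 1 / real (Suc k)) ^ DIM('a) - 1 < e"
      unfolding eventually_sequentially by blast
    have "\<bar>2 * m (A' \<inter> B \<delta>) - m (A \<inter> B \<delta>)\<bar> \<le> e * m (B \<delta>)" if \<delta>: "0 < \<delta>" "\<delta> < r K" for \<delta>
    proof -
      \<comment> \<open>The index with d0/(j+1) < \<delta> \<le> d0/j. As r k = d0/(k+1), the shell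
        that contains \<delta> has number k = j - 1.\<close>
      define j where "j = nat \<lfloor>d0 / \<delta>\<rfloor>"
      have big: "real (Suc K) < d0 / \<delta>" using \<delta> d0 by (simp add: r_def field_simps)
      then have "j \<ge> Suc K" by (simp add: j_def le_nat_floor)
      then obtain k where k: "j = Suc k" "k \<ge> K" by (cases j) auto
      have j: "real j \<le> d0 / \<delta>" "d0 / \<delta> < real j + 1"
        using big by (auto simp: j_def)
      have \<delta>k: "\<delta> \<le> r k" "r (Suc k) \<le> \<delta>" 
        using j \<delta> k by (auto simp: r_def field_simps)
      define c where "c = \<delta> / r (Suc k)"
      have c: "1 \<le> c" "c * r (Suc k) = \<delta>" using \<delta>k r(1)[of "Suc k"] by (auto simp: c_def)
      have "c \<le> r k / r (Suc k)" unfolding c_def using \<delta>k r(1)[of "Suc k"] by (intro divide_right_mono) auto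
      also have "\<dots> = real (Suc (Suc k)) / real (Suc k)" using d0 by (simp add: r_def)
      also have "\<dots> = 1 + 1 / real (Suc k)" by (simp add: field_simps)
      finally have c2: "c \<le> 1 + 1 / real (Suc k)" .
      let ?X = "B \<delta> - B (r (Suc k))"
      have "c ^ DIM('a) \<le> (1 + 1 / real (Suc k)) ^ DIM('a)" using c c2 by (intro power_mono) auto
      then have c3: "c ^ DIM('a) - 1 \<le> e" using K[OF k(2)] by linarith
      have "m ?X = m (B \<delta>) - m (B (r (Suc k)))"
        using split[of UNIV "r (Suc k)" \<delta>] \<delta>k by simp
      also have "\<dots> \<le> (c ^ DIM('a) - 1) * m (B (r (Suc k)))"
        using B_scale[OF r(1)[of "Suc k"] c(1)] c(2) by (simp add: algebra_simps)
      also have "\<dots> \<le> e * m (B \<delta>)"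
        using c3 e B_mono[OF \<delta>k(2)] B_borel by (intro mult_mono measure_lborel_mono_bounded B_bounded) auto
      finally have X: "m ?X \<le> e * m (B \<delta>)" .
      have "2 * m (A' \<inter> B \<delta>) - m (A \<inter> B \<delta>) = 2 * m (A' \<inter> ?X) - m (A \<inter> ?X)"
        using split[OF A \<delta>k(2)] split[OF A'(2) \<delta>k(2)] D[of "Suc k"] by (simp add: D_def)
      moreover have "m (A' \<inter> ?X) \<le> m (A \<inter> ?X)" "m (A \<inter> ?X) \<le> m ?X"
        using A A' B_borel by (auto intro!: measure_lborel_mono_bounded bounded_B_subset[of _ \<delta>])
      moreover have "m (A' \<inter> ?X) \<ge> 0" by simp
      ultimately have "\<bar>2 * m (A' \<inter> B \<delta>) - m (A \<inter> B \<delta>)\<bar> \<le> m ?X" by (simp only: abs_le_iff) linarith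
      then show ?thesis using X by linarith
    qed
    then show ?thesis
      using eventually_at_right_real[OF r(1)[of K]] by (auto elim!: eventually_mono)
  qed
  then show ?thesis using A' by blast
qed

section \<open>From averages over the sets B to integrals for the charge\<close>

lemma set_integrable_bounded_B:
  fixes h :: "'a \<Rightarrow> real"
  assumes "h \<in> borel_measurable borel" "\<And>z. \<bar>h z\<bar> \<le> M"
  shows "set_integrable lborel (B \<delta>) h"
  unfolding set_integrable_def
  using assms B_borel[of \<delta>] finite_lborel_bounded[OF B_bounded[of \<delta>]]
  by (intro integrableI_bounded_set_indicator[where B=M]) (auto simp: less_top)

lemma set_integral_indicator_B:
  assumes "A \<in> sets borel"
  shows "(LINT z:B \<delta>|lborel. indicator A z) = m (A \<inter> B \<delta>)"
proof -
  have "(\<lambda>z. indicator (B \<delta>) z *\<^sub>R indicator A z :: real) = indicator (A \<inter> B \<delta>)"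
    by (auto simp: indicator_def fun_eq_iff)
  then show ?thesis by (simp add: set_lebesgue_integral_def)
qed

text \<open>Each level set of odd last digit is halved; adding or subtracting the last digit on the two
  halves removes this digit and does not change the asymptotic averages.\<close>

lemma step_integral_dyadic_le:
  assumes "h \<in> borel_measurable borel" "\<And>z. \<exists>j::nat. j \<le> 2 ^ n \<and> h z = real j / 2 ^ n"
    and "\<And>e. e > 0 \<Longrightarrow> \<forall>\<^sub>F \<delta> in at_right 0. (LINT z:B \<delta>|lborel. h z) \<le> (L + e) * m (B \<delta>)"
  shows "step_integral \<Omega> \<mu> h \<le> L"
  using assms
proof (induction n arbitrary: h)
  case 0
  define A where "A = h -` {1}"
  have A: "A \<in> sets borel" using measurable_sets[OF 0(1), of "{1}"] by (simp add: A_def)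
  have "h = indicator A"
  proof
    fix z show "h z = indicator A z" using 0(2)[of z] by (auto simp: A_def le_Suc_eq)
  qed
  then have "step_integral \<Omega> \<mu> h = \<mu> (A \<inter> \<Omega>)" by (simp add: step_integral_indicator A)
  also have "\<dots> \<le> L"
  proof (rule upper)
    show "A \<inter> \<Omega> \<in> borel_subsets \<Omega>" using A \<Omega>_borel by (auto simp: borel_subsets_def)
    fix e :: real assume "e > 0"
    from 0(3)[OF this] show "\<forall>\<^sub>F \<delta> in at_right 0. m (A \<inter> \<Omega> \<inter> B \<delta>) \<le> (L + e) * m (B \<delta>)"
    proof eventually_elim
      case (elim \<delta>)
      have "m (A \<inter> \<Omega> \<inter> B \<delta>) \<le> m (A \<inter> B \<delta>)"
        using A \<Omega>_borel B_borel by (intro measure_lborel_mono_bounded) (auto intro: bounded_B_subset[of _ \<delta>])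
      then show ?case using elim \<open>h = indicator A\<close> set_integral_indicator_B[OF A, of \<delta>] by simp
    qed
  qed
  finally show ?case .
next
  case (Suc n)
  let ?c = "1 / 2 ^ Suc n :: real"
  define W where "W = range (\<lambda>i::nat. real (2 * i + 1) / 2 ^ Suc n)"
  define A where "A = h -` W"
  have "W \<in> sets borel" unfolding W_def
    using null_setsD2[OF countable_imp_null_set_lborel[of "range (\<lambda>i::nat. real (2 * i + 1) / 2 ^ Suc n)"]] by simp
  then have A: "A \<in> sets borel" using measurable_sets[OF Suc.prems(1)] by (simp add: A_def)
  obtain A' where A': "A' \<subseteq> A" "A' \<in> sets borel"
    "\<And>e. e > 0 \<Longrightarrow> \<forall>\<^sub>F \<delta> in at_right 0. \<bar>2 * m (A' \<inter> B \<delta>) - m (A \<inter> B \<delta>)\<bar> \<le> e * m (B \<delta>)"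
    using exists_asymptotic_half[OF A] by blast
  define s where "s z = (2 * indicator A' z - indicator A z :: real)" for z
  have s_meas: "s \<in> borel_measurable borel" unfolding s_def[abs_def] using A A'(2) by measurable
  have s_val: "s z = (if z \<in> A then (if z \<in> A' then 1 else -1) else 0)" for z
    using A'(1) by (auto simp: s_def indicator_def)
  have s1: "\<bar>s z\<bar> \<le> 1" for z by (simp add: s_val)
  have h1: "\<bar>h z\<bar> \<le> 1" for z
  proof -
    obtain j :: nat where j: "j \<le> 2 ^ Suc n" "h z = real j / 2 ^ Suc n" using Suc.prems(2)[of z] by blast
    have "real j \<le> real (2 ^ Suc n)" using j(1) by (simp only: of_nat_le_iff)
    then have "real j \<le> 2 ^ Suc n" by simp
    then show ?thesis unfolding j(2) by (simp add: divide_le_eq_1)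
  qed
  have int_s: "(LINT z:B \<delta>|lborel. s z) = 2 * m (A' \<inter> B \<delta>) - m (A \<inter> B \<delta>)" for \<delta>
  proof -
    have "set_integrable lborel (B \<delta>) (\<lambda>z. 2 * indicator A' z :: real)" "set_integrable lborel (B \<delta>) (indicator A :: _ \<Rightarrow> real)"
      using A A'(2) by (auto intro!: set_integrable_bounded_B[where M=2] simp: indicator_def)
    then show ?thesis unfolding s_def by (simp add: set_integral_indicator_B A A'(2))
  qed
  have I: "step_integral \<Omega> \<mu> (\<lambda>z. h z + t * ?c * s z) \<le> L" if t: "t = 1 \<or> t = -1" for t
  proof (rule Suc.IH)
    show "(\<lambda>z. h z + t * ?c * s z) \<in> borel_measurable borel"
      using Suc.prems(1) s_meas by measurable
    show "\<exists>j::nat. j \<le> 2 ^ n \<and> h z + t * ?c * s z = real j / 2 ^ n" for z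
    proof -
      obtain j :: nat where j: "j \<le> 2 ^ Suc n" "h z = real j / 2 ^ Suc n" using Suc.prems(2)[of z] by blast
      show ?thesis
      proof (cases "even j")
        case True
        then obtain i where i: "j = 2 * i" by blast
        have "z \<notin> A"
        proof
          assume "z \<in> A"
          then obtain i' :: nat where "real j / 2 ^ Suc n = real (2 * i' + 1) / 2 ^ Suc n" using j by (auto simp: A_def W_def)
          then have "real j = real (2 * i' + 1)" by simp
          then have "j = 2 * i' + 1" by (simp only: of_nat_eq_iff)
          then show False using True by simp
        qed
        then show ?thesis using i j by (intro exI[of _ i]) (auto simp: s_val)
      next
        case False
        then obtain i where i: "j = 2 * i + 1" using oddE by blast
        have "z \<in> A" using j i by (auto simp: A_def W_def)
        then have "t * s z = 1 \<or> t * s z = -1" using t by (auto simp: s_val)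
        then consider "t * s z = 1" | "t * s z = -1" by blast
        then show ?thesis
        proof cases
          case 1
          \<comment> \<open>An odd j lies strictly below the even number 2^(n+1), so rounding up
            does not leave [0,1].\<close>
          have "i + 1 \<le> 2 ^ n" using i j by simp
          moreover have "h z + t * ?c * s z = h z + ?c * (t * s z)" by simp
          then have "h z + t * ?c * s z = real (i + 1) / 2 ^ n" using 1 i j by (simp add: field_simps)
          ultimately show ?thesis by blast
        next
          case 2
          have "i \<le> 2 ^ n" using i j by simp
          moreover have "h z + t * ?c * s z = h z + ?c * (t * s z)" by simp
          then have "h z + t * ?c * s z = real i / 2 ^ n" using 2 i j by (simp add: field_simps)
          ultimately show ?thesis by blast
        qed
      qed
    qed
    fix e :: real assume e: "e > 0"
    then have "e / 2 > 0" by simp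
    from Suc.prems(3)[OF this] A'(3)[OF this]
    show "\<forall>\<^sub>F \<delta> in at_right 0. (LINT z:B \<delta>|lborel. h z + t * ?c * s z) \<le> (L + e) * m (B \<delta>)"
    proof eventually_elim
      case (elim \<delta>)
      have "(LINT z:B \<delta>|lborel. h z + t * ?c * s z) = (LINT z:B \<delta>|lborel. h z) + t * ?c * (LINT z:B \<delta>|lborel. s z)"
        using set_integrable_bounded_B[OF Suc.prems(1) h1, of \<delta>] set_integrable_bounded_B[OF s_meas s1, of \<delta>]
        by (subst set_integral_add) auto
      moreover have "t * ?c * (LINT z:B \<delta>|lborel. s z) \<le> e / 2 * m (B \<delta>)"
      proof -
        have "t * ?c * (LINT z:B \<delta>|lborel. s z) \<le> \<bar>t * ?c\<bar> * \<bar>LINT z:B \<delta>|lborel. s z\<bar>"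
          using abs_ge_self[of "t * ?c * (LINT z:B \<delta>|lborel. s z)"] by (simp only: abs_mult)
        also have "\<dots> \<le> 1 * (e / 2 * m (B \<delta>))"
        proof (rule mult_mono)
          have "(1::real) \<le> 2 ^ Suc n" by (rule one_le_power) simp
          then show "\<bar>t * ?c\<bar> \<le> 1" using t by (auto simp: divide_le_eq_1)
        qed (use elim(2) int_s in auto)
        finally show ?thesis by simp
      qed
      moreover have "(L + e / 2) * m (B \<delta>) + e / 2 * m (B \<delta>) = (L + e) * m (B \<delta>)"
        by (simp add: algebra_simps)
      ultimately show ?case using elim(1) by linarith
    qed
  qed
  have fin: "finite (f ` \<Omega>)" if "\<And>z. f z \<in> {- 1, 0, 1}" for f :: "'a \<Rightarrow> real"
    by (rule finite_subset[of _ "{- 1, 0, 1}"]) (use that in auto)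
  have s_step: "step_function \<Omega> s"
    by (rule step_functionI[OF s_meas fin]) (auto simp: s_val)
  have h_step: "step_function \<Omega> h"
  proof (rule step_functionI[OF Suc.prems(1)])
    have "h z \<in> (\<lambda>j. real j / 2 ^ Suc n) ` {..2 ^ Suc n}" for z using Suc.prems(2)[of z] by auto
    then have "h ` \<Omega> \<subseteq> (\<lambda>j. real j / 2 ^ Suc n) ` {..2 ^ Suc n}" by (rule image_subsetI)
    then show "finite (h ` \<Omega>)" by (rule finite_subset) simp
  qed
  have split: "step_integral \<Omega> \<mu> (\<lambda>z. h z + b * s z) = step_integral \<Omega> \<mu> h + b * step_integral \<Omega> \<mu> s" for b
    using step_integral_add[OF h_step step_function_binary[OF s_step s_step, of "\<lambda>a _. b * a"]]
      step_integral_cmult[OF s_step, of b] by simp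
  \<comment> \<open>The charge is not yet known to halve \<open>A\<close>, so the integral of
    \<open>s\<close> is unknown at this point. It enters the two inequalities with opposite signs
    and cancels in their mean.\<close>
  from I[of 1] I[of "-1"] show ?case
    unfolding split by simp
qed

lemma charge_eq_0:
  assumes "A \<in> borel_subsets \<Omega>" "\<forall>\<^sub>F \<delta> in at_right 0. m (A \<inter> B \<delta>) = 0"
  shows "\<mu> A = 0"
proof -
  have "\<mu> A \<le> 0"
  proof (rule upper[OF assms(1)])
    fix e :: real assume "e > 0"
    with assms(2) show "\<forall>\<^sub>F \<delta> in at_right 0. m (A \<inter> B \<delta>) \<le> (0 + e) * m (B \<delta>)"
      by (auto elim: eventually_mono)
  qed
  then show ?thesis using nonneg[OF assms(1)] by linarith
qed

text \<open>Scale g' to p with values in [0,1] and round p down to multiples of 2^(-k). The dyadic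
  bound, applied to the rounded function and to its complement, places its step integral within
  2^(-k) of the limit. Scaled back, the rounded functions are uniformly close to g off a set of
  charge 0; g need agree with the bounded Borel function g' only almost everywhere in one
  tube.\<close>

lemma fa_integral_eq_limit:
  fixes g g' :: "'a \<Rightarrow> real"
  assumes g': "g' \<in> borel_measurable borel" "\<And>z. \<bar>g' z\<bar> \<le> M"
    and N: "N \<in> sets borel" "emeasure lborel N = 0" "\<And>z. z \<in> B d0 - N \<Longrightarrow> g z = g' z"
    and lim: "((\<lambda>\<delta>. (LINT z:B \<delta>|lborel. g' z) / m (B \<delta>)) \<longlongrightarrow> \<Delta>) (at_right 0)"
  shows "fa_integrable \<Omega> \<mu> g \<and> fa_integral \<Omega> \<mu> g = \<Delta>"
proof -
  define C where "C = \<bar>M\<bar> + 1"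
  have C: "C > 0" "\<bar>g' z\<bar> \<le> C" for z using g'(2)[of z] by (auto simp: C_def)
  define p where "p z = (g' z + C) / (2 * C)" for z
  have p: "0 \<le> p z" "p z \<le> 1" for z using C(1) C(2)[of z] by (auto simp: p_def abs_le_iff)
  have p_meas [measurable]: "p \<in> borel_measurable borel" unfolding p_def[abs_def] using g'(1) by measurable
  define q where "q = (\<Delta> + C) / (2 * C)"
  define d where "d k z = real_of_int \<lfloor>2 ^ k * p z\<rfloor> / 2 ^ k" for k :: nat and z
  have d_meas [measurable]: "d k \<in> borel_measurable borel" for k unfolding d_def[abs_def] by measurable
  have dj: "\<exists>j::nat. j \<le> 2 ^ k \<and> d k z = real j / 2 ^ k" for k z
  proof (intro exI[of _ "nat \<lfloor>2 ^ k * p z\<rfloor>"] conjI)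
    have "2 ^ k * p z \<le> 2 ^ k" using p(2)[of z] by (simp add: mult_left_le)
    then have "\<lfloor>2 ^ k * p z\<rfloor> \<le> \<lfloor>2 ^ k :: real\<rfloor>" by (rule floor_mono)
    also have "\<lfloor>2 ^ k :: real\<rfloor> = 2 ^ k" by (metis floor_of_int of_int_numeral of_int_power)
    finally show "nat \<lfloor>2 ^ k * p z\<rfloor> \<le> 2 ^ k" by (simp add: nat_le_iff)
    show "d k z = real (nat \<lfloor>2 ^ k * p z\<rfloor>) / 2 ^ k" using p(1)[of z] by (simp add: d_def)
  qed
  have dp: "d k z \<le> p z" "p z \<le> d k z + 1 / 2 ^ k" for k z
  proof -
    have "real_of_int \<lfloor>2 ^ k * p z\<rfloor> \<le> 2 ^ k * p z" by (rule of_int_floor_le)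
    then show "d k z \<le> p z" by (simp add: d_def pos_divide_le_eq mult.commute)
    have "2 ^ k * p z \<le> real_of_int \<lfloor>2 ^ k * p z\<rfloor> + 1" by linarith
    then have "p z \<le> (real_of_int \<lfloor>2 ^ k * p z\<rfloor> + 1) / 2 ^ k" by (simp add: pos_le_divide_eq mult.commute)
    then show "p z \<le> d k z + 1 / 2 ^ k" by (simp add: d_def add_divide_distrib)
  qed
  have d01: "0 \<le> d k z" "d k z \<le> 1" for k z
    using dj[of k z] order_trans[OF dp(1) p(2)] by auto
  have dint: "set_integrable lborel (B \<delta>) (d k)" for \<delta> k
    by (rule set_integrable_bounded_B[OF d_meas, where M=1]) (use d01 in \<open>simp add: abs_le_iff\<close>)
  have pint: "set_integrable lborel (B \<delta>) p" for \<delta>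
    by (rule set_integrable_bounded_B[OF p_meas, where M=1]) (use p in \<open>simp add: abs_le_iff\<close>)
  have const: "(LINT z:B \<delta>|lborel. a) = a * m (B \<delta>)" for a \<delta>
    using B_borel finite_lborel_bounded[OF B_bounded[of \<delta>]] by (subst set_integral_const) auto
  have ci: "set_integrable lborel (B \<delta>) (\<lambda>_. a :: real)" for a \<delta>
    by (rule set_integrable_bounded_B[where M="\<bar>a\<bar>"]) auto
  have int_p: "(LINT z:B \<delta>|lborel. p z) = ((LINT z:B \<delta>|lborel. g' z) / m (B \<delta>) + C) / (2 * C) * m (B \<delta>)" if "\<delta> > 0" for \<delta>
  proof -
    have "(LINT z:B \<delta>|lborel. p z) = ((LINT z:B \<delta>|lborel. g' z) + C * m (B \<delta>)) / (2 * C)"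
      unfolding p_def using set_integrable_bounded_B[OF g', of \<delta>] ci
      by (simp add: const)
    moreover have "(X + C * b) / (2 * C) = (X / b + C) / (2 * C) * b" if "b > 0" for X b
      using that by (simp add: distrib_right)
    ultimately show ?thesis using B_pos[OF that] by simp
  qed
  have limp: "((\<lambda>\<delta>. ((LINT z:B \<delta>|lborel. g' z) / m (B \<delta>) + C) / (2 * C)) \<longlongrightarrow> q) (at_right 0)"
    unfolding q_def using C(1) by (intro tendsto_intros lim) auto
  have up: "\<forall>\<^sub>F \<delta> in at_right 0. (LINT z:B \<delta>|lborel. p z) \<le> (q + e) * m (B \<delta>)"
    and low: "\<forall>\<^sub>F \<delta> in at_right 0. (q - e) * m (B \<delta>) \<le> (LINT z:B \<delta>|lborel. p z)" if e: "e > 0" for e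
  proof -
    have 1: "\<forall>\<^sub>F \<delta> in at_right 0. ((LINT z:B \<delta>|lborel. g' z) / m (B \<delta>) + C) / (2 * C) < q + e"
      and 2: "\<forall>\<^sub>F \<delta> in at_right 0. q - e < ((LINT z:B \<delta>|lborel. g' z) / m (B \<delta>) + C) / (2 * C)"
      using e by (intro order_tendstoD[OF limp]; simp)+
    show "\<forall>\<^sub>F \<delta> in at_right 0. (LINT z:B \<delta>|lborel. p z) \<le> (q + e) * m (B \<delta>)"
      using 1 eventually_at_right_less[of 0]
      by eventually_elim (simp only: int_p, rule mult_right_mono, auto)
    show "\<forall>\<^sub>F \<delta> in at_right 0. (q - e) * m (B \<delta>) \<le> (LINT z:B \<delta>|lborel. p z)"
      using 2 eventually_at_right_less[of 0]
      by eventually_elim (simp only: int_p, rule mult_right_mono, auto)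
  qed
  have d_step: "step_function \<Omega> (d k)" for k
  proof (rule step_functionI[OF d_meas])
    have "d k z \<in> (\<lambda>j. real j / 2 ^ k) ` {..2 ^ k}" for z using dj[of k z] by auto
    then have "d k ` \<Omega> \<subseteq> (\<lambda>j. real j / 2 ^ k) ` {..2 ^ k}" by (rule image_subsetI)
    then show "finite (d k ` \<Omega>)" by (rule finite_subset) simp
  qed
  have I_le: "step_integral \<Omega> \<mu> (d k) \<le> q" for k
  proof (rule step_integral_dyadic_le[OF d_meas dj])
    fix e :: real assume "e > 0"
    from up[OF this] show "\<forall>\<^sub>F \<delta> in at_right 0. (LINT z:B \<delta>|lborel. d k z) \<le> (q + e) * m (B \<delta>)"
    proof eventually_elim
      case (elim \<delta>)
      have "(LINT z:B \<delta>|lborel. d k z) \<le> (LINT z:B \<delta>|lborel. p z)"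
        by (rule set_integral_mono[OF dint pint dp(1)])
      with elim show ?case by linarith
    qed
  qed
  \<comment> \<open>The lower bound is an upper bound for 1 - d k, which is again dyadic with the
    same denominator; 2^(-k) is the loss from rounding p down.\<close>
  have I_ge: "q - 1 / 2 ^ k \<le> step_integral \<Omega> \<mu> (d k)" for k
  proof -
    have "step_integral \<Omega> \<mu> (\<lambda>z. 1 - d k z) \<le> 1 - q + 1 / 2 ^ k"
    proof (rule step_integral_dyadic_le)
      show "(\<lambda>z. 1 - d k z) \<in> borel_measurable borel" by measurable
      show "\<exists>j::nat. j \<le> 2 ^ k \<and> 1 - d k z = real j / 2 ^ k" for z
      proof -
        obtain j :: nat where "j \<le> 2 ^ k" "d k z = real j / 2 ^ k" using dj by blast
        then show ?thesis by (intro exI[of _ "2 ^ k - j"]) (auto simp: of_nat_diff diff_divide_distrib)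
      qed
      fix e :: real assume "e > 0"
      from low[OF this] show "\<forall>\<^sub>F \<delta> in at_right 0. (LINT z:B \<delta>|lborel. 1 - d k z) \<le> (1 - q + 1 / 2 ^ k + e) * m (B \<delta>)"
      proof eventually_elim
        case (elim \<delta>)
        have "(LINT z:B \<delta>|lborel. 1 - d k z) \<le> (LINT z:B \<delta>|lborel. (1 + 1 / 2 ^ k) - p z)"
        proof (rule set_integral_mono)
          show "set_integrable lborel (B \<delta>) (\<lambda>z. 1 - d k z)"
            by (intro set_integral_diff ci dint)
          show "set_integrable lborel (B \<delta>) (\<lambda>z. (1 + 1 / 2 ^ k) - p z)" by (intro set_integral_diff ci pint)
          show "1 - d k z \<le> (1 + 1 / 2 ^ k) - p z" for z using dp(2)[of z k] by linarith
        qed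
        also have "\<dots> = (1 + 1 / 2 ^ k) * m (B \<delta>) - (LINT z:B \<delta>|lborel. p z)"
          by (subst set_integral_diff(2)[OF ci pint]) (simp add: const)
        finally show ?case using elim by (simp add: algebra_simps)
      qed
    qed
    then show ?thesis
      using step_integral_diff[OF step_function_const[of 1] d_step[of k]] by (simp add: step_integral_const total)
  qed
  define h where "h k z = - C + 2 * C * d k z" for k z
  have hg: "\<bar>h k z - g' z\<bar> \<le> 2 * C / 2 ^ k" for k z
  proof -
    have "g' z = - C + 2 * C * p z" using C(1) by (simp add: p_def)
    then have "h k z - g' z = 2 * C * (d k z - p z)" by (simp add: h_def algebra_simps)
    then have "\<bar>h k z - g' z\<bar> = 2 * C * \<bar>d k z - p z\<bar>" using C(1) by (simp add: abs_mult)
    also have "\<dots> \<le> 2 * C * (1 / 2 ^ k)" using dp(1)[of k z] dp(2)[of z k] C(1) by (intro mult_left_mono) (auto simp: abs_le_iff)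
    finally show ?thesis by simp
  qed
  have h_step: "step_function \<Omega> (h k)" for k
    using step_function_binary[OF d_step[of k] d_step[of k], of "\<lambda>a _. - C + 2 * C * a"] by (simp add: h_def[abs_def])
  have Ih: "step_integral \<Omega> \<mu> (h k) = - C + 2 * C * step_integral \<Omega> \<mu> (d k)" for k
    using step_integral_add[OF step_function_const[of "- C"] step_function_binary[OF d_step[of k] d_step[of k], of "\<lambda>a _. 2 * C * a"]]
      step_integral_cmult[OF d_step[of k], of "2 * C"] by (simp add: h_def[abs_def] step_integral_const total)
  have p2: "(\<lambda>k. 1 / 2 ^ k :: real) \<longlonglongrightarrow> 0"
    using LIMSEQ_realpow_zero[of "1 / 2 :: real"] by (simp add: power_one_over)
  have "(\<lambda>k. step_integral \<Omega> \<mu> (d k)) \<longlonglongrightarrow> q"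
  proof (rule tendsto_sandwich)
    show "(\<lambda>k. q - 1 / 2 ^ k) \<longlonglongrightarrow> q" using tendsto_diff[OF tendsto_const p2, of q] by simp
    show "(\<lambda>k. q) \<longlonglongrightarrow> q" by simp
  qed (use I_le I_ge in auto)
  then have "(\<lambda>k. - C + 2 * C * step_integral \<Omega> \<mu> (d k)) \<longlonglongrightarrow> - C + 2 * C * q"
    by (intro tendsto_intros)
  then have lim_h: "(\<lambda>k. step_integral \<Omega> \<mu> (h k)) \<longlonglongrightarrow> \<Delta>"
    using C(1) by (simp add: Ih q_def)
  have small: "\<exists>K. \<forall>k\<ge>K. 2 * C / 2 ^ k < \<epsilon>" if "\<epsilon> > 0" for \<epsilon>
  proof -
    have "(\<lambda>k. 2 * C * (1 / 2 ^ k)) \<longlonglongrightarrow> 2 * C * 0" by (intro tendsto_intros p2)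
    then have "\<forall>\<^sub>F k in sequentially. 2 * C / 2 ^ k < \<epsilon>" using that by (intro order_tendstoD) auto
    then show ?thesis by (simp add: eventually_sequentially)
  qed
  have "approximates \<Omega> \<mu> h g"
    unfolding approximates_def
  proof (intro conjI allI impI h_step)
    fix \<epsilon> :: real assume "\<epsilon> > 0"
    then obtain K where K: "\<And>k. k \<ge> K \<Longrightarrow> 2 * C / 2 ^ k < \<epsilon>" using small by blast
    \<comment> \<open>Outside this set g = g'. Both parts have charge 0: \<open>N\<close> is null,
      and the complement of a tube misses all smaller tubes.\<close>
    let ?E = "(N \<inter> \<Omega>) \<union> (\<Omega> - B d0)"
    have E: "N \<inter> \<Omega> \<in> borel_subsets \<Omega>" "\<Omega> - B d0 \<in> borel_subsets \<Omega>"
      using N(1) \<Omega>_borel B_borel by (auto simp: borel_subsets_def)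
    have "\<mu> (N \<inter> \<Omega>) = 0"
    proof (rule charge_eq_0[OF E(1)], intro always_eventually allI)
      fix \<delta>
      have "emeasure lborel (N \<inter> \<Omega> \<inter> B \<delta>) \<le> emeasure lborel N" using N(1) by (intro emeasure_mono) auto
      then show "m (N \<inter> \<Omega> \<inter> B \<delta>) = 0" using N(2) by (simp add: measure_def)
    qed
    moreover have "\<mu> (\<Omega> - B d0) = 0"
    proof (rule charge_eq_0[OF E(2)])
      show "\<forall>\<^sub>F \<delta> in at_right 0. m ((\<Omega> - B d0) \<inter> B \<delta>) = 0"
        using eventually_at_right_real[OF d0]
      proof eventually_elim
        case (elim \<delta>)
        then have "(\<Omega> - B d0) \<inter> B \<delta> = {}" using B_mono[of \<delta> d0] by auto
        then show ?case by simp
      qed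
    qed
    ultimately have E0: "\<mu> ?E \<le> 0" using subadditive[OF E] by simp
    have E': "?E \<in> borel_subsets \<Omega>" using E by (auto simp: borel_subsets_def)
    have "outer \<Omega> \<mu> {z \<in> \<Omega>. \<bar>h k z - g z\<bar> > \<epsilon>} = 0" if "k \<ge> K" for k
    proof -
      have "{z \<in> \<Omega>. \<bar>h k z - g z\<bar> > \<epsilon>} \<subseteq> ?E"
      proof
        fix z assume z: "z \<in> {z \<in> \<Omega>. \<bar>h k z - g z\<bar> > \<epsilon>}"
        show "z \<in> ?E"
        proof (rule ccontr)
          assume "z \<notin> ?E"
          then have "g z = g' z" using z N(3) by auto
          then show False using z hg[of k z] K[OF that] by auto
        qed
      qed
      from outer_le[OF this E'] E0 outer_nonneg[of "{z \<in> \<Omega>. \<bar>h k z - g z\<bar> > \<epsilon>}"]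
      show ?thesis by auto
    qed
    then show "(\<lambda>k. outer \<Omega> \<mu> {z \<in> \<Omega>. \<bar>h k z - g z\<bar> > \<epsilon>}) \<longlonglongrightarrow> 0"
      by (intro tendsto_eventually) (auto simp: eventually_sequentially)
  next
    fix \<epsilon> :: real assume \<epsilon>: "\<epsilon> > 0"
    then obtain K where K: "\<And>k. k \<ge> K \<Longrightarrow> 2 * C / 2 ^ k < \<epsilon> / 2" using small[of "\<epsilon> / 2"] by auto
    show "\<exists>N. \<forall>k\<ge>N. \<forall>l\<ge>N. step_integral \<Omega> \<mu> (\<lambda>z. \<bar>h k z - h l z\<bar>) < \<epsilon>"
    proof (intro exI[of _ K] allI impI)
      fix k l assume kl: "K \<le> k" "K \<le> l"
      let ?c = "2 * C / 2 ^ k + 2 * C / 2 ^ l"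
      have "step_integral \<Omega> \<mu> (\<lambda>z. \<bar>h k z - h l z\<bar>) \<le> step_integral \<Omega> \<mu> (\<lambda>_. ?c)"
      proof (rule step_integral_mono)
        show "step_function \<Omega> (\<lambda>z. \<bar>h k z - h l z\<bar>)"
          using step_function_binary[OF h_step[of k] h_step[of l], of "\<lambda>a b. \<bar>a - b\<bar>"] .
        show "\<bar>h k z - h l z\<bar> \<le> ?c" for z using hg[of k z] hg[of l z] by linarith
      qed (rule step_function_const)
      also have "\<dots> < \<epsilon>" using K[OF kl(1)] K[OF kl(2)] by (simp add: step_integral_const total)
      finally show "step_integral \<Omega> \<mu> (\<lambda>z. \<bar>h k z - h l z\<bar>) < \<epsilon>" .
    qed
  qed
  then show ?thesis using fa_integral_eqI[OF _ lim_h] by (auto simp: fa_integrable_def)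
qed

end

section \<open>Averages over tubes\<close>

lemma mem_nbhd: "z \<in> nbhd C \<delta> \<longleftrightarrow> (\<exists>c\<in>C. dist c z < \<delta>)"
  by (auto simp: nbhd_def)

lemma open_nbhd: "open (nbhd C \<delta>)"
  by (auto simp: nbhd_def)

lemma borel_nbhd: "nbhd C \<delta> \<in> sets borel"
  by (rule borel_open[OF open_nbhd])

lemma nbhd_mono: "\<delta> \<le> \<delta>' \<Longrightarrow> nbhd C \<delta> \<subseteq> nbhd C \<delta>'"
  unfolding nbhd_def by (intro UN_mono subset_refl subset_ball)

lemma bounded_nbhd:
  fixes C :: "'a::real_normed_vector set"
  assumes "bounded C" shows "bounded (nbhd C \<delta>)"
proof -
  obtain K where K: "\<And>c. c \<in> C \<Longrightarrow> norm c \<le> K" using assms unfolding bounded_iff by blast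
  have "norm z \<le> K + \<delta>" if z: "z \<in> nbhd C \<delta>" for z
  proof -
    obtain c where c: "c \<in> C" "dist c z < \<delta>" using z by (auto simp: mem_nbhd)
    then show ?thesis using K[OF c(1)] norm_triangle_sub[of z c] by (simp add: dist_norm norm_minus_commute)
  qed
  then show ?thesis unfolding bounded_iff by blast
qed

lemma ball_subset_nbhd: "z \<in> nbhd C \<delta> \<Longrightarrow> ball z \<epsilon> \<subseteq> nbhd C (\<delta> + \<epsilon>)"
proof
  fix w assume z: "z \<in> nbhd C \<delta>" and w: "w \<in> ball z \<epsilon>"
  obtain c where c: "c \<in> C" "dist c z < \<delta>" using z by (auto simp: mem_nbhd)
  have "dist c w < \<delta> + \<epsilon>" using dist_triangle[of c w z] c(2) w by auto
  then show "w \<in> nbhd C (\<delta> + \<epsilon>)" using c(1) by (auto simp: mem_nbhd)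
qed

lemma measure_nbhd_pos:
  fixes C :: "'a::euclidean_space set"
  assumes "bounded C" "C \<noteq> {}" "\<delta> > 0"
  shows "measure lborel (nbhd C \<delta>) > 0"
proof -
  obtain c where c: "c \<in> C" using assms(2) by blast
  have "0 < measure lborel (ball c \<delta>)" using assms(3) content_ball_pos by blast
  also have "\<dots> \<le> measure lborel (nbhd C \<delta>)"
    using c by (intro measure_lborel_mono_bounded borel_nbhd bounded_nbhd assms) (auto simp: nbhd_def)
  finally show ?thesis .
qed

text \<open>Scale about a point of \<open>C\<close>; convexity keeps the shrunken copy of \<open>C\<close> inside \<open>C\<close>.\<close>

lemma measure_nbhd_scale:
  fixes C :: "'a::euclidean_space set"
  assumes C: "convex C" "bounded C" "C \<noteq> {}" and \<delta>: "0 < \<delta>" "1 \<le> c"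
  shows "measure lborel (nbhd C (c * \<delta>)) \<le> c ^ DIM('a) * measure lborel (nbhd C \<delta>)"
proof -
  obtain p where p: "p \<in> C" using C(3) by blast
  let ?T = "\<lambda>z. c *\<^sub>R z + (1 - c) *\<^sub>R p"
  have "nbhd C (c * \<delta>) \<subseteq> ?T ` nbhd C \<delta>"
  proof
    fix w assume "w \<in> nbhd C (c * \<delta>)"
    then obtain q where q: "q \<in> C" "dist q w < c * \<delta>" by (auto simp: mem_nbhd)
    define z where "z = p + (1/c) *\<^sub>R (w - p)"
    have wz: "w = ?T z" using \<delta> by (simp add: z_def algebra_simps)
    have "(1 - 1/c) *\<^sub>R p + (1/c) *\<^sub>R q \<in> C"
      using C(1) p q(1) \<delta> by (intro convexD) auto
    moreover have "dist ((1 - 1/c) *\<^sub>R p + (1/c) *\<^sub>R q) z = dist q w / c"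
    proof -
      have "(1 - 1/c) *\<^sub>R p + (1/c) *\<^sub>R q - z = (1/c) *\<^sub>R (q - w)" by (simp add: z_def algebra_simps)
      then show ?thesis using \<delta> by (simp add: dist_norm)
    qed
    moreover have "dist q w / c < \<delta>" using q(2) \<delta> by (simp add: pos_divide_less_eq mult.commute)
    ultimately have "z \<in> nbhd C \<delta>"
      unfolding mem_nbhd by (intro bexI[of _ "(1 - 1/c) *\<^sub>R p + (1/c) *\<^sub>R q"]) simp_all
    then show "w \<in> ?T ` nbhd C \<delta>" using wz by blast
  qed
  moreover have "?T ` nbhd C \<delta> \<in> lmeasurable"
  proof -
    have "bounded (?T ` nbhd C \<delta>)"
    proof -
      have "bounded ((\<lambda>z. (1 - c) *\<^sub>R p + z) ` ((\<lambda>z. c *\<^sub>R z) ` nbhd C \<delta>))"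
        by (intro bounded_translation bounded_scaling bounded_nbhd C)
      then show ?thesis by (simp add: image_image add.commute)
    qed
    moreover have "open (?T ` nbhd C \<delta>)"
    proof -
      have "open ((\<lambda>z. (1 - c) *\<^sub>R p + z) ` ((\<lambda>z. c *\<^sub>R z) ` nbhd C \<delta>))"
        using \<delta> by (intro open_translation open_scaling open_nbhd) auto
      then show ?thesis by (simp add: image_image add.commute)
    qed
    ultimately show ?thesis by (rule lmeasurable_open)
  qed
  ultimately have "measure lebesgue (nbhd C (c * \<delta>)) \<le> measure lebesgue (?T ` nbhd C \<delta>)"
    using borel_nbhd[of C "c * \<delta>"] by (intro measure_mono_fmeasurable) auto
  also have "\<dots> = c ^ DIM('a) * measure lebesgue (nbhd C \<delta>)"
    using measure_lebesgue_affine[of c "(1 - c) *\<^sub>R p" "nbhd C \<delta>"] \<delta> by simp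
  finally show ?thesis using borel_nbhd[of C "c * \<delta>"] borel_nbhd[of C \<delta>] by simp
qed

text \<open>The tubes have finite measure and decrease to \<open>C\<close>, since \<open>C\<close>
  is closed; the measure is continuous from above.\<close>

lemma measure_nbhd_null:
  fixes C :: "'a::euclidean_space set"
  assumes C: "compact C" "C \<noteq> {}" "negligible C" and d: "d > 0"
  shows "(\<lambda>k. measure lborel (nbhd C (d / real (Suc k)))) \<longlonglongrightarrow> 0"
proof -
  let ?A = "\<lambda>k. nbhd C (d / real (Suc k))"
  have "(\<lambda>k. measure lborel (?A k)) \<longlonglongrightarrow> measure lborel (\<Inter>k. ?A k)"
  proof (rule Lim_measure_decseq)
    show "range ?A \<subseteq> sets lborel" using borel_nbhd by auto
    show "decseq ?A" unfolding decseq_def using d by (intro allI impI nbhd_mono) (simp add: frac_le)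
    show "emeasure lborel (?A k) \<noteq> \<infinity>" for k
      by (intro finite_lborel_bounded bounded_nbhd compact_imp_bounded C)
  qed
  moreover have "(\<Inter>k. ?A k) = C"
  proof
    have "z \<in> ?A k" if "z \<in> C" for z k
      unfolding mem_nbhd using d that by (intro bexI[of _ z]) simp_all
    then show "C \<subseteq> (\<Inter>k. ?A k)" by blast
    show "(\<Inter>k. ?A k) \<subseteq> C"
    proof
      fix z assume z: "z \<in> (\<Inter>k. ?A k)"
      have "infdist z C \<le> 0"
      proof (rule field_le_epsilon)
        fix e :: real assume "e > 0"
        then have "e / d > 0" using d by simp
        then obtain k :: nat where k: "1 / real (Suc k) < e / d" using nat_approx_posE by metis
        have "z \<in> ?A k" using z by blast
        then obtain c where c: "c \<in> C" "dist c z < d / real (Suc k)" by (auto simp: mem_nbhd)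
        have "d / real (Suc k) < e" using k d by (simp add: field_simps)
        moreover have "infdist z C \<le> dist z c" by (rule infdist_le[OF c(1)])
        ultimately show "infdist z C \<le> 0 + e" using c(2) by (simp add: dist_commute)
      qed
      then have "infdist z C = 0" using infdist_nonneg[of z C] by linarith
      then show "z \<in> C" using in_closed_iff_infdist_zero[of C z] C(1,2) compact_imp_closed by auto
    qed
  qed
  moreover have "measure lborel C = 0"
    using negligible_imp_measure0[OF C(3)] C(1) by (simp add: borel_compact)
  ultimately show ?thesis by simp
qed

text \<open>A translate of the segment spans at most a line, a proper subspace in dimension at least
  two.\<close>

lemma negligible_closed_segment:
  fixes x y :: "'a::euclidean_space"
  assumes "DIM('a) \<ge> 2"
  shows "negligible (closed_segment x y)"
proof -
  have "closed_segment 0 (y - x) \<subseteq> span {y - x}"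
    by (auto simp: closed_segment_def span_singleton)
  then have "dim (closed_segment 0 (y - x)) \<le> card {y - x}"
    by (intro dim_le_card) auto
  then have "negligible (closed_segment 0 (y - x))"
    using assms by (intro negligible_lowdim) simp
  then have "negligible ((+) x ` closed_segment 0 (y - x))" by (rule negligible_translation)
  then show ?thesis using closed_segment_translation[of x 0 "y - x"] by simp
qed

text \<open>\<open>T\<close> is \<open>S\<close> translated by \<open>a\<close>. The shifted
  integral over \<open>S\<close> is an integral over \<open>T\<close>, and the part common to
  \<open>S\<close> and \<open>T\<close> cancels; translation invariance also makes the two
  remainders equal in measure.\<close>

lemma set_integral_shift_diff:
  fixes f :: "'a::euclidean_space \<Rightarrow> real"
  assumes S: "S \<in> sets borel" "bounded S" and f: "f \<in> borel_measurable borel"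
    and bd: "\<And>z. z \<in> S \<Longrightarrow> \<bar>f z\<bar> \<le> K" "\<And>z. z \<in> S \<Longrightarrow> \<bar>f (z + a)\<bar> \<le> K"
  defines "T \<equiv> {z. z - a \<in> S}"
  shows "(LINT z:S|lborel. f (z + a) - f z) = (LINT z:T - S|lborel. f z) - (LINT z:S - T|lborel. f z)"
    and "measure lborel (T - S) = measure lborel (S - T)"
    and "T \<in> sets borel" and "bounded T"
    and "set_integrable lborel S (\<lambda>z. f (z + a))" and "set_integrable lborel S f" and "set_integrable lborel T f"
proof -
  have T: "T = (+) a ` S" by (auto simp: T_def image_iff intro!: bexI[of _ "_ - a"])
  show bT: "bounded T" unfolding T by (rule bounded_translation[OF S(2)])
  have "(\<lambda>z. z - a) -` S \<inter> space borel \<in> sets borel"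
    by (rule measurable_sets[OF _ S(1)]) simp
  then show Tb: "T \<in> sets borel" by (simp add: T_def vimage_def)
  have int: "set_integrable lborel X h" if "X \<in> sets borel" "bounded X" "h \<in> borel_measurable borel" "\<And>z. z \<in> X \<Longrightarrow> \<bar>h z\<bar> \<le> K" for X and h :: "'a \<Rightarrow> real"
    unfolding set_integrable_def using that finite_lborel_bounded[OF that(2)]
    by (intro integrableI_bounded_set_indicator[where B=K]) (auto simp: less_top)
  have fa: "(\<lambda>z. f (z + a)) \<in> borel_measurable borel" using f by measurable
  show i1: "set_integrable lborel S (\<lambda>z. f (z + a))" by (rule int[OF S fa bd(2)])
  show i2: "set_integrable lborel S f" by (rule int[OF S f bd(1)])
  show i3: "set_integrable lborel T f"
  proof (rule int[OF Tb bT f])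
    fix z assume "z \<in> T" then show "\<bar>f z\<bar> \<le> K" using bd(2)[of "z - a"] by (simp add: T_def)
  qed
  have tr: "(LINT z|lborel. h (z + a)) = (LINT z|lborel. h z)" if "h \<in> borel_measurable borel" for h :: "'a \<Rightarrow> real"
  proof -
    have "(LINT z|lborel. h z) = (LINT z|distr lborel borel ((+) a). h z)" by (simp add: lborel_distr_plus)
    also have "\<dots> = (LINT z|lborel. h (a + z))" using that by (subst integral_distr) auto
    finally show ?thesis by (simp add: add.commute)
  qed
  have e1: "(LINT z:S|lborel. f (z + a)) = (LINT z:T|lborel. f z)"
  proof -
    have "(\<lambda>z. indicator T z *\<^sub>R f z) \<in> borel_measurable borel" using Tb f by measurable
    from tr[OF this] show ?thesis by (simp add: set_lebesgue_integral_def T_def indicator_def)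
  qed
  have dec: "(LINT z:X|lborel. f z) = (LINT z:X - Y|lborel. f z) + (LINT z:X \<inter> Y|lborel. f z)"
    if "X \<in> sets borel" "Y \<in> sets borel" "set_integrable lborel X f" for X Y
  proof -
    have "(LINT z:(X - Y) \<union> (X \<inter> Y)|lborel. f z) = (LINT z:X - Y|lborel. f z) + (LINT z:X \<inter> Y|lborel. f z)"
      by (rule set_integral_Un) (use that in \<open>auto intro: set_integrable_subset\<close>)
    moreover have "(X - Y) \<union> (X \<inter> Y) = X" by blast
    ultimately show ?thesis by simp
  qed
  have "(LINT z:S|lborel. f (z + a) - f z) = (LINT z:S|lborel. f (z + a)) - (LINT z:S|lborel. f z)"
    by (rule set_integral_diff(2)[OF i1 i2])
  also have "\<dots> = (LINT z:T|lborel. f z) - (LINT z:S|lborel. f z)" by (simp only: e1)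
  also have "\<dots> = (LINT z:T - S|lborel. f z) - (LINT z:S - T|lborel. f z)"
    using dec[OF Tb S(1) i3] dec[OF S(1) Tb i2] by (simp add: Int_commute)
  finally show "(LINT z:S|lborel. f (z + a) - f z) = (LINT z:T - S|lborel. f z) - (LINT z:S - T|lborel. f z)" .
  have "measure lborel T = measure lborel S"
    using measure_translation[of a S] Tb S(1) unfolding T[symmetric] by simp
  moreover have "measure lborel T = measure lborel (T \<inter> S) + measure lborel (T - S)"
    by (rule measure_lborel_split_bounded[OF Tb S(1) bT])
  moreover have "measure lborel S = measure lborel (S \<inter> T) + measure lborel (S - T)"
    by (rule measure_lborel_split_bounded[OF S(1) Tb S(2)])
  ultimately show "measure lborel (T - S) = measure lborel (S - T)" by (simp add: Int_commute)
qed

text \<open>If the point at parameter t is close to the unshifted z, the point at t + s is equally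
  close to z. Since z is outside the tube, t + s exceeds 1, but by at most s, so that point lies
  within s |v| of the end y.\<close>

lemma segment_front:
  fixes x y z :: "'a::real_normed_vector"
  assumes "z - s *\<^sub>R (y - x) \<in> nbhd (closed_segment x y) \<delta>" "z \<notin> nbhd (closed_segment x y) \<delta>" "s \<ge> 0"
  shows "dist z y < \<delta> + s * norm (y - x)"
proof -
  let ?v = "y - x"
  obtain t where t: "0 \<le> t" "t \<le> 1" "dist (x + t *\<^sub>R ?v) (z - s *\<^sub>R ?v) < \<delta>"
  proof -
    obtain c where c: "c \<in> closed_segment x y" "dist c (z - s *\<^sub>R ?v) < \<delta>"
      using assms(1) by (auto simp: mem_nbhd)
    then obtain t where t: "0 \<le> t" "t \<le> 1" "c = (1 - t) *\<^sub>R x + t *\<^sub>R y" by (auto simp: closed_segment_def)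
    then have "c = x + t *\<^sub>R ?v" by (simp add: algebra_simps)
    then show ?thesis using that[of t] t c(2) by simp
  qed
  have e: "dist (x + (t + s) *\<^sub>R ?v) z < \<delta>" using t(3) by (simp add: dist_norm algebra_simps)
  have "t + s > 1"
  proof (rule ccontr)
    assume "\<not> t + s > 1"
    then have "x + (t + s) *\<^sub>R ?v \<in> closed_segment x y"
      using t assms(3) by (auto simp: closed_segment_def algebra_simps intro!: exI[of _ "t + s"])
    then show False using e assms(2) by (auto simp: mem_nbhd)
  qed
  have "dist (x + (t + s) *\<^sub>R ?v) y = (t + s - 1) * norm ?v"
  proof -
    have "x + (t + s) *\<^sub>R ?v - y = (t + s - 1) *\<^sub>R ?v" by (simp add: algebra_simps)
    then show ?thesis using \<open>t + s > 1\<close> by (simp add: dist_norm)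
  qed
  also have "\<dots> \<le> s * norm ?v" using t by (intro mult_right_mono) auto
  finally show ?thesis using e dist_triangle[of z y "x + (t + s) *\<^sub>R ?v"] by (simp add: dist_commute)
qed

text \<open>The mirror image of the previous argument: t - s would be a parameter close to the
  shifted-back point unless t < s, so z is near x.\<close>

lemma segment_back:
  fixes x y z :: "'a::real_normed_vector"
  assumes "z \<in> nbhd (closed_segment x y) \<delta>" "z - s *\<^sub>R (y - x) \<notin> nbhd (closed_segment x y) \<delta>" "s \<ge> 0"
  shows "dist z x < \<delta> + s * norm (y - x)"
proof -
  let ?w = "z - s *\<^sub>R (y - x)"
  have "\<exists>t. 0 \<le> t \<and> t \<le> 1 \<and> dist (x + t *\<^sub>R (y - x)) z < \<delta>"
  proof -
    obtain c where c: "c \<in> closed_segment x y" "dist c z < \<delta>" using assms(1) by (auto simp: mem_nbhd)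
    then obtain t where t: "0 \<le> t" "t \<le> 1" "c = (1 - t) *\<^sub>R x + t *\<^sub>R y" by (auto simp: closed_segment_def)
    then have "c = x + t *\<^sub>R (y - x)" by (simp add: algebra_simps)
    then show ?thesis using t c(2) by (intro exI[of _ t]) simp
  qed
  then obtain t where t: "0 \<le> t" "t \<le> 1" "dist (x + t *\<^sub>R (y - x)) z < \<delta>" by blast
  have "t < s"
  proof (rule ccontr)
    assume "\<not> t < s"
    then have "x + (t - s) *\<^sub>R (y - x) \<in> closed_segment x y"
      using t assms(3) by (auto simp: closed_segment_def algebra_simps intro!: exI[of _ "t - s"])
    moreover have "dist (x + (t - s) *\<^sub>R (y - x)) ?w < \<delta>" using t(3) by (simp add: dist_norm algebra_simps)
    ultimately show False using assms(2) by (auto simp: mem_nbhd)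
  qed
  have "dist (x + t *\<^sub>R (y - x)) x = t * norm (y - x)" using t by (simp add: dist_norm)
  also have "\<dots> \<le> s * norm (y - x)" using \<open>t < s\<close> by (intro mult_right_mono) auto
  finally show ?thesis using t(3) dist_triangle[of z x "x + t *\<^sub>R (y - x)"] by (simp add: dist_commute)
qed

lemma abs_set_integral_le:
  fixes f :: "'a::euclidean_space \<Rightarrow> real"
  assumes "X \<in> sets borel" "bounded X" "\<And>z. z \<in> X \<Longrightarrow> \<bar>f z\<bar> \<le> c"
  shows "\<bar>LINT z:X|lborel. f z\<bar> \<le> c * measure lborel X"
proof -
  have fin: "emeasure lborel X < \<infinity>" using finite_lborel_bounded[OF assms(2)] by (simp add: less_top)
  have "\<bar>LINT z|lborel. indicator X z *\<^sub>R f z\<bar> \<le> (LINT z|lborel. c * indicator X z)"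
  proof (rule abs_integral_le)
    show "integrable lborel (\<lambda>z. c * indicator X z)"
      using assms(1) fin by (intro integrable_mult_right integrable_real_indicator) auto
    show "AE z in lborel. \<bar>indicator X z *\<^sub>R f z\<bar> \<le> c * indicator X z"
      using assms(3) by (auto simp: indicator_def)
  qed
  then show ?thesis using assms(1) by (simp add: set_lebesgue_integral_def)
qed

text \<open>Subtract from \<open>u\<close> the affine function with the same values at \<open>x\<close> and \<open>y\<close>. The shift by
  \<open>s (y - x)\<close> changes the tube only near the two endpoints, where the difference is small; the affine
  function itself measures the size of this change.\<close>

lemma tube_difference_bound:
  fixes u :: "'a::euclidean_space \<Rightarrow> real" and x y :: 'a
  defines "v \<equiv> y - x"
  assumes xy: "x \<noteq> y" and u: "u \<in> borel_measurable borel" and K: "\<And>z. z \<in> nbhd (closed_segment x y) d \<Longrightarrow> \<bar>u z\<bar> \<le> K"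
    and s: "s > 0" and \<delta>: "\<delta> > 0" "\<delta> + s * norm v \<le> \<eta>" "\<eta> \<le> d" "4 * \<eta> \<le> norm v"
    and \<omega>: "\<And>z. dist z x < \<eta> \<Longrightarrow> \<bar>u z - u x - (u y - u x) * ((z - x) \<bullet> v) / (norm v)\<^sup>2\<bar> \<le> \<omega>"
      "\<And>z. dist z y < \<eta> \<Longrightarrow> \<bar>u z - u x - (u y - u x) * ((z - x) \<bullet> v) / (norm v)\<^sup>2\<bar> \<le> \<omega>"
  shows "\<bar>(LINT z:nbhd (closed_segment x y) \<delta>|lborel. u (z + s *\<^sub>R v) - u z)
      - s * (u y - u x) * measure lborel (nbhd (closed_segment x y) \<delta>)\<bar>
    \<le> 4 * \<omega> * s * measure lborel (nbhd (closed_segment x y) \<delta>)"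
proof -
  let ?S = "nbhd (closed_segment x y) \<delta>" and ?\<Delta> = "u y - u x" and ?m = "measure lborel"
  define T where "T = {z. z - s *\<^sub>R v \<in> ?S}"
  have v: "norm v > 0" using xy by (simp add: v_def)
  \<comment> \<open>The normalised coordinate along the segment: 0 at x, 1 at y, and increased by
    exactly s under the shift.\<close>
  define l where "l z = ((z - x) \<bullet> v) / (norm v)\<^sup>2" for z
  define w where "w z = u z - u x - ?\<Delta> * l z" for z
  have S: "?S \<in> sets borel" "bounded ?S" by (simp_all add: borel_nbhd bounded_nbhd compact_imp_bounded)
  have l_meas: "l \<in> borel_measurable borel" unfolding l_def[abs_def] by measurable
  have w_meas: "w \<in> borel_measurable borel" unfolding w_def[abs_def] using u l_meas by measurable
  have lv: "l (z + s *\<^sub>R v) - l z = s" for z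
    using v by (simp add: l_def inner_diff_left inner_add_left flip: diff_divide_distrib)
      (simp add: power2_norm_eq_inner)
  obtain R where R: "\<And>z. z \<in> ?S \<Longrightarrow> norm z \<le> R" using S(2) unfolding bounded_iff by blast
  define Kl where "Kl = (\<bar>R\<bar> + s * norm v + norm x) / norm v"
  have l_bd: "\<bar>l z\<bar> \<le> norm (z - x) / norm v" for z
  proof -
    have "\<bar>(z - x) \<bullet> v\<bar> \<le> norm (z - x) * norm v" by (rule Cauchy_Schwarz_ineq2)
    then have "\<bar>l z\<bar> \<le> norm (z - x) * norm v / (norm v)\<^sup>2" unfolding l_def abs_divide by (simp add: divide_right_mono)
    then show ?thesis using v by (simp add: power2_eq_square)
  qed
  have Kl: "\<bar>l z\<bar> \<le> Kl" "\<bar>l (z + s *\<^sub>R v)\<bar> \<le> Kl" if "z \<in> ?S" for z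
  proof -
    have "norm (z - x) \<le> \<bar>R\<bar> + norm x" using R[OF that] norm_triangle_ineq4[of z x] by linarith
    moreover have "0 \<le> s * norm v" using s by simp
    ultimately have 1: "norm (z - x) \<le> \<bar>R\<bar> + s * norm v + norm x" by linarith
    have "norm (z + s *\<^sub>R v - x) \<le> norm (z - x) + norm (s *\<^sub>R v)"
      using norm_triangle_ineq[of "z - x" "s *\<^sub>R v"] by (simp add: algebra_simps)
    then have 2: "norm (z + s *\<^sub>R v - x) \<le> \<bar>R\<bar> + s * norm v + norm x"
      using \<open>norm (z - x) \<le> \<bar>R\<bar> + norm x\<close> s by simp
    show "\<bar>l z\<bar> \<le> Kl" "\<bar>l (z + s *\<^sub>R v)\<bar> \<le> Kl"
      using order_trans[OF l_bd divide_right_mono[OF 1]] order_trans[OF l_bd divide_right_mono[OF 2]] by (simp_all add: Kl_def)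
  qed
  have in_d: "z \<in> nbhd (closed_segment x y) d" "z + s *\<^sub>R v \<in> nbhd (closed_segment x y) d" if zS: "z \<in> ?S" for z
  proof -
    have "\<delta> \<le> d" using \<delta> s v by (smt (verit) mult_pos_pos)
    then show "z \<in> nbhd (closed_segment x y) d" using zS nbhd_mono by blast
    obtain c where c: "c \<in> closed_segment x y" "dist c z < \<delta>" using zS by (auto simp: mem_nbhd)
    have "dist c (z + s *\<^sub>R v) \<le> dist c z + dist z (z + s *\<^sub>R v)" by (rule dist_triangle)
    also have "dist z (z + s *\<^sub>R v) = s * norm v" using s by (simp add: dist_norm)
    finally have "dist c (z + s *\<^sub>R v) < d" using c(2) \<delta> by linarith
    then show "z + s *\<^sub>R v \<in> nbhd (closed_segment x y) d" using c(1) by (auto simp: mem_nbhd)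
  qed
  define Kw where "Kw = K + \<bar>u x\<bar> + \<bar>?\<Delta>\<bar> * Kl"
  have Kw: "\<bar>w z\<bar> \<le> Kw" "\<bar>w (z + s *\<^sub>R v)\<bar> \<le> Kw" if "z \<in> ?S" for z
  proof -
    have "\<bar>w z'\<bar> \<le> Kw" if "\<bar>u z'\<bar> \<le> K" "\<bar>l z'\<bar> \<le> Kl" for z'
    proof -
      have "\<bar>?\<Delta> * l z'\<bar> \<le> \<bar>?\<Delta>\<bar> * Kl" unfolding abs_mult using that(2) by (intro mult_left_mono) auto
      then show ?thesis unfolding w_def Kw_def using that(1) by linarith
    qed
    then show "\<bar>w z\<bar> \<le> Kw" "\<bar>w (z + s *\<^sub>R v)\<bar> \<le> Kw"
      using K[OF in_d(1)[OF that]] K[OF in_d(2)[OF that]] Kl[OF that] by blast+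
  qed
  note sl = set_integral_shift_diff[OF S l_meas Kl, folded T_def]
  note sw = set_integral_shift_diff[OF S w_meas Kw, folded T_def]
  have front: "dist z y < \<eta>" if "z \<in> T - ?S" for z
    using segment_front[of z s y x \<delta>] that s \<delta>(2) by (auto simp: T_def v_def)
  have back': "dist z x < \<eta>" if "z \<in> ?S - T" for z
    using segment_back[of z x y \<delta> s] that s \<delta>(2) by (auto simp: T_def v_def)
  let ?q = "?m (T - ?S)"
  have meas: "T - ?S \<in> sets borel" "?S - T \<in> sets borel" "bounded (T - ?S)" "bounded (?S - T)"
    using sl(3,4) S by (auto intro: bounded_diff)
  have near: "\<bar>l z - 1\<bar> \<le> 1 / 4" if "dist z y < \<eta>" for z
  proof -
    have "l z - 1 = ((z - x) \<bullet> v - (norm v)\<^sup>2) / (norm v)\<^sup>2" using v by (simp add: l_def diff_divide_distrib)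
    also have "(z - x) \<bullet> v - (norm v)\<^sup>2 = (z - y) \<bullet> v"
      by (simp add: power2_norm_eq_inner v_def inner_diff_left)
    finally have "\<bar>l z - 1\<bar> = \<bar>(z - y) \<bullet> v\<bar> / (norm v)\<^sup>2" by (simp add: abs_divide)
    also have "\<dots> \<le> norm (z - y) * norm v / (norm v)\<^sup>2" by (intro divide_right_mono Cauchy_Schwarz_ineq2) auto
    also have "\<dots> = norm (z - y) / norm v" using v by (simp add: power2_eq_square)
    also have "\<dots> \<le> 1 / 4" using that \<delta>(4) v by (simp add: dist_norm field_simps)
    finally show ?thesis .
  qed
  have near0: "\<bar>l z\<bar> \<le> 1 / 4" if "dist z x < \<eta>" for z
  proof -
    have "norm (z - x) / norm v \<le> 1 / 4" using that \<delta>(4) v by (simp add: dist_norm field_simps)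
    then show ?thesis using l_bd[of z] by linarith
  qed
  \<comment> \<open>The shift identity is tested with \<open>l\<close> itself. The left side is
    exact; on the right \<open>l\<close> is at least 3/4 on the front difference and at most 1/4 on
    the back one, as 4 \<eta> \<le> |v|. So the volume q gained at the front, equal to that lost at
    the back, satisfies q/2 \<le> s m(S), without any computation with the end caps.\<close>
  have "s * ?m ?S = (LINT z:?S|lborel. l (z + s *\<^sub>R v) - l z)"
    unfolding lv using S finite_lborel_bounded[OF S(2)] by (subst set_integral_const) auto
  also have "\<dots> = (LINT z:T - ?S|lborel. l z) - (LINT z:?S - T|lborel. l z)" by (rule sl(1))
  also have "\<dots> \<ge> 3 / 4 * ?q - 1 / 4 * ?q"
  proof (rule diff_mono)
    have i1: "set_integrable lborel (T - ?S) l" by (rule set_integrable_subset[OF sl(7)]) (use meas in auto)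
    have i2: "set_integrable lborel (T - ?S) (\<lambda>_. 3 / 4 :: real)"
      unfolding set_integrable_def using meas finite_lborel_bounded[OF meas(3)] by (simp add: less_top)
    have "(LINT z:T - ?S|lborel. 3 / 4) \<le> (LINT z:T - ?S|lborel. l z)"
    proof (rule set_integral_mono[OF i2 i1])
      fix z assume "z \<in> T - ?S"
      from near[OF front[OF this]] show "3 / 4 \<le> l z" by linarith
    qed
    moreover have "(LINT z:T - ?S|lborel. 3 / 4) = 3 / 4 * ?q"
      using meas finite_lborel_bounded[OF meas(3)] by (subst set_integral_const) auto
    ultimately show "3 / 4 * ?q \<le> (LINT z:T - ?S|lborel. l z)" by simp
    have "\<bar>LINT z:?S - T|lborel. l z\<bar> \<le> 1 / 4 * ?m (?S - T)"
      by (rule abs_set_integral_le[OF meas(2,4)]) (use near0 back' in auto)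
    then show "(LINT z:?S - T|lborel. l z) \<le> 1 / 4 * ?q" using sl(2) by simp
  qed
  finally have q: "?q \<le> 2 * s * ?m ?S" by simp
  have w\<omega>: "\<bar>w z\<bar> \<le> \<omega>" if "dist z x < \<eta> \<or> dist z y < \<eta>" for z
    using that \<omega>[of z] by (auto simp: w_def l_def)
  have "\<omega> \<ge> 0"
  proof -
    have "dist x x < \<eta>" using \<delta> s v by (smt (verit) dist_self mult_pos_pos)
    then show ?thesis using w\<omega>[of x] by force
  qed
  have "\<bar>(LINT z:?S|lborel. w (z + s *\<^sub>R v) - w z)\<bar> \<le> \<omega> * ?q + \<omega> * ?m (?S - T)"
  proof -
    have "\<bar>LINT z:T - ?S|lborel. w z\<bar> \<le> \<omega> * ?q"
      by (rule abs_set_integral_le[OF meas(1,3)]) (use w\<omega> front in auto)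
    moreover have "\<bar>LINT z:?S - T|lborel. w z\<bar> \<le> \<omega> * ?m (?S - T)"
      by (rule abs_set_integral_le[OF meas(2,4)]) (use w\<omega> back' in auto)
    ultimately show ?thesis using sw(1) by linarith
  qed
  also have "\<dots> = 2 * \<omega> * ?q" using sl(2) by simp
  also have "\<dots> \<le> 2 * \<omega> * (2 * s * ?m ?S)" using q \<open>\<omega> \<ge> 0\<close> by (intro mult_left_mono) auto
  finally have main: "\<bar>(LINT z:?S|lborel. w (z + s *\<^sub>R v) - w z)\<bar> \<le> 4 * \<omega> * s * ?m ?S" by simp
  have "u (z + s *\<^sub>R v) - u z = (w (z + s *\<^sub>R v) - w z) + ?\<Delta> * s" for z
  proof -
    have "?\<Delta> * (l (z + s *\<^sub>R v) - l z) = ?\<Delta> * s" using lv by simp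
    then show ?thesis by (simp add: w_def right_diff_distrib)
  qed
  then have "(LINT z:?S|lborel. u (z + s *\<^sub>R v) - u z) = (LINT z:?S|lborel. (w (z + s *\<^sub>R v) - w z) + ?\<Delta> * s)"
    by simp
  also have "\<dots> = (LINT z:?S|lborel. w (z + s *\<^sub>R v) - w z) + (LINT z:?S|lborel. ?\<Delta> * s)"
  proof (rule set_integral_add(2))
    show "set_integrable lborel ?S (\<lambda>z. w (z + s *\<^sub>R v) - w z)" by (rule set_integral_diff(1)[OF sw(5,6)])
    show "set_integrable lborel ?S (\<lambda>_. ?\<Delta> * s)"
      unfolding set_integrable_def using S finite_lborel_bounded[OF S(2)] by (simp add: less_top)
  qed
  also have "(LINT z:?S|lborel. ?\<Delta> * s) = s * ?\<Delta> * ?m ?S"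
    using S finite_lborel_bounded[OF S(2)] by (subst set_integral_const) auto
  finally show ?thesis using main by simp
qed

text \<open>For fixed \<delta> the difference quotients converge to g and are dominated by the
  Lipschitz bound, so \<open>tube_difference_bound\<close>, divided by s, survives the limit s to 0.
  Its error is relative to the volume of the tube, with a factor uniform in small s and \<delta>, so
  \<delta> may tend to 0 afterwards.\<close>

lemma average_tendsto:
  fixes u g :: "'a::euclidean_space \<Rightarrow> real" and x y :: 'a
  defines "v \<equiv> y - x" and "B \<equiv> nbhd (closed_segment x y)"
  assumes xy: "x \<noteq> y" and u: "u \<in> borel_measurable borel" and d: "d > 0"
    and K: "\<And>z. z \<in> B d \<Longrightarrow> \<bar>u z\<bar> \<le> K"
    and cont: "isCont u x" "isCont u y"
    and lip: "s0 > 0" "\<And>z s. z \<in> B (d/2) \<Longrightarrow> 0 < s \<Longrightarrow> s \<le> s0 \<Longrightarrow> \<bar>u (z + s *\<^sub>R v) - u z\<bar> \<le> M * s"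
    and g: "g \<in> borel_measurable borel"
    and diff: "AE z in lborel. z \<in> B (d/2) \<longrightarrow> ((\<lambda>s. (u (z + s *\<^sub>R v) - u z) / s) \<longlongrightarrow> g z) (at_right 0)"
  shows "((\<lambda>\<delta>. (LINT z:B \<delta>|lborel. g z) / measure lborel (B \<delta>)) \<longlongrightarrow> u y - u x) (at_right 0)"
proof (rule tendstoI)
  fix e :: real assume e: "e > 0"
  let ?\<Delta> = "u y - u x"
  have v: "norm v > 0" using xy by (simp add: v_def)
  have B: "B \<delta> \<in> sets borel" "bounded (B \<delta>)" for \<delta>
    by (simp_all add: B_def borel_nbhd bounded_nbhd compact_imp_bounded)
  define w where "w z = u z - u x - ?\<Delta> * ((z - x) \<bullet> v) / (norm v)\<^sup>2" for z
  have w0: "w x = 0" "w y = 0"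
    using v by (simp_all add: w_def v_def power2_norm_eq_inner)
  have cw: "isCont w x" "isCont w y"
    unfolding w_def[abs_def] using cont v by (auto intro!: continuous_intros)
  \<comment> \<open>The bound on the tube multiplies this oscillation by 4, which leaves
    e/2.\<close>
  obtain r1 where r1: "r1 > 0" "\<And>z. dist z x < r1 \<Longrightarrow> dist (w z) (w x) < e / 8"
    using cw(1) e unfolding continuous_at_eps_delta by (metis zero_less_divide_iff zero_less_numeral)
  obtain r2 where r2: "r2 > 0" "\<And>z. dist z y < r2 \<Longrightarrow> dist (w z) (w y) < e / 8"
    using cw(2) e unfolding continuous_at_eps_delta by (metis zero_less_divide_iff zero_less_numeral)
  define \<eta> where "\<eta> = min (min r1 r2) (min d (norm v / 4))"
  have \<eta>: "\<eta> > 0" "\<eta> \<le> d" "4 * \<eta> \<le> norm v" "\<eta> \<le> r1" "\<eta> \<le> r2"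
    using r1 r2 d v by (auto simp: \<eta>_def)
  have \<omega>: "\<bar>w z\<bar> \<le> e / 8" if "dist z x < \<eta> \<or> dist z y < \<eta>" for z
    using that r1(2)[of z] r2(2)[of z] \<eta> w0 by (auto simp: dist_real_def)
  \<comment> \<open>For \<delta> < \<eta>/2, shifts with s \<le> S keep \<delta> + s |v| \<le>
    \<eta>.\<close>
  define S where "S = min s0 (\<eta> / (2 * norm v))"
  have S: "S > 0" using lip(1) \<eta>(1) v by (simp add: S_def)
  have bound: "\<bar>(LINT z:B \<delta>|lborel. g z) - ?\<Delta> * measure lborel (B \<delta>)\<bar> \<le> e / 2 * measure lborel (B \<delta>)"
    if \<delta>: "0 < \<delta>" "\<delta> < \<eta> / 2" for \<delta>
  proof -
    have B\<delta>: "B \<delta> \<subseteq> B (d / 2)" unfolding B_def using \<delta> \<eta>(2) by (intro nbhd_mono) linarith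
    have fin: "emeasure lborel (B \<delta>) < \<infinity>" using finite_lborel_bounded[OF B(2)[of \<delta>]] by (simp add: less_top)
    define s where "s k = S / real (Suc k)" for k
    have s: "0 < s k" "s k \<le> s0" "s k * norm v \<le> \<eta> / 2" for k
    proof -
      show "0 < s k" using S by (simp add: s_def)
      have "s k \<le> S" using S by (simp add: s_def divide_le_eq)
      then show "s k \<le> s0" "s k * norm v \<le> \<eta> / 2"
        using v by (auto simp: S_def field_simps)
    qed
    have s_lim: "filterlim s (at_right 0) sequentially"
    proof -
      have "(\<lambda>k. S * (1 / real (Suc k))) \<longlonglongrightarrow> S * 0" by (intro tendsto_intros LIMSEQ_Suc[OF lim_1_over_n])
      then have "s \<longlonglongrightarrow> 0" by (simp add: s_def[abs_def])
      then show ?thesis unfolding filterlim_at using s(1) by (auto simp: less_imp_neq[symmetric] intro!: always_eventually)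
    qed
    define q where "q k z = (u (z + s k *\<^sub>R v) - u z) / s k" for k z
    have "(\<lambda>k. LINT z|lborel. indicator (B \<delta>) z *\<^sub>R q k z) \<longlonglongrightarrow> (LINT z|lborel. indicator (B \<delta>) z *\<^sub>R g z)"
    proof (rule integral_dominated_convergence[where w="\<lambda>z. \<bar>M\<bar> * indicator (B \<delta>) z"])
      show "(\<lambda>z. indicator (B \<delta>) z *\<^sub>R g z) \<in> borel_measurable lborel" using B(1) g by measurable
      show "(\<lambda>z. indicator (B \<delta>) z *\<^sub>R q k z) \<in> borel_measurable lborel" for k
        unfolding q_def using B(1) u by measurable
      show "integrable lborel (\<lambda>z. \<bar>M\<bar> * indicator (B \<delta>) z)"
        using B(1) fin by (intro integrable_mult_right integrable_real_indicator) auto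
      show "AE z in lborel. norm (indicator (B \<delta>) z *\<^sub>R q k z) \<le> \<bar>M\<bar> * indicator (B \<delta>) z" for k
      proof (rule AE_I2)
        fix z
        show "norm (indicator (B \<delta>) z *\<^sub>R q k z) \<le> \<bar>M\<bar> * indicator (B \<delta>) z"
        proof (cases "z \<in> B \<delta>")
          case True
          then have "\<bar>u (z + s k *\<^sub>R v) - u z\<bar> \<le> M * s k" using lip(2) B\<delta> s by blast
          also have "\<dots> \<le> \<bar>M\<bar> * s k" using s(1)[of k] by (intro mult_right_mono) auto
          finally show ?thesis using True s(1)[of k] by (simp add: q_def abs_divide pos_divide_le_eq)
        qed simp
      qed
      show "AE z in lborel. (\<lambda>k. indicator (B \<delta>) z *\<^sub>R q k z) \<longlonglongrightarrow> indicator (B \<delta>) z *\<^sub>R g z"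
        using diff
      proof (rule AE_mp, intro AE_I2 impI)
        fix z assume "z \<in> B (d/2) \<longrightarrow> ((\<lambda>s. (u (z + s *\<^sub>R v) - u z) / s) \<longlongrightarrow> g z) (at_right 0)"
        then show "(\<lambda>k. indicator (B \<delta>) z *\<^sub>R q k z) \<longlonglongrightarrow> indicator (B \<delta>) z *\<^sub>R g z"
          using B\<delta> filterlim_compose[OF _ s_lim, of "\<lambda>s. (u (z + s *\<^sub>R v) - u z) / s"]
          by (cases "z \<in> B \<delta>") (auto simp: q_def)
      qed
    qed
    then have lim: "(\<lambda>k. LINT z:B \<delta>|lborel. q k z) \<longlonglongrightarrow> (LINT z:B \<delta>|lborel. g z)"
      by (simp add: set_lebesgue_integral_def)
    have "\<bar>(LINT z:B \<delta>|lborel. q k z) - ?\<Delta> * measure lborel (B \<delta>)\<bar> \<le> e / 2 * measure lborel (B \<delta>)" for k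
    proof -
      have "\<bar>(LINT z:B \<delta>|lborel. u (z + s k *\<^sub>R v) - u z) - s k * ?\<Delta> * measure lborel (B \<delta>)\<bar>
        \<le> 4 * (e / 8) * s k * measure lborel (B \<delta>)"
        unfolding B_def v_def
      proof (rule tube_difference_bound[where d=d and \<eta>=\<eta> and K=K])
        show "\<delta> + s k * norm (y - x) \<le> \<eta>" using \<delta> s(3)[of k] unfolding v_def by linarith
      qed (use xy u K s \<delta> \<eta> \<omega> in \<open>auto simp: B_def v_def w_def\<close>)
      then have "\<bar>(LINT z:B \<delta>|lborel. u (z + s k *\<^sub>R v) - u z) - s k * ?\<Delta> * measure lborel (B \<delta>)\<bar> / s k
        \<le> e / 2 * measure lborel (B \<delta>)"
        using s(1)[of k] by (simp add: pos_divide_le_eq mult_ac)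
      moreover have "(LINT z:B \<delta>|lborel. q k z) = (LINT z:B \<delta>|lborel. u (z + s k *\<^sub>R v) - u z) / s k"
        by (simp add: q_def)
      moreover have "\<bar>X - S * D * m\<bar> / S = \<bar>X / S - D * m\<bar>" if "S > 0" for X S D m :: real
      proof -
        have "X / S - D * m = (X - S * D * m) / S" using that by (simp add: diff_divide_distrib)
        then show ?thesis using that by (simp add: abs_divide)
      qed
      ultimately show ?thesis using s(1)[of k] by simp
    qed
    moreover have "(\<lambda>k. \<bar>(LINT z:B \<delta>|lborel. q k z) - ?\<Delta> * measure lborel (B \<delta>)\<bar>)
      \<longlonglongrightarrow> \<bar>(LINT z:B \<delta>|lborel. g z) - ?\<Delta> * measure lborel (B \<delta>)\<bar>"
      by (intro tendsto_intros lim)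
    ultimately show ?thesis by (intro LIMSEQ_le_const2) auto
  qed
  have "\<forall>\<^sub>F \<delta> in at_right 0. 0 < \<delta> \<and> \<delta> < \<eta> / 2"
    using eventually_at_right_real[of 0 "\<eta> / 2"] \<eta>(1) by (auto elim: eventually_mono)
  then show "\<forall>\<^sub>F \<delta> in at_right 0. dist ((LINT z:B \<delta>|lborel. g z) / measure lborel (B \<delta>)) ?\<Delta> < e"
  proof eventually_elim
    case (elim \<delta>)
    then have m: "measure lborel (B \<delta>) > 0"
      unfolding B_def by (intro measure_nbhd_pos) (auto intro: compact_imp_bounded)
    have "\<bar>I / m - D\<bar> \<le> e / 2" if "\<bar>I - D * m\<bar> \<le> e / 2 * m" "m > 0" for I D m :: real
    proof -
      have "I / m - D = (I - D * m) / m" using that(2) by (simp add: diff_divide_distrib)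
      then show ?thesis using that by (simp add: abs_divide pos_divide_le_eq)
    qed
    from this[OF bound m] elim have "\<bar>(LINT z:B \<delta>|lborel. g z) / measure lborel (B \<delta>) - ?\<Delta>\<bar> \<le> e / 2" by blast
    then show ?case using e by (simp add: dist_real_def)
  qed
qed

section \<open>The mean value theorem\<close>

lemma norm_nth_nth_le: "\<bar>(A :: real^'n::finite^'m::finite) $ i $ j\<bar> \<le> norm A"
  by (rule order_trans[OF component_le_norm_cart Finite_Cartesian_Product.norm_nth_le])

lemma borel_measurable_vec_nth:
  fixes G :: "'a \<Rightarrow> 'b::real_normed_vector^'m::finite"
  assumes "G \<in> borel_measurable M" shows "(\<lambda>z. G z $ i) \<in> borel_measurable M"
proof -
  have "continuous_on UNIV (\<lambda>x :: 'b^'m. x $ i)" by (intro continuous_intros)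
  from borel_measurable_continuous_onI[OF this] show ?thesis
    by (rule measurable_compose[OF assms])
qed

lemma set_integrable_compact_iff:
  fixes h :: "'a::euclidean_space \<Rightarrow> real"
  assumes "compact K"
  shows "set_integrable lebesgue K h \<longleftrightarrow> integrable (lebesgue_on K) h"
  unfolding set_integrable_def
  using assms by (subst integrable_restrict_space) (auto simp: borel_compact)

lemma weak_jacobian_component:
  fixes f :: "real^'n::finite \<Rightarrow> real^'m::finite"
  assumes "weak_jacobian \<Omega> f G"
  shows "weak_gradient \<Omega> (\<lambda>z. f z $ i) (\<lambda>z. G z $ i)"
  unfolding weak_gradient_def
proof (intro conjI allI impI ballI)
  fix K j assume K: "compact K \<and> K \<subseteq> \<Omega>"
  then have "Lp_on 1 K G" using assms by (auto simp: weak_jacobian_def Lp_loc_def)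
  then have G: "G \<in> borel_measurable (lebesgue_on K)" "integrable (lebesgue_on K) (\<lambda>z. norm (G z) powr 1)"
    by (auto simp: Lp_on_def)
  have "integrable (lebesgue_on K) (\<lambda>z. G z $ i $ j)"
  proof (rule Bochner_Integration.integrable_bound[OF G(2)])
    show "(\<lambda>z. G z $ i $ j) \<in> borel_measurable (lebesgue_on K)"
      by (intro borel_measurable_vec_nth G)
    show "AE z in lebesgue_on K. norm (G z $ i $ j) \<le> norm (norm (G z) powr 1)"
      by (intro AE_I2) (simp add: norm_nth_nth_le)
  qed
  then show "set_integrable lebesgue K (\<lambda>z. G z $ i $ j)"
    using K by (simp add: set_integrable_compact_iff)
next
  fix \<phi> j assume "\<phi> \<in> test_functions \<Omega>"
  then show "(LINT z:\<Omega>|lebesgue. f z $ i * pdiff j \<phi> z) = - (LINT z:\<Omega>|lebesgue. G z $ i $ j * \<phi> z)"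
    using assms by (auto simp: weak_jacobian_def)
qed

text \<open>Morrey's estimate is stated for a finite exponent. For p = \<infinity> local boundedness
  on compact sets allows any finite one, here N + 1.\<close>

lemma Lp_loc_component_powr:
  fixes G :: "real^'n::finite \<Rightarrow> real^'n^'m::finite"
  assumes p: "of_nat N < p" and G: "Lp_loc p \<Omega> G"
  obtains q where "q > real N"
    "\<And>K. compact K \<Longrightarrow> K \<subseteq> \<Omega> \<Longrightarrow> set_integrable lebesgue K (\<lambda>z. norm (G z $ i) powr q)"
proof -
  define q where "q = (if p = top then real N + 1 else enn2real p)"
  have q: "q > real N"
  proof (cases "p = top")
    case False
    then obtain r where r: "p = ennreal r" "r \<ge> 0" by (cases p) auto
    have "ennreal (real N) < ennreal r" using p r(1) by (simp add: ennreal_of_nat_eq_real_of_nat)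
    then show ?thesis using r by (simp add: q_def ennreal_less_iff)
  qed (simp add: q_def)
  then have q0: "q > 0" by (rule order_le_less_trans[rotated]) simp
  moreover have "set_integrable lebesgue K (\<lambda>z. norm (G z $ i) powr q)" if K: "compact K" "K \<subseteq> \<Omega>" for K
  proof -
    have L: "Lp_on p K G" using G K by (auto simp: Lp_loc_def)
    then have m: "G \<in> borel_measurable (lebesgue_on K)" by (simp add: Lp_on_def)
    have [measurable]: "(\<lambda>z. G z $ i) \<in> borel_measurable (lebesgue_on K)" by (intro borel_measurable_vec_nth m)
    have mp: "(\<lambda>z. norm (G z $ i) powr q) \<in> borel_measurable (lebesgue_on K)" by measurable
    have le: "norm (G z $ i) powr q \<le> norm (G z) powr q" for z
      using q0 Finite_Cartesian_Product.norm_nth_le[of "G z" i] by (intro powr_mono2) auto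
    have "integrable (lebesgue_on K) (\<lambda>z. norm (G z $ i) powr q)"
    proof (cases "p = top")
      case True
      then obtain M where M: "AE z in lebesgue_on K. norm (G z) \<le> M" using L by (auto simp: Lp_on_def)
      have "finite_measure (lebesgue_on K)"
        using K lmeasurable_compact[of K] by (intro finite_measure_lebesgue_on) auto
      then show ?thesis
      proof (rule finite_measure.integrable_const_bound[where B="\<bar>M\<bar> powr q"])
        show "AE z in lebesgue_on K. norm (norm (G z $ i) powr q) \<le> \<bar>M\<bar> powr q"
          using M
        proof (rule AE_mp, intro AE_I2 impI)
          fix z assume "norm (G z) \<le> M"
          then have "norm (G z) powr q \<le> \<bar>M\<bar> powr q" using q0 by (intro powr_mono2) auto
          then show "norm (norm (G z $ i) powr q) \<le> \<bar>M\<bar> powr q" using le[of z] by simp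
        qed
      qed (rule mp)
    next
      case False
      then have I: "integrable (lebesgue_on K) (\<lambda>z. norm (G z) powr q)" using L by (simp add: Lp_on_def q_def)
      show ?thesis
        by (rule Bochner_Integration.integrable_bound[OF I mp]) (use le in auto)
    qed
    then show ?thesis using K by (simp add: set_integrable_compact_iff)
  qed
  ultimately show ?thesis using that q by blast
qed

lemma has_derivative_matrix_rows:
  fixes f :: "real^'n::finite \<Rightarrow> real^'m::finite" and A :: "real^'n^'m"
  assumes "\<And>i. ((\<lambda>z. f z $ i) has_derivative (\<lambda>h. A $ i \<bullet> h)) (at z)"
  shows "(f has_derivative (\<lambda>h. A *v h)) (at z)"
  unfolding has_derivative_componentwise_within[of f]
  using assms by (auto simp: Basis_vec_def inner_axis matrix_vector_mul_component)

text \<open>Links \<open>Df\<close>, a pointwise derivative, to the weak derivative, so that the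
  assumed bound on \<open>Df f z *v v\<close> becomes one on the weak gradient.\<close>

lemma sobolev_loc_differentiable_AE:
  fixes f :: "real^'n::finite \<Rightarrow> real^'m::finite"
  assumes \<Omega>: "open \<Omega>" and p: "of_nat CARD('n) < p" and G: "weak_jacobian \<Omega> f G" "Lp_loc p \<Omega> G"
    and f: "continuous_on \<Omega> f"
  shows "AE z in lebesgue. z \<in> \<Omega> \<longrightarrow> (f has_derivative (\<lambda>h. G z *v h)) (at z) \<and> Df f z = G z"
proof -
  have "AE z in lebesgue. z \<in> \<Omega> \<longrightarrow> ((\<lambda>z. f z $ i) has_derivative (\<lambda>h. G z $ i \<bullet> h)) (at z)" for i
  proof -
    obtain q where q: "q > real CARD('n)"
      "\<And>K. compact K \<Longrightarrow> K \<subseteq> \<Omega> \<Longrightarrow> set_integrable lebesgue K (\<lambda>z. norm (G z $ i) powr q)"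
      using Lp_loc_component_powr[OF p G(2)] by blast
    show ?thesis
    proof (rule weak_gradient_has_derivative[OF \<Omega> _ weak_jacobian_component[OF G(1)] q(1) _ q(2)])
      show "continuous_on \<Omega> (\<lambda>z. f z $ i)" using f by (intro continuous_intros)
      show "(\<lambda>z. G z $ i) \<in> borel_measurable (lebesgue_on K)" if "compact K" "K \<subseteq> \<Omega>" for K
        using G(2) that by (intro borel_measurable_vec_nth) (auto simp: Lp_loc_def Lp_on_def)
    qed
  qed
  then have "AE z in lebesgue. \<forall>i. z \<in> \<Omega> \<longrightarrow> ((\<lambda>z. f z $ i) has_derivative (\<lambda>h. G z $ i \<bullet> h)) (at z)"
    unfolding AE_all_countable by (rule allI)
  then show ?thesis
  proof (rule AE_mp, intro AE_I2 impI)
    fix z assume "\<forall>i. z \<in> \<Omega> \<longrightarrow> ((\<lambda>z. f z $ i) has_derivative (\<lambda>h. G z $ i \<bullet> h)) (at z)" "z \<in> \<Omega>"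
    then have d: "(f has_derivative (\<lambda>h. G z *v h)) (at z)" by (intro has_derivative_matrix_rows) blast
    moreover have "Df f z = G z"
      using frechet_derivative_at[OF d] by (simp add: Df_def jacobian_def flip: frechet_derivative_at[OF d])
    ultimately show "(f has_derivative (\<lambda>h. G z *v h)) (at z) \<and> Df f z = G z" ..
  qed
qed

text \<open>Tubes of radius at most d lie in \<Omega>, so the denominators of
  \<open>density_ratio\<close> are volumes of tubes. Positivity comes from the Liminf, and total
  mass 1 from the ratio of \<Omega>, which is eventually constant.\<close>

lemma Dens_density_charge:
  fixes \<Omega> :: "(real^'n::finite) set"
  assumes n: "CARD('n) \<ge> 2" and \<Omega>: "open \<Omega>" and d: "d > 0" "nbhd (closed_segment x y) d \<subseteq> \<Omega>"
    and \<mu>: "\<mu> \<in> Dens \<Omega> (closed_segment x y)"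
  shows "density_charge \<Omega> \<mu> (nbhd (closed_segment x y)) d"
proof -
  let ?C = "closed_segment x y" and ?m = "measure lborel"
  have C: "compact ?C" "?C \<noteq> {}" "bounded ?C" "convex ?C" by (auto intro: compact_imp_bounded)
  have ev: "\<forall>\<^sub>F \<delta> in at_right 0. 0 < \<delta> \<and> \<Omega> \<inter> nbhd ?C \<delta> = nbhd ?C \<delta> \<and> ?m (nbhd ?C \<delta>) > 0"
    using eventually_at_right_real[OF d(1)]
  proof eventually_elim
    case (elim \<delta>)
    then have "nbhd ?C \<delta> \<subseteq> \<Omega>" using nbhd_mono[of \<delta> d ?C] d(2) by auto
    then show ?case using elim measure_nbhd_pos[OF C(3,2), of \<delta>] by auto
  qed
  have \<mu>D: "Liminf (at_right 0) (density_ratio \<Omega> ?C A) \<le> ereal (\<mu> A)"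
      "ereal (\<mu> A) \<le> Limsup (at_right 0) (density_ratio \<Omega> ?C A)" if "A \<in> borel_subsets \<Omega>" for A
    using \<mu> that by (auto simp: Dens_def)
  have \<Omega>s: "\<Omega> \<in> borel_subsets \<Omega>" using \<Omega> by (auto simp: borel_subsets_def)
  have le: "\<mu> A \<le> L" if A: "A \<in> borel_subsets \<Omega>"
    and L: "\<And>e. e > 0 \<Longrightarrow> \<forall>\<^sub>F \<delta> in at_right 0. ?m (A \<inter> nbhd ?C \<delta>) \<le> (L + e) * ?m (nbhd ?C \<delta>)" for A L
  proof (rule field_le_epsilon)
    fix e :: real assume e: "e > 0"
    have "\<forall>\<^sub>F \<delta> in at_right 0. density_ratio \<Omega> ?C A \<delta> \<le> ereal (L + e)"
      using L[OF e] ev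
    proof eventually_elim
      case (elim \<delta>)
      have "A \<inter> \<Omega> \<inter> nbhd ?C \<delta> = A \<inter> nbhd ?C \<delta>" using A by (auto simp: borel_subsets_def)
      then show ?case using elim by (simp add: density_ratio_def pos_divide_le_eq)
    qed
    then have "Limsup (at_right 0) (density_ratio \<Omega> ?C A) \<le> ereal (L + e)" by (rule Limsup_bounded)
    then have "ereal (\<mu> A) \<le> ereal (L + e)" using \<mu>D(2)[OF A] by (rule order_trans[rotated])
    then show "\<mu> A \<le> L + e" by simp
  qed
  show ?thesis
  proof
    show "\<Omega> \<in> sets borel" using \<Omega> by simp
    show "\<mu> (A \<union> B) = \<mu> A + \<mu> B" if "A \<in> borel_subsets \<Omega>" "B \<in> borel_subsets \<Omega>" "A \<inter> B = {}" for A B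
      using \<mu> that by (auto simp: Dens_def ba_def)
    show "0 \<le> \<mu> A" if A: "A \<in> borel_subsets \<Omega>" for A
    proof -
      have "ereal 0 \<le> Liminf (at_right 0) (density_ratio \<Omega> ?C A)"
        by (intro Liminf_bounded always_eventually allI) (simp add: density_ratio_def)
      then have "ereal 0 \<le> ereal (\<mu> A)" using \<mu>D(1)[OF A] by (rule order_trans)
      then show ?thesis by simp
    qed
    show "\<mu> \<Omega> = 1"
    proof (rule antisym)
      show "\<mu> \<Omega> \<le> 1"
      proof (rule le[OF \<Omega>s])
        fix e :: real assume "e > 0"
        then show "\<forall>\<^sub>F \<delta> in at_right 0. ?m (\<Omega> \<inter> nbhd ?C \<delta>) \<le> (1 + e) * ?m (nbhd ?C \<delta>)"
          using ev by (auto elim!: eventually_mono)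
      qed
      have "\<forall>\<^sub>F \<delta> in at_right 0. ereal 1 \<le> density_ratio \<Omega> ?C \<Omega> \<delta>"
        using ev by eventually_elim (simp add: density_ratio_def)
      then have "ereal 1 \<le> Liminf (at_right 0) (density_ratio \<Omega> ?C \<Omega>)" by (rule Liminf_bounded)
      then have "ereal 1 \<le> ereal (\<mu> \<Omega>)" using \<mu>D(1)[OF \<Omega>s] by (rule order_trans)
      then show "1 \<le> \<mu> \<Omega>" by simp
    qed
    show "(\<lambda>k. ?m (nbhd ?C (d / real (Suc k)))) \<longlonglongrightarrow> 0"
      by (rule measure_nbhd_null[OF C(1,2) negligible_closed_segment d(1)]) (use n in simp)
    show "?m (nbhd ?C (c * \<delta>)) \<le> c ^ DIM(real^'n) * ?m (nbhd ?C \<delta>)" if "0 < \<delta>" "1 \<le> c" for \<delta> c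
      by (rule measure_nbhd_scale[OF C(4,3,2) that])
    show "nbhd ?C \<delta> \<subseteq> nbhd ?C \<delta>'" if "\<delta> \<le> \<delta>'" for \<delta> \<delta>' by (rule nbhd_mono[OF that])
    show "0 < ?m (nbhd ?C \<delta>)" if "0 < \<delta>" for \<delta> by (rule measure_nbhd_pos[OF C(3,2) that])
  qed (use le d bounded_nbhd[OF C(3)] borel_nbhd in auto)
qed

text \<open>The lemmas on averages require Borel functions on the whole space, while f matters only
  on \<Omega> and \<open>Df\<close> is only Lebesgue measurable on the tube. So f is extended by 0
  to u, and \<open>Df f z *v v\<close> is replaced by a bounded Borel g that agrees with it almost
  everywhere in the tube.\<close>

lemma fa_integral_directional_derivative:
  fixes f :: "real^'n::finite \<Rightarrow> real^'m::finite"
  assumes n: "CARD('n) \<ge> 2" and \<Omega>: "open \<Omega>" and xy: "x \<noteq> y" "closed_segment x y \<subseteq> \<Omega>"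
    and p: "of_nat CARD('n) < p" and f: "sobolev_loc p \<Omega> f" "continuous_on \<Omega> f"
    and d: "d > 0" "nbhd (closed_segment x y) d \<subseteq> \<Omega>"
      "Lp_on top (nbhd (closed_segment x y) d) (\<lambda>z. Df f z *v (y - x))"
    and \<mu>: "\<mu> \<in> Dens \<Omega> (closed_segment x y)"
  shows "fa_integrable \<Omega> \<mu> (\<lambda>z. (Df f z *v (y - x)) $ i) \<and>
    fa_integral \<Omega> \<mu> (\<lambda>z. (Df f z *v (y - x)) $ i) = f y $ i - f x $ i"
proof -
  let ?C = "closed_segment x y" and ?v = "y - x"
  let ?B = "nbhd ?C"
  let ?n = "real CARD('n)"
  have C: "compact ?C" by simp
  obtain G where G: "weak_jacobian \<Omega> f G" "Lp_loc p \<Omega> G" using f(1) by (auto simp: sobolev_loc_def)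
  have D: "AE z in lebesgue. z \<in> \<Omega> \<longrightarrow> (f has_derivative (\<lambda>h. G z *v h)) (at z) \<and> Df f z = G z"
    by (rule sobolev_loc_differentiable_AE[OF \<Omega> p G f(2)])
  note W = weak_jacobian_component[OF G(1), of i]
  have cf: "continuous_on \<Omega> (\<lambda>z. f z $ i)" using f(2) by (intro continuous_intros)
  have Bs: "?B d \<in> sets lebesgue" using borel_nbhd[of ?C d] by simp
  define g0 where "g0 z = (Df f z *v ?v) $ i" for z
  obtain M0 where M0: "AE z in lebesgue_on (?B d). norm (Df f z *v ?v) \<le> M0" using d(3) by (auto simp: Lp_on_def)
  define M where "M = \<bar>M0\<bar>"
  have M: "AE z in lebesgue. z \<in> ?B d \<longrightarrow> \<bar>g0 z\<bar> \<le> M"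
  proof -
    have "AE z in lebesgue. z \<in> ?B d \<longrightarrow> norm (Df f z *v ?v) \<le> M0"
      using M0 Bs by (subst (asm) AE_restrict_space_iff) auto
    then show ?thesis
    proof (rule AE_mp, intro AE_I2 impI)
      fix z assume "z \<in> ?B d \<longrightarrow> norm (Df f z *v ?v) \<le> M0" "z \<in> ?B d"
      then show "\<bar>g0 z\<bar> \<le> M"
        using component_le_norm_cart[of "Df f z *v ?v" i] unfolding g0_def M_def by linarith
    qed
  qed
  have MG: "AE z in lebesgue. z \<in> ?B d \<longrightarrow> \<bar>G z $ i \<bullet> ?v\<bar> \<le> M"
    using M D
  proof eventually_elim
    case (elim z)
    then show ?case using d(2) by (auto simp: g0_def matrix_vector_mul_component)
  qed
  have "(\<lambda>z. indicator (?B d) z *\<^sub>R g0 z) \<in> borel_measurable lebesgue"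
  proof -
    have "(\<lambda>z. Df f z *v ?v) \<in> borel_measurable (lebesgue_on (?B d))" using d(3) by (simp add: Lp_on_def)
    from borel_measurable_vec_nth[OF this, of i] show ?thesis
      using Bs unfolding g0_def by (subst (asm) borel_measurable_restrict_space_iff) auto
  qed
  then obtain g1 where g1: "g1 \<in> borel_measurable lborel" "AE z in lborel. indicator (?B d) z *\<^sub>R g0 z = g1 z"
    using completion_ex_borel_measurable_real by blast
  \<comment> \<open>The truncation makes the Borel version bounded everywhere; almost everywhere in
    the tube it changes nothing.\<close>
  define g where "g z = max (- M) (min M (g1 z))" for z
  have g_meas: "g \<in> borel_measurable borel" unfolding g_def[abs_def] using g1(1) by simp
  have g_bd: "\<bar>g z\<bar> \<le> M" for z by (auto simp: g_def M_def)
  have gg: "AE z in lborel. z \<in> ?B d \<longrightarrow> g0 z = g z"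
    using g1(2) M[unfolded AE_completion_iff]
  proof eventually_elim
    case (elim z)
    show ?case
    proof
      assume "z \<in> ?B d"
      then have "g0 z = g1 z" "\<bar>g1 z\<bar> \<le> M" using elim by auto
      then show "g0 z = g z" by (auto simp: g_def abs_le_iff)
    qed
  qed
  define u where "u z = (if z \<in> \<Omega> then f z $ i else 0)" for z
  have u_meas: "u \<in> borel_measurable borel"
  proof -
    have "(\<lambda>z. indicator \<Omega> z *\<^sub>R f z $ i) \<in> borel_measurable borel"
      using \<Omega> cf by (intro borel_measurable_continuous_on_indicator) auto
    moreover have "u = (\<lambda>z. indicator \<Omega> z *\<^sub>R f z $ i)" by (auto simp: u_def indicator_def)
    ultimately show ?thesis by simp
  qed
  have u_cont: "isCont u z" if "z \<in> \<Omega>" for z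
  proof -
    have "isCont (\<lambda>z. f z $ i) z" using cf \<Omega> that by (simp add: continuous_on_eq_continuous_at)
    moreover have "\<forall>\<^sub>F z in nhds z. u z = f z $ i"
      using eventually_nhds_in_open[OF \<Omega> that] by eventually_elim (simp add: u_def)
    ultimately show ?thesis using isCont_cong[of u "\<lambda>z. f z $ i" z] by simp
  qed
  have xC: "x \<in> \<Omega>" "y \<in> \<Omega>" using xy(2) by auto
  \<comment> \<open>Half the width serves twice: the closure of the tube of radius e is a compact
    subset of \<Omega>, which bounds u, and a ball of radius e around a point of the tube of radius
    e/2 stays in the tube of radius d.\<close>
  define e where "e = d / 2"
  have e: "e > 0" "e < d" using d(1) by (auto simp: e_def)
  obtain K where K: "\<And>z. z \<in> ?B e \<Longrightarrow> \<bar>u z\<bar> \<le> K"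
  proof -
    have cl: "closure (?B e) \<subseteq> ?B d"
    proof
      fix z assume "z \<in> closure (?B e)"
      moreover have "d - e > 0" using e by simp
      ultimately obtain w where w: "w \<in> ?B e" "dist w z < d - e"
        using closure_approachable[of z "?B e"] by blast
      have "ball w (d - e) \<subseteq> ?B (e + (d - e))" by (rule ball_subset_nbhd[OF w(1)])
      then show "z \<in> ?B d" using w(2) by auto
    qed
    have "compact (closure (?B e))" using bounded_nbhd[of ?C e] compact_imp_bounded[OF C] by simp
    moreover have "continuous_on (closure (?B e)) (\<lambda>z. f z $ i)"
      using cl d(2) by (intro continuous_on_subset[OF cf]) auto
    ultimately have "bounded ((\<lambda>z. f z $ i) ` closure (?B e))"
      by (intro compact_imp_bounded compact_continuous_image)
    then obtain K where K: "\<And>z. z \<in> closure (?B e) \<Longrightarrow> \<bar>f z $ i\<bar> \<le> K" unfolding bounded_iff by auto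
    have "\<bar>u z\<bar> \<le> K" if "z \<in> ?B e" for z
    proof -
      have "z \<in> closure (?B e)" using that closure_subset by blast
      then show ?thesis using K[of z] cl d(2) by (auto simp: u_def)
    qed
    then show ?thesis using that by blast
  qed
  \<comment> \<open>\<open>directional_Lipschitz\<close> asks for n |s v| < e; this choice gives at
    most e/2.\<close>
  define s0 where "s0 = e / (2 * ?n * norm ?v)"
  have nv: "?n > 0" "norm ?v > 0" using xy(1) by auto
  have s0: "s0 > 0" using e nv by (simp add: s0_def)
  have lip: "\<bar>u (z + s *\<^sub>R ?v) - u z\<bar> \<le> M * s" if z: "z \<in> ?B (e / 2)" and s: "0 < s" "s \<le> s0" for z s
  proof -
    have ball: "ball z e \<subseteq> ?B d"
    proof -
      have "ball z e \<subseteq> ?B (e / 2 + e)" by (rule ball_subset_nbhd[OF z])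
      also have "\<dots> \<subseteq> ?B d" by (rule nbhd_mono) (use d(1) in \<open>simp add: e_def\<close>)
      finally show ?thesis .
    qed
    have n1: "1 \<le> ?n" using n by simp
    have "s * (?n * norm ?v) \<le> s0 * (?n * norm ?v)" using s nv by (intro mult_right_mono) auto
    also have "\<dots> = e / 2" using nv by (simp add: s0_def)
    finally have small: "?n * norm (s *\<^sub>R ?v) < e" using s e by (simp add: mult_ac)
    have "\<bar>f (z + s *\<^sub>R ?v) $ i - f z $ i\<bar> \<le> M * s"
    proof (rule directional_Lipschitz[OF \<Omega> cf W _ _ small])
      show "ball z e \<subseteq> \<Omega>" using ball d(2) by blast
      show "AE w in lebesgue. w \<in> ball z e \<longrightarrow> \<bar>G w $ i \<bullet> (s *\<^sub>R ?v)\<bar> \<le> M * s"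
        using MG
      proof (rule AE_mp, intro AE_I2 impI)
        fix w assume "w \<in> ?B d \<longrightarrow> \<bar>G w $ i \<bullet> ?v\<bar> \<le> M" "w \<in> ball z e"
        then have "\<bar>G w $ i \<bullet> ?v\<bar> \<le> M" using ball by blast
        then show "\<bar>G w $ i \<bullet> (s *\<^sub>R ?v)\<bar> \<le> M * s" using s by (simp add: abs_mult mult.commute mult_right_mono)
      qed
    qed
    moreover have "z \<in> \<Omega>" "z + s *\<^sub>R ?v \<in> \<Omega>"
    proof -
      have "norm (s *\<^sub>R ?v) \<le> ?n * norm (s *\<^sub>R ?v)" using mult_right_mono[OF n1, of "norm (s *\<^sub>R ?v)"] by simp
      then have "z + s *\<^sub>R ?v \<in> ball z e" using small by (simp add: dist_norm)
      then show "z + s *\<^sub>R ?v \<in> \<Omega>" using ball d(2) by blast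
      have "z \<in> ball z e" using e by simp
      then show "z \<in> \<Omega>" using ball d(2) by blast
    qed
    ultimately show ?thesis by (simp add: u_def)
  qed
  have diff: "AE z in lborel. z \<in> ?B (e / 2) \<longrightarrow> ((\<lambda>s. (u (z + s *\<^sub>R ?v) - u z) / s) \<longlongrightarrow> g z) (at_right 0)"
    using D[unfolded AE_completion_iff] gg
  proof eventually_elim
    case (elim z)
    show ?case
    proof
      assume "z \<in> ?B (e / 2)"
      then have zd: "z \<in> ?B d" using nbhd_mono[of "e / 2" d ?C] e by auto
      then have z\<Omega>: "z \<in> \<Omega>" using d(2) by blast
      then have "(f has_derivative (\<lambda>h. Df f z *v h)) (at z)" and g0: "g0 z = g z" using elim zd by auto
      then have "((\<lambda>z. f z $ i) has_derivative (\<lambda>h. (Df f z *v h) $ i)) (at z)"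
        by (intro bounded_linear.has_derivative[OF bounded_linear_vec_nth])
      then have ud: "(u has_derivative (\<lambda>h. (Df f z *v h) $ i)) (at z)"
        by (rule has_derivative_transform_within_open[OF _ \<Omega> z\<Omega>]) (simp add: u_def)
      have "((\<lambda>s. z + s *\<^sub>R ?v) has_derivative (\<lambda>s. s *\<^sub>R ?v)) (at 0)"
        by (auto intro!: derivative_eq_intros)
      then have "((\<lambda>s. u (z + s *\<^sub>R ?v)) has_derivative (\<lambda>s. (Df f z *v (s *\<^sub>R ?v)) $ i)) (at 0)"
        using has_derivative_compose[of "\<lambda>s. z + s *\<^sub>R ?v" "\<lambda>s. s *\<^sub>R ?v" 0 UNIV u] ud by simp
      moreover have "(\<lambda>s. (Df f z *v (s *\<^sub>R ?v)) $ i) = (\<lambda>s. g0 z * s)"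
        by (simp add: g0_def fun_eq_iff matrix_vector_mul_component)
      ultimately have "((\<lambda>s. u (z + s *\<^sub>R ?v)) has_real_derivative g0 z) (at 0)"
        by (simp add: has_field_derivative_def)
      then have "((\<lambda>s. (u (z + s *\<^sub>R ?v) - u z) / s) \<longlongrightarrow> g0 z) (at 0)"
        by (simp add: DERIV_def)
      then show "((\<lambda>s. (u (z + s *\<^sub>R ?v) - u z) / s) \<longlongrightarrow> g z) (at_right 0)"
        unfolding g0 by (rule filterlim_mono) (auto simp: at_le)
    qed
  qed
  have lim: "((\<lambda>\<delta>. (LINT z:?B \<delta>|lborel. g z) / measure lborel (?B \<delta>)) \<longlongrightarrow> u y - u x) (at_right 0)"
    by (rule average_tendsto[OF xy(1) u_meas e(1) K u_cont[OF xC(1)] u_cont[OF xC(2)] s0 lip g_meas diff])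
  interpret density_charge \<Omega> \<mu> ?B d
    by (rule Dens_density_charge[OF n \<Omega> d(1,2) \<mu>])
  obtain N where N: "{z \<in> space lborel. \<not> (z \<in> ?B d \<longrightarrow> g0 z = g z)} \<subseteq> N" "emeasure lborel N = 0" "N \<in> sets lborel"
    using gg by (rule AE_E)
  have "fa_integrable \<Omega> \<mu> g0 \<and> fa_integral \<Omega> \<mu> g0 = u y - u x"
    by (rule fa_integral_eq_limit[OF g_meas g_bd _ N(2) _ lim]) (use N in auto)
  then show ?thesis using xC by (simp add: g0_def[abs_def] u_def)
qed

theorem theorem5p18:
  fixes \<Omega> :: "(real^'n::finite) set" and x y :: "real^'n"
    and f :: "real^'n \<Rightarrow> real^'m::finite" and p :: ennreal
    and dens :: "(real^'n) set \<Rightarrow> real"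
  assumes "CARD('n) \<ge> 2"
    and "open \<Omega>" and "x \<in> \<Omega>" and "y \<in> \<Omega>" and "x \<noteq> y" and "closed_segment x y \<subseteq> \<Omega>"
    and "of_nat CARD('n) < p"
    and "sobolev_loc p \<Omega> f" and "continuous_on \<Omega> f"
    and "\<exists>\<delta>>0. nbhd (closed_segment x y) \<delta> \<subseteq> \<Omega> \<and>
               Lp_on top (nbhd (closed_segment x y) \<delta>) (\<lambda>z. Df f z *v (y - x))"
    and "dens \<in> Dens \<Omega> (closed_segment x y)"
  shows "fa_integrable_vec \<Omega> dens (\<lambda>z. Df f z *v (y - x)) \<and>
         f y - f x = fa_integral_vec \<Omega> dens (\<lambda>z. Df f z *v (y - x)) \<and>
         (fa_integrable_mat \<Omega> dens (Df f) \<longrightarrow>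
            f y - f x = fa_integral_mat \<Omega> dens (Df f) *v (y - x))"
proof -
  obtain d where d: "d > 0" "nbhd (closed_segment x y) d \<subseteq> \<Omega>"
      "Lp_on top (nbhd (closed_segment x y) d) (\<lambda>z. Df f z *v (y - x))"
    using assms(10) by blast
  note I = fa_integral_directional_derivative[OF assms(1,2,5-9) d assms(11)]
  have vec: "f y - f x = fa_integral_vec \<Omega> dens (\<lambda>z. Df f z *v (y - x))"
    using I by (simp add: vec_eq_iff fa_integral_vec_def)
  interpret density_charge \<Omega> dens "nbhd (closed_segment x y)" d
    by (rule Dens_density_charge[OF assms(1,2) d(1,2) assms(11)])
  \<comment> \<open>If every entry of \<open>Df f\<close> is integrable, the integral is linear in
    the entries and the constant vector can be taken out.\<close>
  have "fa_integral_mat \<Omega> dens (Df f) *v (y - x) = fa_integral_vec \<Omega> dens (\<lambda>z. Df f z *v (y - x))"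
    if "fa_integrable_mat \<Omega> dens (Df f)"
  proof -
    have "fa_integral \<Omega> dens (\<lambda>z. \<Sum>j\<in>UNIV. Df f z $ i $ j * (y - x) $ j)
      = (\<Sum>j\<in>UNIV. fa_integral \<Omega> dens (\<lambda>z. Df f z $ i $ j) * (y - x) $ j)" for i
      using fa_integral_sum[of UNIV "\<lambda>j z. Df f z $ i $ j" "\<lambda>j. (y - x) $ j"] that
      by (simp add: fa_integrable_mat_def)
    then show ?thesis
      by (simp add: vec_eq_iff fa_integral_mat_def fa_integral_vec_def matrix_vector_mult_def)
  qed
  then show ?thesis using I vec by (simp add: fa_integrable_vec_def)
qed

end
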